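(* Let $X=L^1(\mathbb T,m)$ and let $\mathcal D$ be the set of Dunford--Pettis operators on $X$. There is a positive operator $R\in\mathcal D$ with $\|R\|=1$ such that $$\|R-RT\|\ge 1\quad\text{and}\quad \|R-TR\|\ge 1\qquad\text{for every } T\in\mathcal D.$$ Consequently, the Banach algebra of Dunford--Pettis operators on $L^1[0,1]$ has neither a right approximate identity nor a left approximate identity (where no boundedness of the net is required).
   Context: Scalars are complex. $\mathbb T=\mathbb R/\mathbb Z$ and $m$ is normalized Haar measure on $\mathbb T$; $L^1(\mathbb T,m)$ is isometrically isomorphic to $L^1[0,1]$. A bounded operator is Dunford--Pettis if it maps weakly null sequences to norm-null sequences. Norms of operators are operator norms. An operator on $L^1$ is positive if it maps (a.e.) nonnegative functions to nonnegative functions. A right (respectively left) approximate identity in a Banach algebra $J$ is a net $(e_\alpha)\subseteq J$ with $\|ae_\alpha-a\|\to0$ (respectively $\|e_\alpha a-a\|\to 0$) for every $a\in J$; the net is not assumed bounded. *)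

theory Defs
  imports "HOL-Analysis.Analysis"
begin

section \<open>Complex normed spaces and Dunford--Pettis operators\<close>

text \<open>
  The libraries only provide real normed spaces. Bounded operators are rendered as elements of
  the library type of bounded real-linear maps that also commute with complex scalars; their
  operator norm is the library norm of that type.
\<close>

class complex_normed_space = real_normed_vector +
  fixes scaleC :: "complex \<Rightarrow> 'a \<Rightarrow> 'a"  (infixr "*\<^sub>C" 75)
  assumes scaleC_add_right: "c *\<^sub>C (x + y) = c *\<^sub>C x + c *\<^sub>C y"
    and scaleC_add_left: "(c + d) *\<^sub>C x = c *\<^sub>C x + d *\<^sub>C x"
    and scaleC_scaleC: "c *\<^sub>C d *\<^sub>C x = (c * d) *\<^sub>C x"
    and scaleC_of_real: "complex_of_real r *\<^sub>C x = r *\<^sub>R x"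
    and norm_scaleC: "norm (c *\<^sub>C x) = cmod c * norm x"

instantiation complex :: complex_normed_space
begin

definition scaleC_complex :: "complex \<Rightarrow> complex \<Rightarrow> complex" where
  "scaleC_complex c x = c * x"

instance
  by standard (auto simp: scaleC_complex_def algebra_simps norm_mult scaleR_conv_of_real)

end

definition complex_linear ::
    "('a::complex_normed_space \<Rightarrow>\<^sub>L 'b::complex_normed_space) \<Rightarrow> bool" where
  "complex_linear T \<longleftrightarrow> (\<forall>c x. blinfun_apply T (c *\<^sub>C x) = c *\<^sub>C blinfun_apply T x)"

definition weakly_null :: "(nat \<Rightarrow> 'a::complex_normed_space) \<Rightarrow> bool" where
  "weakly_null x \<longleftrightarrow>
     (\<forall>\<phi> :: 'a \<Rightarrow>\<^sub>L complex. complex_linear \<phi> \<longrightarrow> (\<lambda>n. blinfun_apply \<phi> (x n)) \<longlonglongrightarrow> 0)"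

definition dunford_pettis ::
    "('a::complex_normed_space \<Rightarrow>\<^sub>L 'b::complex_normed_space) set" where
  "dunford_pettis =
     {T. complex_linear T \<and>
         (\<forall>x. weakly_null x \<longrightarrow> (\<lambda>n. norm (blinfun_apply T (x n))) \<longlonglongrightarrow> 0)}"

section \<open>Approximate identities\<close>

definition directed_preorder :: "'i set \<Rightarrow> ('i \<Rightarrow> 'i \<Rightarrow> bool) \<Rightarrow> bool" where
  "directed_preorder I le \<longleftrightarrow>
     I \<noteq> {} \<and> (\<forall>i\<in>I. le i i) \<and>
     (\<forall>i\<in>I. \<forall>j\<in>I. \<forall>k\<in>I. le i j \<longrightarrow> le j k \<longrightarrow> le i k) \<and>
     (\<forall>i\<in>I. \<forall>j\<in>I. \<exists>k\<in>I. le i k \<and> le j k)"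

definition net_null :: "'i set \<Rightarrow> ('i \<Rightarrow> 'i \<Rightarrow> bool) \<Rightarrow> ('i \<Rightarrow> real) \<Rightarrow> bool" where
  "net_null I le r \<longleftrightarrow> (\<forall>\<epsilon>>0. \<exists>i\<in>I. \<forall>j\<in>I. le i j \<longrightarrow> \<bar>r j\<bar> < \<epsilon>)"

text \<open>Here \<open>J\<close> is an algebra of operators, with composition as its product.\<close>

definition right_approximate_identity ::
    "('a::real_normed_vector \<Rightarrow>\<^sub>L 'a) set \<Rightarrow> 'i set \<Rightarrow> ('i \<Rightarrow> 'i \<Rightarrow> bool) \<Rightarrow> ('i \<Rightarrow> 'a \<Rightarrow>\<^sub>L 'a) \<Rightarrow> bool"
  where
  "right_approximate_identity J I le e \<longleftrightarrow>
     directed_preorder I le \<and> (\<forall>i\<in>I. e i \<in> J) \<and>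
     (\<forall>a\<in>J. net_null I le (\<lambda>i. norm ((a o\<^sub>L e i) - a)))"

definition left_approximate_identity ::
    "('a::real_normed_vector \<Rightarrow>\<^sub>L 'a) set \<Rightarrow> 'i set \<Rightarrow> ('i \<Rightarrow> 'i \<Rightarrow> bool) \<Rightarrow> ('i \<Rightarrow> 'a \<Rightarrow>\<^sub>L 'a) \<Rightarrow> bool"
  where
  "left_approximate_identity J I le e \<longleftrightarrow>
     directed_preorder I le \<and> (\<forall>i\<in>I. e i \<in> J) \<and>
     (\<forall>a\<in>J. net_null I le (\<lambda>i. norm ((e i o\<^sub>L a) - a)))"

section \<open>The complex space \<open>L\<^sup>1\<close>\<close>

text \<open>
  A type cannot depend on a measure, so the measure is attached to the underlying type by a
  type class; \<open>'a l1\<close> is then the space of integrable complex functions on \<open>'a\<close> modulo equality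
  almost everywhere.
\<close>

class has_measure =
  fixes base_measure :: "'a measure"

lemma AE_eq_trans:
  "(AE x in M. f x = g x) \<Longrightarrow> (AE x in M. g x = h x) \<Longrightarrow> (AE x in M. f x = h x)"
  by (drule (1) AE_conjI) (erule eventually_mono, simp)

quotient_type (overloaded) 'a l1 = "'a::has_measure \<Rightarrow> complex" / partial:
  "\<lambda>f g. integrable base_measure f \<and> integrable base_measure g \<and> (AE x in base_measure. f x = g x)"
proof (rule part_equivpI)
  show "\<exists>f :: 'a \<Rightarrow> complex. integrable base_measure f \<and> integrable base_measure f \<and>
          (AE x in base_measure. f x = f x)"
    by (rule exI[of _ "\<lambda>_. 0"]) simp
  show "symp (\<lambda>f g :: 'a \<Rightarrow> complex. integrable base_measure f \<and> integrable base_measure g \<and>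
          (AE x in base_measure. f x = g x))"
    by (rule sympI) (simp add: eq_commute)
  show "transp (\<lambda>f g :: 'a \<Rightarrow> complex. integrable base_measure f \<and> integrable base_measure g \<and>
          (AE x in base_measure. f x = g x))"
    by (rule transpI) (blast intro: AE_eq_trans)
qed

instantiation l1 :: (has_measure) complex_normed_space
begin

lift_definition zero_l1 :: "'a l1" is "\<lambda>_. 0"
  by simp

lift_definition plus_l1 :: "'a l1 \<Rightarrow> 'a l1 \<Rightarrow> 'a l1" is "\<lambda>f g x. f x + g x"
  by (auto elim: eventually_elim2)

lift_definition uminus_l1 :: "'a l1 \<Rightarrow> 'a l1" is "\<lambda>f x. - f x"
  by (auto elim: eventually_mono)

lift_definition minus_l1 :: "'a l1 \<Rightarrow> 'a l1 \<Rightarrow> 'a l1" is "\<lambda>f g x. f x - g x"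
  by (auto elim: eventually_elim2)

lift_definition scaleC_l1 :: "complex \<Rightarrow> 'a l1 \<Rightarrow> 'a l1" is "\<lambda>c f x. c * f x"
  by (auto elim: eventually_mono)

lift_definition scaleR_l1 :: "real \<Rightarrow> 'a l1 \<Rightarrow> 'a l1" is "\<lambda>r f x. complex_of_real r * f x"
  by (auto elim: eventually_mono)

lift_definition norm_l1 :: "'a l1 \<Rightarrow> real" is "\<lambda>f. \<integral>x. cmod (f x) \<partial>base_measure"
  by (rule integral_cong_AE) (auto elim: eventually_mono)

definition sgn_l1 :: "'a l1 \<Rightarrow> 'a l1" where
  "sgn_l1 f = inverse (norm f) *\<^sub>R f"

definition dist_l1 :: "'a l1 \<Rightarrow> 'a l1 \<Rightarrow> real" where
  "dist_l1 f g = norm (f - g)"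

definition uniformity_l1 :: "('a l1 \<times> 'a l1) filter" where
  "uniformity_l1 = (INF e\<in>{0<..}. principal {(f, g). dist f g < e})"

definition open_l1 :: "'a l1 set \<Rightarrow> bool" where
  "open_l1 U \<longleftrightarrow> (\<forall>f\<in>U. eventually (\<lambda>(f', g). f' = f \<longrightarrow> g \<in> U) uniformity)"

instance
proof
  fix f g h :: "'a l1" and a b :: real and c d :: complex
  show "f + g + h = f + (g + h)" "f + g = g + f" "0 + f = f" "- f + f = 0" "f - g = f + - g"
    by (transfer; simp add: algebra_simps)+
  show "a *\<^sub>R (f + g) = a *\<^sub>R f + a *\<^sub>R g" "(a + b) *\<^sub>R f = a *\<^sub>R f + b *\<^sub>R f"
       "a *\<^sub>R b *\<^sub>R f = (a * b) *\<^sub>R f" "1 *\<^sub>R f = f"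
    by (transfer; simp add: algebra_simps)+
  show "c *\<^sub>C (f + g) = c *\<^sub>C f + c *\<^sub>C g" "(c + d) *\<^sub>C f = c *\<^sub>C f + d *\<^sub>C f"
       "c *\<^sub>C d *\<^sub>C f = (c * d) *\<^sub>C f" "complex_of_real a *\<^sub>C f = a *\<^sub>R f"
    by (transfer; simp add: algebra_simps)+
  show "norm (a *\<^sub>R f) = \<bar>a\<bar> * norm f" "norm (c *\<^sub>C f) = cmod c * norm f"
    by (transfer; simp add: norm_mult)+
  show "norm (f + g) \<le> norm f + norm g"
  proof transfer
    fix f g :: "'a \<Rightarrow> complex"
    assume "integrable base_measure f \<and> integrable base_measure f \<and> (AE x in base_measure. f x = f x)"
      and "integrable base_measure g \<and> integrable base_measure g \<and> (AE x in base_measure. g x = g x)"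
    then have f: "integrable base_measure f" and g: "integrable base_measure g"
      by auto
    have "(\<integral>x. cmod (f x + g x) \<partial>base_measure) \<le> (\<integral>x. cmod (f x) + cmod (g x) \<partial>base_measure)"
      using f g by (intro integral_mono) (auto intro: norm_triangle_ineq)
    also have "\<dots> = (\<integral>x. cmod (f x) \<partial>base_measure) + (\<integral>x. cmod (g x) \<partial>base_measure)"
      using f g by simp
    finally show "(\<integral>x. cmod (f x + g x) \<partial>base_measure)
        \<le> (\<integral>x. cmod (f x) \<partial>base_measure) + (\<integral>x. cmod (g x) \<partial>base_measure)" .
  qed
  show "norm f = 0 \<longleftrightarrow> f = 0"
    by transfer (auto simp: integral_nonneg_eq_0_iff_AE)
  show "dist f g = norm (f - g)" "sgn f = inverse (norm f) *\<^sub>R f"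
    by (simp_all add: dist_l1_def sgn_l1_def)
  show "(uniformity :: ('a l1 \<times> 'a l1) filter) = (INF e\<in>{0<..}. principal {(f, g). dist f g < e})"
    by (rule uniformity_l1_def)
  show "open U \<longleftrightarrow> (\<forall>f\<in>U. \<forall>\<^sub>F (f', g) in uniformity. f' = f \<longrightarrow> g \<in> U)" for U :: "'a l1 set"
    by (rule open_l1_def)
qed

end

lift_definition nonneg_l1 :: "'a::has_measure l1 \<Rightarrow> bool" is
  "\<lambda>f. AE x in base_measure. f x \<in> \<real>\<^sub>\<ge>\<^sub>0"
proof -
  fix f g :: "'a \<Rightarrow> complex"
  assume *: "integrable base_measure f \<and> integrable base_measure g \<and> (AE x in base_measure. f x = g x)"
  then have "AE x in base_measure. f x \<in> \<real>\<^sub>\<ge>\<^sub>0 \<longleftrightarrow> g x \<in> \<real>\<^sub>\<ge>\<^sub>0"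
    by (auto elim: eventually_mono)
  then show "(AE x in base_measure. f x \<in> \<real>\<^sub>\<ge>\<^sub>0) \<longleftrightarrow> (AE x in base_measure. g x \<in> \<real>\<^sub>\<ge>\<^sub>0)"
    by (rule eventually_subst)
qed

definition positive_operator :: "('a::has_measure l1 \<Rightarrow>\<^sub>L 'b::has_measure l1) \<Rightarrow> bool" where
  "positive_operator T \<longleftrightarrow> (\<forall>f. nonneg_l1 f \<longrightarrow> nonneg_l1 (blinfun_apply T f))"

section \<open>The circle \<open>\<real>/\<int>\<close> and its Haar measure\<close>

quotient_type circle = real / "\<lambda>x y. x - y \<in> \<int>"
  morphisms rep_circle to_circle
proof (rule equivpI)
  show "reflp (\<lambda>x y :: real. x - y \<in> \<int>)"
    by (auto intro: reflpI)
  show "symp (\<lambda>x y :: real. x - y \<in> \<int>)"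
    by (rule sympI) (drule Ints_minus, simp)
  show "transp (\<lambda>x y :: real. x - y \<in> \<int>)"
  proof (rule transpI)
    fix x y z :: real
    assume "x - y \<in> \<int>" "y - z \<in> \<int>"
    then have "(x - y) + (y - z) \<in> \<int>"
      by (rule Ints_add)
    then show "x - z \<in> \<int>"
      by simp
  qed
qed

instantiation circle :: ab_group_add
begin

lift_definition zero_circle :: circle is 0 .

lift_definition plus_circle :: "circle \<Rightarrow> circle \<Rightarrow> circle" is "(+)"
  by (drule (1) Ints_add) (simp add: algebra_simps)

lift_definition uminus_circle :: "circle \<Rightarrow> circle" is uminus
  by (drule Ints_minus) (simp add: algebra_simps)

lift_definition minus_circle :: "circle \<Rightarrow> circle \<Rightarrow> circle" is "(-)"
  by (drule (1) Ints_diff) (simp add: algebra_simps)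

instance
  by standard (transfer; simp)+

end

instantiation circle :: topological_space
begin

definition open_circle :: "circle set \<Rightarrow> bool" where
  "open_circle U \<longleftrightarrow> open (to_circle -` U)"

instance
  by standard (auto simp: open_circle_def vimage_Union)

end

lemma continuous_to_circle: "continuous_on UNIV to_circle"
  by (simp add: continuous_on_open_vimage open_circle_def)

lemma measurable_to_circle [measurable]: "to_circle \<in> borel \<rightarrow>\<^sub>M borel"
  by (rule borel_measurable_continuous_onI[OF continuous_to_circle])

lemma to_circle_eq_iff: "to_circle x = to_circle y \<longleftrightarrow> x - y \<in> \<int>"
  by (rule circle.abs_eq_iff)

lemma to_circle_add: "to_circle (x + y) = to_circle x + to_circle y"
  by (simp add: plus_circle.abs_eq)

instantiation circle :: has_measure
begin

text \<open>
  Lebesgue measure of a fundamental domain, carried to the Borel sets of the quotient. It has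
  total mass one and is translation invariant (see \<open>emeasure_base_measure_circle_UNIV\<close> and
  \<open>emeasure_base_measure_circle_translation\<close>), hence is the normalised Haar measure.
\<close>

definition base_measure_circle :: "circle measure" where
  "base_measure_circle = distr (restrict_space lborel {0..<1}) borel to_circle"

instance ..

end

lemma sets_base_measure_circle [measurable_cong]: "sets (base_measure :: circle measure) = sets borel"
  by (simp add: base_measure_circle_def)

lemma emeasure_base_measure_circle:
  assumes "A \<in> sets borel"
  shows "emeasure (base_measure :: circle measure) A = emeasure lborel (to_circle -` A \<inter> {0..<1})"
proof -
  have "to_circle \<in> restrict_space lborel {0..<1} \<rightarrow>\<^sub>M borel"
    by (intro measurable_restrict_space1) simp
  with assms show ?thesis
    by (simp add: base_measure_circle_def emeasure_distr emeasure_restrict_space space_restrict_space)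
qed

lemma emeasure_base_measure_circle_UNIV: "emeasure (base_measure :: circle measure) UNIV = 1"
  by (simp add: emeasure_base_measure_circle)

lemma continuous_circle_translation: "continuous_on UNIV (\<lambda>x :: circle. x + t)"
proof -
  obtain s where t: "t = to_circle s"
    using Quotient_abs_rep[OF Quotient_circle] by metis
  have "to_circle -` (\<lambda>x. x + t) -` U = (\<lambda>x. x + s) -` to_circle -` U" for U
    by (auto simp: t to_circle_add)
  moreover have "open ((\<lambda>x. x + s) -` V)" if "open V" for V :: "real set"
    by (intro open_vimage that continuous_intros)
  ultimately show ?thesis
    by (simp add: continuous_on_open_vimage open_circle_def)
qed

lemma emeasure_base_measure_circle_translation:
  assumes A: "A \<in> sets borel"
  shows "emeasure (base_measure :: circle measure) ((\<lambda>x. x + t) -` A) = emeasure base_measure A"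
proof -
  define s where "s = frac (rep_circle t)"
  have s: "0 \<le> s" "s < 1"
    by (auto simp: s_def frac_lt_1)
  have "to_circle s = to_circle (rep_circle t)"
    by (simp add: to_circle_eq_iff s_def frac_def)
  then have t: "t = to_circle s"
    using Quotient_abs_rep[OF Quotient_circle] by metis
  define B where "B = to_circle -` A"
  have B [measurable]: "B \<in> sets lborel"
    using measurable_sets[OF measurable_to_circle A] by (simp add: B_def)
  have period: "x + 1 \<in> B \<longleftrightarrow> x \<in> B" for x
  proof -
    have "to_circle (x + 1) = to_circle x"
      by (simp add: to_circle_eq_iff)
    then show ?thesis
      by (simp add: B_def)
  qed
  have shift: "emeasure lborel ((\<lambda>x. r + x) -` C) = emeasure lborel C"
    if C: "C \<in> sets borel" for r :: real and C
  proof -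
    have "emeasure lborel C = emeasure (distr lborel borel ((+) r)) C"
      by (simp only: lborel_distr_plus)
    also have "\<dots> = emeasure lborel ((\<lambda>x. r + x) -` C)"
      using C by (subst emeasure_distr) auto
    finally show ?thesis ..
  qed
  have tA: "(\<lambda>x. x + t) -` A \<in> sets borel"
    using measurable_sets[OF borel_measurable_continuous_onI[OF continuous_circle_translation] A, of t] by simp
  have 1: "to_circle -` (\<lambda>x. x + t) -` A = (\<lambda>x. s + x) -` B"
    by (auto simp: B_def t to_circle_add add.commute)
  have "emeasure base_measure ((\<lambda>x. x + t) -` A) = emeasure lborel ((\<lambda>x. s + x) -` B \<inter> {0..<1})"
    by (simp add: emeasure_base_measure_circle tA 1)
  also have "(\<lambda>x. s + x) -` B \<inter> {0..<1} = (\<lambda>x. s + x) -` (B \<inter> {s..<s+1})"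
    by auto
  also have "emeasure lborel \<dots> = emeasure lborel (B \<inter> {s..<s+1})"
    using B by (intro shift) auto
  also have "B \<inter> {s..<s+1} = (B \<inter> {s..<1}) \<union> (B \<inter> {1..<s+1})"
    using s by auto
  also have "emeasure lborel \<dots> = emeasure lborel (B \<inter> {s..<1}) + emeasure lborel (B \<inter> {1..<s+1})"
    using B by (intro plus_emeasure[symmetric]) auto
  also have "emeasure lborel (B \<inter> {1..<s+1}) = emeasure lborel ((\<lambda>x. 1 + x) -` (B \<inter> {1..<s+1}))"
    using B by (intro shift[symmetric]) auto
  also have "(\<lambda>x. 1 + x) -` (B \<inter> {1..<s+1}) = B \<inter> {0..<s}"
    using period by (auto simp: add.commute)
  also have "emeasure lborel (B \<inter> {s..<1}) + emeasure lborel (B \<inter> {0..<s})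
      = emeasure lborel ((B \<inter> {s..<1}) \<union> (B \<inter> {0..<s}))"
    using B by (intro plus_emeasure) auto
  also have "(B \<inter> {s..<1}) \<union> (B \<inter> {0..<s}) = B \<inter> {0..<1}"
    using s by auto
  also have "emeasure lborel \<dots> = emeasure base_measure A"
    by (simp add: emeasure_base_measure_circle A B_def)
  finally show ?thesis .
qed

section \<open>The unit interval with Lebesgue measure\<close>

typedef unit_interval = "{0..1::real}"
  by (rule exI[of _ 0]) simp

instantiation unit_interval :: has_measure
begin

definition base_measure_unit_interval :: "unit_interval measure" where
  "base_measure_unit_interval = embed_measure (restrict_space lborel {0..1}) Abs_unit_interval"

instance ..

end

lemma inj_on_Abs_unit_interval: "inj_on Abs_unit_interval {0..1}"
  by (rule inj_onI) (simp add: Abs_unit_interval_inject)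

lemma emeasure_base_measure_unit_interval:
  assumes A: "A \<in> sets borel" "A \<subseteq> {0..1}"
  shows "emeasure (base_measure :: unit_interval measure) (Abs_unit_interval ` A) = emeasure lborel A"
proof -
  have "emeasure (base_measure :: unit_interval measure) (Abs_unit_interval ` A)
      = emeasure (restrict_space lborel {0..1}) A"
    using A inj_on_Abs_unit_interval unfolding base_measure_unit_interval_def
    by (intro emeasure_embed_measure_image') (auto simp: space_restrict_space sets_restrict_space)
  then show ?thesis
    using A by (simp add: emeasure_restrict_space)
qed

end

theory Submission
  imports Defs "HOL-Probability.Probability"
begin

text \<open>
  Binary digits identify both measure spaces with the group \<open>{0,1}\<^sup>\<nat>\<close> of fair coin sequences. The
  operator \<open>R\<close> is convolution with the law \<open>\<mu>\<close> of independent coins whose \<open>k\<close>-th bias is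
  \<open>a\<^sub>k = 1 / sqrt (k + 1)\<close>; it multiplies the Walsh function of a finite set \<open>F\<close> by \<open>\<Prod>k\<in>F. a\<^sub>k\<close>.

  Since \<open>a\<^sub>k \<rightarrow> 0\<close>, \<open>R\<close> is compact on \<open>L\<^sup>2\<close>, and weakly null sequences in \<open>L\<^sup>1\<close> are uniformly
  integrable, so \<open>R\<close> is Dunford--Pettis.

  For the lower bounds, average \<open>R - RT\<close> or \<open>R - TR\<close> over the translations of the group: both become
  convolution with \<open>\<mu> - \<mu> * \<nu>\<close>, where the Walsh coefficients \<open>\<langle>T w\<^sub>F, w\<^sub>F\<rangle>\<close> of \<open>\<nu>\<close> vanish at infinity
  because \<open>T\<close> is Dunford--Pettis. As \<open>\<Sum> a\<^sub>k\<^sup>2 = \<infinity>\<close>, the normalised sum \<open>S = \<Sum> a\<^sub>k r\<^sub>k / \<Sum> a\<^sub>k\<^sup>2\<close> of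
  Rademacher functions over a long late block is concentrated near \<open>1\<close> under \<open>\<mu>\<close>, and near
  \<open>m(t) = \<Sum> a\<^sub>k\<^sup>2 r\<^sub>k(t) / \<Sum> a\<^sub>k\<^sup>2\<close> under the translate of \<open>\<mu>\<close> by \<open>t\<close>. Since \<open>\<bar>m\<bar> \<le> 1\<close>, truncating \<open>S\<close> to
  \<open>[-1, 1]\<close> gives a test function of norm at most \<open>1\<close> whose integral is nearly \<open>1\<close> for \<open>\<mu>\<close> and nearly
  \<open>\<integral> m d\<nu>\<close>, hence nearly \<open>0\<close>, for \<open>\<mu> * \<nu>\<close>.
\<close>

section \<open>Walsh functions and biased coins\<close>

text \<open>The two conditions on \<open>a\<close> pull in opposite directions. If the squares were
  summable, \<mu> would have a density with respect to Haar measure; composing R with convolution by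
  the cylinder kernels would then approximate R in norm by operators R T with T of finite rank, and
  the lower bounds would fail. A null sequence with divergent squares keeps \<mu> singular while its
  coefficients vanish at infinity. The sum S has the right means but is not bounded by 1, and
  pairing with an averaged operator costs the sup norm of the test function; this is why S must be
  truncated, and why \<bar>m\<bar> \<le> 1 matters. The measure \<nu> is represented by the numbers
  \<open>diagonal T F\<close> alone: each estimate involves finitely many digits, and
  \<open>norm_diagonal_sum_le\<close> plays the part of the total variation bound. Only singletons F
  need to be small, since m is a combination of Rademacher functions. As R is diagonal on the Walsh
  functions, R T and T R have the same diagonal, and one argument covers both orders.\<close>

definition walsh :: "nat set \<Rightarrow> (nat \<Rightarrow> bool) \<Rightarrow> complex" where
  "walsh F \<omega> = (\<Prod>k\<in>F. if \<omega> k then -1 else 1)"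

definition walsh_sum :: "nat \<Rightarrow> (nat set \<Rightarrow> complex) \<Rightarrow> (nat \<Rightarrow> bool) \<Rightarrow> complex" where
  "walsh_sum n c \<omega> = (\<Sum>F\<in>Pow {..<n}. c F * walsh F \<omega>)"

text \<open>The function lives on all sequences, not up to null sets, so that it may be translated
  and evaluated at a point.\<close>

definition depends_below :: "nat \<Rightarrow> ((nat \<Rightarrow> bool) \<Rightarrow> 'b) \<Rightarrow> bool" where
  "depends_below n q \<longleftrightarrow> (\<forall>\<omega> \<omega>'. (\<forall>k<n. \<omega> k = \<omega>' k) \<longrightarrow> q \<omega> = q \<omega>')"

definition bxor :: "(nat \<Rightarrow> bool) \<Rightarrow> (nat \<Rightarrow> bool) \<Rightarrow> nat \<Rightarrow> bool" where
  "bxor \<omega> \<omega>' = (\<lambda>k. \<omega> k \<noteq> \<omega>' k)"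

abbreviation bits :: "(nat \<Rightarrow> bool) measure" where
  "bits \<equiv> \<Pi>\<^sub>M k\<in>UNIV. count_space UNIV"

text \<open>The probability \<open>(1 - a k) / 2\<close> of \<open>True\<close> makes
  \<open>a k\<close> the mean of the sign of digit k. The parameter 0 gives Haar measure of the coin
  group; setting \<open>a k = 0\<close> for late k averages those digits out.\<close>

definition biased_coins :: "(nat \<Rightarrow> real) \<Rightarrow> (nat \<Rightarrow> bool) measure" where
  "biased_coins a = (\<Pi>\<^sub>M k\<in>UNIV. measure_pmf (bernoulli_pmf ((1 - a k) / 2)))"

lemma walsh_empty [simp]: "walsh {} \<omega> = 1"
  by (simp add: walsh_def)

lemma walsh_insert: "finite F \<Longrightarrow> k \<notin> F \<Longrightarrow> walsh (insert k F) \<omega> = (if \<omega> k then -1 else 1) * walsh F \<omega>"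
  by (simp add: walsh_def)

text \<open>Infinite F are covered by the default value 1 of the product.\<close>

lemma norm_walsh [simp]: "norm (walsh F \<omega>) = 1"
  unfolding walsh_def prod_norm[symmetric] by (rule prod.neutral) auto

lemma walsh_square [simp]: "walsh F \<omega> * walsh F \<omega> = 1"
  unfolding walsh_def prod.distrib[symmetric] by (rule prod.neutral) auto

lemma cnj_walsh [simp]: "cnj (walsh F \<omega>) = walsh F \<omega>"
  by (auto simp: walsh_def intro!: prod.cong)

lemma walsh_bxor: "walsh F (bxor \<omega> \<omega>') = walsh F \<omega> * walsh F \<omega>'"
  by (auto simp: walsh_def bxor_def prod.distrib[symmetric] intro!: prod.cong)

text \<open>The factors over \<open>F \<inter> G\<close> occur twice and square to 1.\<close>

lemma walsh_mult:
  assumes "finite F" "finite G"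
  shows "walsh F \<omega> * walsh G \<omega> = walsh (sym_diff F G) \<omega>"
proof -
  have *: "walsh F \<omega> = walsh (F - G) \<omega> * walsh (F \<inter> G) \<omega>" if "finite F" for F G
    unfolding walsh_def using that by (subst prod.union_disjoint[symmetric]) (auto simp: Un_Diff_Int intro!: prod.cong)
  have "walsh F \<omega> * walsh G \<omega>
      = walsh (F - G) \<omega> * walsh (G - F) \<omega> * (walsh (F \<inter> G) \<omega> * walsh (F \<inter> G) \<omega>)"
    using *[OF assms(1), of G] *[OF assms(2), of F] by (simp only: Int_commute mult_ac)
  also have "\<dots> = walsh (sym_diff F G) \<omega>"
    unfolding walsh_square unfolding walsh_def using assms by (subst prod.union_disjoint) auto
  finally show ?thesis .
qed

lemma measurable_bits [measurable]: "(\<lambda>\<omega>. \<omega> k) \<in> bits \<rightarrow>\<^sub>M count_space UNIV"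
  by (rule measurable_component_singleton) simp

lemma sets_biased_coins [measurable_cong]: "sets (biased_coins a) = sets bits"
  unfolding biased_coins_def by (rule sets_PiM_cong) auto

lemma space_bits [simp]: "space bits = UNIV"
  by (simp add: space_PiM)

lemma measurable_walsh [measurable]: "walsh F \<in> borel_measurable bits"
  unfolding walsh_def by measurable

lemma measurable_walsh_sum [measurable]: "walsh_sum n c \<in> borel_measurable bits"
  unfolding walsh_sum_def by measurable

lemma measurable_bxor [measurable]: "(\<lambda>p. bxor (fst p) (snd p)) \<in> bits \<Otimes>\<^sub>M bits \<rightarrow>\<^sub>M bits"
  unfolding bxor_def by (rule measurable_PiM_single') auto

lemma norm_walsh_sum_le: "norm (walsh_sum n c \<omega>) \<le> (\<Sum>F\<in>Pow {..<n}. norm (c F))"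
  unfolding walsh_sum_def by (rule sum_norm_le) (simp add: norm_mult)

lemma depends_belowD: "depends_below n q \<Longrightarrow> (\<And>k. k < n \<Longrightarrow> \<omega> k = \<omega>' k) \<Longrightarrow> q \<omega> = q \<omega>'"
  by (auto simp: depends_below_def)

lemma depends_below_walsh: "F \<subseteq> {..<n} \<Longrightarrow> depends_below n (walsh F)"
  unfolding depends_below_def walsh_def by (auto intro!: prod.cong)

lemma depends_below_walsh_sum: "depends_below n (walsh_sum n c)"
proof -
  have "walsh_sum n c \<omega> = walsh_sum n c \<omega>'" if "\<forall>k<n. \<omega> k = \<omega>' k" for \<omega> \<omega>'
    unfolding walsh_sum_def using that
    by (intro sum.cong refl arg_cong[where f="(*) _"] depends_belowD[OF depends_below_walsh[of _ n]]) auto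
  then show ?thesis
    by (simp add: depends_below_def)
qed

text \<open>The characters of a finite group span all functions on it.\<close>

lemma walsh_expansion:
  fixes q :: "(nat \<Rightarrow> bool) \<Rightarrow> complex"
  assumes "depends_below n q"
  shows "\<exists>c. q = walsh_sum n c"
  using assms
proof (induction n arbitrary: q)
  case 0
  then have "q \<omega> = q (\<lambda>_. False)" for \<omega>
    by (auto simp: depends_below_def)
  then have "q \<omega> = walsh_sum 0 (\<lambda>_. q (\<lambda>_. False)) \<omega>" for \<omega>
    by (simp add: walsh_sum_def)
  then show ?case
    by blast
next
  case (Suc n)
  define q0 where "q0 \<omega> = q (fun_upd \<omega> n False)" for \<omega>
  define q1 where "q1 \<omega> = q (fun_upd \<omega> n True)" for \<omega>
  have "depends_below n q0" "depends_below n q1"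
    using Suc.prems by (auto simp: depends_below_def q0_def q1_def less_Suc_eq)
  then obtain c0 c1 where c: "q0 = walsh_sum n c0" "q1 = walsh_sum n c1"
    using Suc.IH by metis
  \<comment> \<open>Half the sum and half the difference of the two restrictions give the parts of
    \<open>q\<close> that are even and odd under flipping digit \<open>n\<close>.\<close>
  define d where "d F = (if n \<in> F then (c0 (F - {n}) - c1 (F - {n})) / 2 else (c0 F + c1 F) / 2)" for F
  have "q \<omega> = walsh_sum (Suc n) d \<omega>" for \<omega>
  proof -
    have "walsh_sum (Suc n) d \<omega>
        = (\<Sum>F\<in>Pow {..<n}. d F * walsh F \<omega>) + (\<Sum>F\<in>insert n ` Pow {..<n}. d F * walsh F \<omega>)"
      unfolding walsh_sum_def lessThan_Suc Pow_insert by (rule sum.union_disjoint) auto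
    also have "(\<Sum>F\<in>insert n ` Pow {..<n}. d F * walsh F \<omega>)
        = (\<Sum>F\<in>Pow {..<n}. d (insert n F) * walsh (insert n F) \<omega>)"
      by (rule sum.reindex_cong[OF _ refl refl]) (auto simp: inj_on_def dest: insert_ident)
    also have "\<dots> = (\<Sum>F\<in>Pow {..<n}. (c0 F - c1 F) / 2 * ((if \<omega> n then -1 else 1) * walsh F \<omega>))"
    proof (intro sum.cong refl)
      fix F assume F: "F \<in> Pow {..<n}"
      then have "n \<notin> F" "finite F" "insert n F - {n} = F"
        by (auto intro: finite_subset)
      then show "d (insert n F) * walsh (insert n F) \<omega>
          = (c0 F - c1 F) / 2 * ((if \<omega> n then -1 else 1) * walsh F \<omega>)"
        by (simp add: d_def walsh_insert)
    qed
    also have "(\<Sum>F\<in>Pow {..<n}. d F * walsh F \<omega>) = (\<Sum>F\<in>Pow {..<n}. (c0 F + c1 F) / 2 * walsh F \<omega>)"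
      by (intro sum.cong refl) (auto simp: d_def)
    finally have "walsh_sum (Suc n) d \<omega> = (\<Sum>F\<in>Pow {..<n}. (if \<omega> n then c1 F else c0 F) * walsh F \<omega>)"
      by (simp only: sum.distrib[symmetric]) (auto intro!: sum.cong simp: field_simps)
    also have "\<dots> = (if \<omega> n then q1 \<omega> else q0 \<omega>)"
      by (simp add: c walsh_sum_def)
    also have "\<dots> = q \<omega>"
      by (auto simp: q0_def q1_def fun_upd_idem)
    finally show ?thesis ..
  qed
  then show ?case
    by blast
qed

lemma product_prob_space_pmf: "product_prob_space (\<lambda>k. measure_pmf (p k))"
  by (simp add: product_prob_space_def product_prob_space_axioms_def product_sigma_finite_def
      measure_pmf.prob_space_axioms measure_pmf.sigma_finite_measure_axioms)

lemma prob_space_biased_coins: "prob_space (biased_coins a)"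
  unfolding biased_coins_def by (intro prob_space_PiM measure_pmf.prob_space_axioms)

text \<open>Only the digits in F matter, so the infinite product measure projects to a finite one,
  where independence splits the integral.\<close>

lemma integral_walsh_biased_coins:
  assumes "finite F" "\<And>k. k \<in> F \<Longrightarrow> \<bar>a k\<bar> \<le> 1"
  shows "(\<integral>\<omega>. walsh F \<omega> \<partial>biased_coins a) = (\<Prod>k\<in>F. complex_of_real (a k))"
proof -
  let ?p = "\<lambda>k. measure_pmf (bernoulli_pmf ((1 - a k) / 2))"
  interpret product_prob_space ?p UNIV
    by (rule product_prob_space_pmf)
  have meas: "(\<lambda>\<omega>. \<Prod>k\<in>F. if \<omega> k then -1 else 1 :: complex) \<in> borel_measurable (Pi\<^sub>M F ?p)"
    by (intro borel_measurable_prod measurable_compose[OF measurable_component_singleton]) auto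
  have "(\<integral>\<omega>. walsh F \<omega> \<partial>biased_coins a)
      = (\<integral>\<omega>. (\<Prod>k\<in>F. if restrict \<omega> F k then -1 else 1) \<partial>Pi\<^sub>M UNIV ?p)"
    unfolding biased_coins_def walsh_def by (intro Bochner_Integration.integral_cong refl prod.cong) auto
  also have "\<dots> = (\<integral>\<omega>. (\<Prod>k\<in>F. if \<omega> k then -1 else 1) \<partial>distr (Pi\<^sub>M UNIV ?p) (Pi\<^sub>M F ?p) (\<lambda>\<omega>. restrict \<omega> F))"
    by (rule integral_distr[OF measurable_restrict_subset meas, symmetric]) auto
  also have "distr (Pi\<^sub>M UNIV ?p) (Pi\<^sub>M F ?p) (\<lambda>\<omega>. restrict \<omega> F) = Pi\<^sub>M F ?p"
    using assms by (intro distr_PiM_restrict_finite) auto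
  also have "(\<integral>\<omega>. (\<Prod>k\<in>F. if \<omega> k then -1 else 1) \<partial>Pi\<^sub>M F ?p)
      = (\<Prod>k\<in>F. \<integral>b. (if b then -1 else 1) \<partial>?p k :: complex)"
    by (rule product_integral_prod[OF assms(1)]) (auto intro: integrable_measure_pmf_finite)
  also have "\<dots> = (\<Prod>k\<in>F. complex_of_real (a k))"
  proof (intro prod.cong refl)
    fix k assume "k \<in> F"
    then have "\<bar>a k\<bar> \<le> 1"
      by (rule assms(2))
    then show "(\<integral>b. (if b then -1 else 1) \<partial>?p k) = complex_of_real (a k)"
      by (subst integral_measure_pmf[of UNIV])
        (auto simp: UNIV_bool abs_le_iff scaleR_conv_of_real field_simps)
  qed
  finally show ?thesis .
qed

lemma integrable_walsh_sum:
  assumes "finite_measure N" and [measurable_cong]: "sets N = sets bits"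
  shows "integrable N (walsh_sum n c)" "integrable N (walsh F)"
proof -
  interpret finite_measure N by fact
  show "integrable N (walsh_sum n c)"
    by (rule integrable_const_bound[where B="\<Sum>F\<in>Pow {..<n}. norm (c F)"]) (auto intro: norm_walsh_sum_le)
  show "integrable N (walsh F)"
    by (rule integrable_const_bound[where B=1]) auto
qed

text \<open>Uniqueness of Fourier coefficients on the coin group: indicators of cylinders are finite
  Walsh sums, and cylinders determine a finite measure.\<close>

lemma measure_eqI_walsh:
  assumes N1: "prob_space N1" "sets N1 = sets bits"
    and N2: "prob_space N2" "sets N2 = sets bits"
    and eq: "\<And>F. finite F \<Longrightarrow> (\<integral>\<omega>. walsh F \<omega> \<partial>N1) = (\<integral>\<omega>. walsh F \<omega> \<partial>N2)"
  shows "N1 = N2"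
proof (rule measure_eqI_PiM_infinite)
  interpret N1: prob_space N1 by fact
  interpret N2: prob_space N2 by fact
  show "sets N1 = sets bits" "sets N2 = sets bits" "finite_measure N1"
    by (fact N1 N2)+ unfold_locales
  fix A :: "nat \<Rightarrow> bool set" and J :: "nat set"
  assume J: "finite J"
  define D where "D = prod_emb UNIV (\<lambda>_. count_space UNIV) J (Pi\<^sub>E J A)"
  have D: "D = {\<omega>. \<forall>k\<in>J. \<omega> k \<in> A k}"
    by (auto simp: D_def prod_emb_iff space_PiM)
  have [measurable]: "D \<in> sets bits"
    unfolding D_def using J by (intro sets_PiM_I) auto
  obtain n where n: "J \<subseteq> {..<n}"
    using J by (meson finite_nat_iff_bounded)
  then have "depends_below n (\<lambda>\<omega>. complex_of_real (indicator D \<omega>))"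
    unfolding depends_below_def D indicator_def by (intro allI impI arg_cong[where f=complex_of_real]) (simp add: subset_iff)
  then obtain c where c: "(\<lambda>\<omega>. complex_of_real (indicator D \<omega>)) = walsh_sum n c"
    using walsh_expansion by blast
  have "complex_of_real (measure N D) = (\<Sum>F\<in>Pow {..<n}. c F * (\<integral>\<omega>. walsh F \<omega> \<partial>N))"
    if "prob_space N" and sets: "sets N = sets bits" for N
  proof -
    interpret prob_space N by fact
    have "complex_of_real (measure N D) = (\<integral>\<omega>. complex_of_real (indicator D \<omega>) \<partial>N)"
      using sets by (simp add: space_bits sets_eq_imp_space_eq[OF sets])
    also have "\<dots> = (\<Sum>F\<in>Pow {..<n}. c F * (\<integral>\<omega>. walsh F \<omega> \<partial>N))"
      unfolding c walsh_sum_def using integrable_walsh_sum[OF finite_measure_axioms sets]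
      by (subst Bochner_Integration.integral_sum) auto
    finally show ?thesis .
  qed
  note this[OF N1] this[OF N2]
  moreover have "(\<Sum>F\<in>Pow {..<n}. c F * (\<integral>\<omega>. walsh F \<omega> \<partial>N1)) = (\<Sum>F\<in>Pow {..<n}. c F * (\<integral>\<omega>. walsh F \<omega> \<partial>N2))"
    by (intro sum.cong refl arg_cong2[where f="(*)"] eq) (auto intro: finite_subset)
  ultimately have "measure N1 D = measure N2 D"
    by (metis of_real_eq_iff)
  then show "emeasure N1 D = emeasure N2 D"
    by (simp add: N1.emeasure_eq_measure N2.emeasure_eq_measure)
qed

section \<open>Operators on \<open>L\<^sup>1\<close> and coin codings\<close>

lemma integrable_rep_l1 [simp]: "integrable base_measure (rep_l1 x)"
  using Quotient3_rep_reflp[OF Quotient3_l1] by blast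

lemma abs_rep_l1 [simp]: "abs_l1 (rep_l1 x) = x"
  by (rule Quotient3_abs_rep[OF Quotient3_l1])

lemma abs_l1_cong_AE:
  assumes "integrable base_measure f" "integrable base_measure g" "AE x in base_measure. f x = g x"
  shows "abs_l1 f = abs_l1 g"
  using Quotient3_rel_abs[OF Quotient3_l1] assms by blast

lemma norm_abs_l1:
  "integrable base_measure f \<Longrightarrow> norm (abs_l1 f) = (\<integral>x. norm (f x) \<partial>base_measure)"
  by (simp add: norm_l1.abs_eq)

lemma abs_l1_add:
  "integrable base_measure f \<Longrightarrow> integrable base_measure g \<Longrightarrow> abs_l1 f + abs_l1 g = abs_l1 (\<lambda>x. f x + g x)"
  by (simp add: plus_l1.abs_eq)

lemma abs_l1_diff:
  "integrable base_measure f \<Longrightarrow> integrable base_measure g \<Longrightarrow> abs_l1 f - abs_l1 g = abs_l1 (\<lambda>x. f x - g x)"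
  by (simp add: minus_l1.abs_eq)

lemma abs_l1_scaleC:
  "integrable base_measure f \<Longrightarrow> c *\<^sub>C abs_l1 f = abs_l1 (\<lambda>x. c * f x)"
  by (simp add: scaleC_l1.abs_eq)

lemma abs_l1_zero: "abs_l1 (\<lambda>_. 0) = 0"
  by (simp add: zero_l1.abs_eq)

lemma abs_l1_sum:
  "(\<And>i. i \<in> I \<Longrightarrow> integrable base_measure (f i)) \<Longrightarrow>
   (\<Sum>i\<in>I. abs_l1 (f i)) = abs_l1 (\<lambda>x. \<Sum>i\<in>I. f i x)"
  by (induction I rule: infinite_finite_induct) (simp_all add: abs_l1_zero abs_l1_add)

lemma nonneg_abs_l1:
  "integrable base_measure f \<Longrightarrow> nonneg_l1 (abs_l1 f) \<longleftrightarrow> (AE x in base_measure. f x \<in> \<real>\<^sub>\<ge>\<^sub>0)"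
  by (simp add: nonneg_l1.abs_eq)

text \<open>Operators are built on functions rather than on classes. The norm bound does double
  duty: applied to the difference of two representatives it shows that \<Phi> descends to the
  quotient.\<close>

lemma l1_operator_exists:
  fixes \<Phi> :: "('a::has_measure \<Rightarrow> complex) \<Rightarrow> 'b::complex_normed_space"
  assumes add: "\<And>f g. integrable base_measure f \<Longrightarrow> integrable base_measure g \<Longrightarrow>
      \<Phi> (\<lambda>x. f x + g x) = \<Phi> f + \<Phi> g"
    and scale: "\<And>c f. integrable base_measure f \<Longrightarrow> \<Phi> (\<lambda>x. c * f x) = c *\<^sub>C \<Phi> f"
    and bound: "\<And>f. integrable base_measure f \<Longrightarrow> norm (\<Phi> f) \<le> C * (\<integral>x. norm (f x) \<partial>base_measure)"
    and C: "0 \<le> C"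
  obtains T :: "'a l1 \<Rightarrow>\<^sub>L 'b"
  where "complex_linear T" "norm T \<le> C" "\<And>f. integrable base_measure f \<Longrightarrow> blinfun_apply T (abs_l1 f) = \<Phi> f"
proof -
  have cong: "\<Phi> f = \<Phi> g"
    if f: "integrable base_measure f" and g: "integrable base_measure g" and "abs_l1 f = abs_l1 g" for f g
  proof -
    \<comment> \<open>The difference is written with the factor -1 because \<Phi> is only known to
      respect sums and scalar multiples.\<close>
    have "(\<integral>x. norm (f x + (-1) * g x) \<partial>base_measure) = norm (abs_l1 f - abs_l1 g)"
      using f g by (subst abs_l1_diff) (auto simp: norm_abs_l1)
    with that have "norm (\<Phi> (\<lambda>x. f x + (-1) * g x)) \<le> 0"
      using bound[of "\<lambda>x. f x + (-1) * g x"] by simp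
    moreover have "\<Phi> (\<lambda>x. f x + (-1) * g x) = \<Phi> f + (-1) *\<^sub>C \<Phi> g"
      using add[of f "\<lambda>x. (-1) * g x"] scale[OF g, of "-1"] f g by simp
    moreover have "(-1) *\<^sub>C \<Phi> g = - \<Phi> g"
      using scaleC_of_real[of "-1" "\<Phi> g"] by simp
    ultimately show ?thesis
      by simp
  qed
  define T0 where "T0 x = \<Phi> (rep_l1 x)" for x
  have T0: "T0 (abs_l1 f) = \<Phi> f" if "integrable base_measure f" for f
    unfolding T0_def using that by (intro cong) auto
  have T0_scale: "T0 (c *\<^sub>C x) = c *\<^sub>C T0 x" for c x
    using T0[of "\<lambda>y. c * rep_l1 x y"] by (simp add: scale abs_l1_scaleC[symmetric] T0_def)
  have "bounded_linear T0"
  proof (rule bounded_linear_intro)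
    fix x y :: "'a l1" and r :: real
    show "T0 (x + y) = T0 x + T0 y"
      using T0[of "\<lambda>z. rep_l1 x z + rep_l1 y z"] by (simp add: add abs_l1_add[symmetric] T0_def)
    show "T0 (r *\<^sub>R x) = r *\<^sub>R T0 x"
      using T0_scale[of "complex_of_real r" x] by (simp add: scaleC_of_real)
    show "norm (T0 x) \<le> norm x * C"
      using bound[of "rep_l1 x"] norm_abs_l1[of "rep_l1 x"] by (simp add: T0_def mult.commute)
  qed
  then have apply_T: "blinfun_apply (Blinfun T0) = T0"
    by (rule bounded_linear_Blinfun_apply)
  show ?thesis
  proof
    show "complex_linear (Blinfun T0)"
      by (simp add: complex_linear_def apply_T T0_scale)
    show "norm (Blinfun T0) \<le> C"
    proof (rule norm_blinfun_bound[OF C])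
      show "norm (blinfun_apply (Blinfun T0) x) \<le> C * norm x" for x
        using bound[of "rep_l1 x"] norm_abs_l1[of "rep_l1 x"] by (simp add: apply_T T0_def)
    qed
    show "blinfun_apply (Blinfun T0) (abs_l1 f) = \<Phi> f" if "integrable base_measure f" for f
      using that by (simp add: apply_T T0)
  qed
qed

lemma integrable_mult_bounded:
  fixes f g :: "'a \<Rightarrow> complex"
  assumes "integrable M f" "g \<in> borel_measurable M" "\<And>x. norm (g x) \<le> C"
  shows "integrable M (\<lambda>x. f x * g x)"
proof (rule Bochner_Integration.integrable_bound)
  show "integrable M (\<lambda>x. C * norm (f x))"
    using assms(1) by simp
  show "(\<lambda>x. f x * g x) \<in> borel_measurable M"
    using assms by measurable
  have "norm (f x * g x) \<le> norm (C * norm (f x))" for x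
  proof -
    have "norm (f x * g x) \<le> norm (f x) * C"
      unfolding norm_mult by (intro mult_left_mono assms) simp
    then show ?thesis
      by (simp add: mult.commute)
  qed
  then show "AE x in M. norm (f x * g x) \<le> norm (C * norm (f x))"
    by simp
qed

text \<open>The easy half of the duality between L^1 and bounded functions. It supplies the Walsh
  coefficients and the functionals that test uniform integrability.\<close>

lemma l1_functional_exists:
  fixes g :: "'a::has_measure \<Rightarrow> complex"
  assumes g [measurable]: "g \<in> borel_measurable base_measure" and C: "\<And>x. norm (g x) \<le> C"
  obtains \<phi> :: "'a l1 \<Rightarrow>\<^sub>L complex"
  where "complex_linear \<phi>" "norm \<phi> \<le> C"
    "\<And>f. integrable base_measure f \<Longrightarrow> blinfun_apply \<phi> (abs_l1 f) = (\<integral>x. f x * g x \<partial>base_measure)"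
proof (rule l1_operator_exists[where \<Phi>="\<lambda>f. \<integral>x. f x * g x \<partial>base_measure" and C=C])
  note int = integrable_mult_bounded[OF _ g C]
  show "(\<integral>x. (f x + h x) * g x \<partial>base_measure) = (\<integral>x. f x * g x \<partial>base_measure) + (\<integral>x. h x * g x \<partial>base_measure)"
    if "integrable base_measure f" "integrable base_measure h" for f h
    using that by (simp add: distrib_right int)
  show "(\<integral>x. (c * f x) * g x \<partial>base_measure) = c *\<^sub>C (\<integral>x. f x * g x \<partial>base_measure)" for c f
    by (simp add: scaleC_complex_def mult.assoc)
  show "0 \<le> C"
    using order_trans[OF norm_ge_zero C] .
  show "norm (\<integral>x. f x * g x \<partial>base_measure) \<le> C * (\<integral>x. norm (f x) \<partial>base_measure)"
    if f: "integrable base_measure f" for f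
  proof -
    have "norm (\<integral>x. f x * g x \<partial>base_measure) \<le> (\<integral>x. norm (f x * g x) \<partial>base_measure)"
      by (rule integral_norm_bound)
    also have "\<dots> \<le> (\<integral>x. C * norm (f x) \<partial>base_measure)"
      using f C by (intro integral_mono integrable_norm int) (auto simp: norm_mult mult.commute[of C] intro!: mult_left_mono)
    finally show ?thesis
      by simp
  qed
qed (use that in auto)

lemma complex_linear_sum:
  "complex_linear T \<Longrightarrow> blinfun_apply T (\<Sum>i\<in>I. c i *\<^sub>C x i) = (\<Sum>i\<in>I. c i *\<^sub>C blinfun_apply T (x i))"
  by (simp add: blinfun.sum_right complex_linear_def)

lemma scaleC_diff_right: "c *\<^sub>C (x - y) = c *\<^sub>C x - c *\<^sub>C (y :: 'a::complex_normed_space)"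
  by (metis add_diff_cancel diff_add_cancel scaleC_add_right)

lemma complex_linear_diff: "complex_linear S \<Longrightarrow> complex_linear T \<Longrightarrow> complex_linear (S - T)"
  by (simp add: complex_linear_def blinfun.diff_left scaleC_diff_right)

lemma complex_linear_compose: "complex_linear S \<Longrightarrow> complex_linear T \<Longrightarrow> complex_linear (S o\<^sub>L T)"
  by (simp add: complex_linear_def)

text \<open>One interface for the circle and the interval. Decoding leads back to the space after
  bits have been flipped; it inverts \<open>b\<close> only almost everywhere because the end point 1
  of the interval has the digits of 0.\<close>

locale coin_coding =
  fixes b :: "'a::has_measure \<Rightarrow> nat \<Rightarrow> bool" and dec :: "(nat \<Rightarrow> bool) \<Rightarrow> 'a"
  assumes prob: "prob_space (base_measure :: 'a measure)"
    and measurable_b [measurable]: "b \<in> base_measure \<rightarrow>\<^sub>M bits"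
    and measurable_dec [measurable]: "dec \<in> bits \<rightarrow>\<^sub>M base_measure"
    and distr_b: "distr base_measure bits b = biased_coins (\<lambda>_. 0)"
    and dec_b: "AE x in base_measure. dec (b x) = x"
begin

abbreviation M :: "'a measure" where
  "M \<equiv> base_measure"

sublocale prob_space M
  by (rule prob)

lemma measurable_compose_b [measurable]:
  "q \<in> borel_measurable bits \<Longrightarrow> (\<lambda>x. q (b x)) \<in> borel_measurable M"
  by (rule measurable_compose[OF measurable_b])

lemma integral_b:
  fixes q :: "(nat \<Rightarrow> bool) \<Rightarrow> complex"
  assumes "q \<in> borel_measurable bits"
  shows "(\<integral>x. q (b x) \<partial>M) = (\<integral>\<omega>. q \<omega> \<partial>biased_coins (\<lambda>_. 0))"
  using assms by (simp add: distr_b[symmetric] integral_distr)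

lemma integrable_b:
  "integrable M (\<lambda>x. walsh_sum n c (b x))" "integrable M (\<lambda>x. walsh F (b x))"
proof -
  show "integrable M (\<lambda>x. walsh_sum n c (b x))"
    by (rule integrable_const_bound[where B="\<Sum>F\<in>Pow {..<n}. norm (c F)"]) (auto intro: norm_walsh_sum_le)
  show "integrable M (\<lambda>x. walsh F (b x))"
    by (rule integrable_const_bound[where B=1]) auto
qed

lemma integral_walsh:
  assumes "finite F"
  shows "(\<integral>x. walsh F (b x) \<partial>M) = (if F = {} then 1 else 0)"
  using assms by (subst integral_b) (auto simp: integral_walsh_biased_coins)

lemma integral_walsh_mult:
  assumes "finite F" "finite G"
  shows "(\<integral>x. walsh F (b x) * walsh G (b x) \<partial>M) = (if F = G then 1 else 0)"
proof -
  have "(\<integral>x. walsh F (b x) * walsh G (b x) \<partial>M) = (if sym_diff F G = {} then 1 else 0)"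
    using assms by (simp only: walsh_mult) (intro integral_walsh, auto)
  then show ?thesis
    by auto
qed

text \<open>Haar measure is the law of \<open>b\<close>, and on sequences of the form
  \<open>b x\<close> the claim follows from \<open>dec_b\<close>.\<close>

lemma b_dec: "AE \<omega> in biased_coins (\<lambda>_. 0). b (dec \<omega>) = \<omega>"
proof -
  have "AE \<omega> in distr M bits b. b (dec \<omega>) = \<omega>"
  proof (subst AE_distr_iff)
    have [measurable]: "(\<lambda>\<omega>. b (dec \<omega>) k) \<in> bits \<rightarrow>\<^sub>M count_space UNIV" for k
      by (rule measurable_compose[OF measurable_compose[OF measurable_dec measurable_b] measurable_bits])
    \<comment> \<open>Equality of sequences is a countable conjunction of conditions on digits,
      which makes the set measurable.\<close>
    have "{\<omega> \<in> space bits. \<forall>k. b (dec \<omega>) k = \<omega> k} \<in> sets bits"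
      by measurable
    then show "{\<omega> \<in> space bits. b (dec \<omega>) = \<omega>} \<in> sets bits"
      by (simp add: fun_eq_iff)
    show "AE x in M. b (dec (b x)) = b x"
      using dec_b by eventually_elim simp
  qed simp
  then show ?thesis
    unfolding distr_b .
qed

lemma distr_dec: "distr (biased_coins (\<lambda>_. 0)) M dec = M"
proof -
  have "distr (biased_coins (\<lambda>_. 0)) M dec = distr M M (dec \<circ> b)"
    by (simp add: distr_b[symmetric] distr_distr)
  also have "\<dots> = distr M M (\<lambda>x. x)"
    using dec_b by (intro distr_cong_AE) auto
  finally show ?thesis
    by (simp add: distr_id2)
qed

text \<open>Translation of the coin group carried over to \<open>'a\<close>.\<close>

definition flip :: "'a \<times> (nat \<Rightarrow> bool) \<Rightarrow> 'a" where
  "flip p = dec (bxor (b (fst p)) (snd p))"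

lemma measurable_bxor_b [measurable]:
  "(\<lambda>p. bxor (b (fst p)) (snd p)) \<in> M \<Otimes>\<^sub>M biased_coins a \<rightarrow>\<^sub>M bits"
proof -
  have "(\<lambda>p. (b (fst p), snd p)) \<in> M \<Otimes>\<^sub>M biased_coins a \<rightarrow>\<^sub>M bits \<Otimes>\<^sub>M bits"
    by measurable
  from measurable_compose[OF this measurable_bxor] show ?thesis
    by simp
qed

lemma measurable_flip [measurable]: "flip \<in> M \<Otimes>\<^sub>M biased_coins a \<rightarrow>\<^sub>M M"
  unfolding flip_def by measurable

lemma pair_prob: "pair_prob_space M (biased_coins a)"
  using prob prob_space_biased_coins[of a]
  by (simp add: pair_prob_space_def pair_sigma_finite_def prob_space_imp_sigma_finite)

lemma integral_walsh_bxor: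
  fixes a :: "nat \<Rightarrow> real"
  assumes F: "finite F" and a: "\<forall>k. \<bar>a k\<bar> \<le> 1"
  shows "(\<integral>p. walsh F (bxor (b (fst p)) (snd p)) \<partial>(M \<Otimes>\<^sub>M biased_coins a)) = (if F = {} then 1 else 0)"
proof -
  interpret pair_prob_space M "biased_coins a"
    by (rule pair_prob)
  have int: "integrable (M \<Otimes>\<^sub>M biased_coins a) (\<lambda>p. walsh F (bxor (b (fst p)) (snd p)))"
    by (rule P.integrable_const_bound[where B=1]) auto
  have "(\<integral>p. walsh F (bxor (b (fst p)) (snd p)) \<partial>(M \<Otimes>\<^sub>M biased_coins a))
      = (\<integral>x. (\<integral>\<omega>. walsh F (b x) * walsh F \<omega> \<partial>biased_coins a) \<partial>M)"
    by (subst integral_fst'[OF int, symmetric]) (simp add: walsh_bxor)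
  also have "\<dots> = (if F = {} then 1 else 0)"
    using F a by (cases "F = {}") (simp_all add: integral_walsh M2.prob_space prob_space.prob_space[OF prob])
  finally show ?thesis .
qed

text \<open>Haar measure absorbs every independent translation: each nontrivial Walsh coefficient of
  the sum has a factor coming from Haar measure, which is 0.\<close>

lemma distr_bxor:
  fixes a :: "nat \<Rightarrow> real"
  assumes a: "\<forall>k. \<bar>a k\<bar> \<le> 1"
  shows "distr (M \<Otimes>\<^sub>M biased_coins a) bits (\<lambda>p. bxor (b (fst p)) (snd p)) = biased_coins (\<lambda>_. 0)"
proof (rule measure_eqI_walsh)
  interpret pair_prob_space M "biased_coins a"
    by (rule pair_prob)
  show "prob_space (distr (M \<Otimes>\<^sub>M biased_coins a) bits (\<lambda>p. bxor (b (fst p)) (snd p)))"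
    by (rule P.prob_space_distr) measurable
  show "(\<integral>\<omega>. walsh F \<omega> \<partial>distr (M \<Otimes>\<^sub>M biased_coins a) bits (\<lambda>p. bxor (b (fst p)) (snd p)))
      = (\<integral>\<omega>. walsh F \<omega> \<partial>biased_coins (\<lambda>_. 0))" if "finite F" for F
    using that by (subst integral_distr) (auto simp: integral_walsh_bxor a integral_walsh_biased_coins)
qed (auto simp: prob_space_biased_coins sets_biased_coins)

lemma distr_flip:
  fixes a :: "nat \<Rightarrow> real"
  assumes a: "\<forall>k. \<bar>a k\<bar> \<le> 1"
  shows "distr (M \<Otimes>\<^sub>M biased_coins a) M flip = M"
proof -
  have "distr (M \<Otimes>\<^sub>M biased_coins a) M flip
      = distr (distr (M \<Otimes>\<^sub>M biased_coins a) bits (\<lambda>p. bxor (b (fst p)) (snd p))) M dec"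
    by (subst distr_distr) (auto simp: flip_def[abs_def] comp_def)
  then show ?thesis
    by (simp add: distr_bxor a distr_dec)
qed

text \<open>By \<open>distr_bxor\<close> the flipped sequence has Haar law, so almost surely it
  avoids the null set on which \<open>b (dec \<omega>)\<close> differs from \<omega>.\<close>

lemma b_flip:
  fixes a :: "nat \<Rightarrow> real"
  assumes a: "\<forall>k. \<bar>a k\<bar> \<le> 1"
  shows "AE p in M \<Otimes>\<^sub>M biased_coins a. b (flip p) = bxor (b (fst p)) (snd p)"
proof -
  have "AE \<omega> in distr (M \<Otimes>\<^sub>M biased_coins a) bits (\<lambda>p. bxor (b (fst p)) (snd p)). b (dec \<omega>) = \<omega>"
    unfolding distr_bxor[OF a] by (rule b_dec)
  then show ?thesis
    unfolding flip_def by (rule AE_distrD[OF measurable_bxor_b])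
qed

end

section \<open>Averaging over random bit flips\<close>

lemma measurable_bxor_right [measurable]: "bxor \<omega> \<in> bits \<rightarrow>\<^sub>M bits"
proof -
  have "(\<lambda>\<omega>'. (\<omega>, \<omega>')) \<in> bits \<rightarrow>\<^sub>M bits \<Otimes>\<^sub>M bits"
    by (rule measurable_Pair1') simp
  from measurable_compose[OF this measurable_bxor] show ?thesis
    by simp
qed

lemma depends_below_mono: "depends_below n q \<Longrightarrow> n \<le> m \<Longrightarrow> depends_below m q"
  by (auto simp: depends_below_def)

section \<open>Density in L^1 of functions of finitely many digits\<close>

context coin_coding
begin

lemma integrable_depends_below:
  fixes q :: "(nat \<Rightarrow> bool) \<Rightarrow> complex"
  assumes "depends_below n q"
  shows "integrable M (\<lambda>x. q (b x))"
  using walsh_expansion[OF assms] integrable_b(1) by metis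

definition approximable :: "('a \<Rightarrow> complex) \<Rightarrow> bool" where
  "approximable f \<longleftrightarrow> integrable M f \<and>
     (\<forall>\<epsilon>>0. \<exists>n q. depends_below n q \<and> (\<integral>x. norm (f x - q (b x)) \<partial>M) < \<epsilon>)"

lemma approximable_depends_below: "depends_below n q \<Longrightarrow> approximable (\<lambda>x. q (b x))"
  unfolding approximable_def by (auto intro!: exI[of _ n] exI[of _ q] integrable_depends_below)

lemma integral_norm_diff_triangle:
  fixes f g h :: "'a \<Rightarrow> complex"
  assumes "integrable M f" "integrable M g" "integrable M h"
  shows "(\<integral>x. norm (f x - h x) \<partial>M) \<le> (\<integral>x. norm (f x - g x) \<partial>M) + (\<integral>x. norm (g x - h x) \<partial>M)"
proof -
  have "(\<integral>x. norm (f x - h x) \<partial>M) \<le> (\<integral>x. norm (f x - g x) + norm (g x - h x) \<partial>M)"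
    using assms norm_triangle_ineq[of "f x - g x" "g x - h x" for x] by (intro integral_mono) auto
  then show ?thesis
    using assms by simp
qed

lemma approximable_close:
  assumes f: "integrable M f" and s: "\<And>\<epsilon>. \<epsilon> > 0 \<Longrightarrow> \<exists>g. approximable g \<and> (\<integral>x. norm (f x - g x) \<partial>M) < \<epsilon>"
  shows "approximable f"
  unfolding approximable_def
proof (intro conjI allI impI f)
  fix \<epsilon> :: real assume "\<epsilon> > 0"
  then obtain g where g: "approximable g" "(\<integral>x. norm (f x - g x) \<partial>M) < \<epsilon> / 2"
    using s[of "\<epsilon> / 2"] by auto
  then obtain n q where q: "depends_below n q" "(\<integral>x. norm (g x - q (b x)) \<partial>M) < \<epsilon> / 2"
    unfolding approximable_def using \<open>\<epsilon> > 0\<close> by (meson half_gt_zero)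
  have "(\<integral>x. norm (f x - q (b x)) \<partial>M) < \<epsilon>"
    using integral_norm_diff_triangle[OF f _ integrable_depends_below[OF q(1)], of g] g q(2)
    by (simp add: approximable_def)
  with q show "\<exists>n q. depends_below n q \<and> (\<integral>x. norm (f x - q (b x)) \<partial>M) < \<epsilon>"
    by blast
qed

lemma approximable_add:
  assumes "approximable f" "approximable g"
  shows "approximable (\<lambda>x. f x + g x)"
  unfolding approximable_def
proof (intro conjI allI impI)
  have f: "integrable M f" and g: "integrable M g"
    using assms by (auto simp: approximable_def)
  then show "integrable M (\<lambda>x. f x + g x)"
    by simp
  fix \<epsilon> :: real assume "\<epsilon> > 0"
  then obtain n q m r where q: "depends_below n q" "(\<integral>x. norm (f x - q (b x)) \<partial>M) < \<epsilon> / 2"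
    and r: "depends_below m r" "(\<integral>x. norm (g x - r (b x)) \<partial>M) < \<epsilon> / 2"
    using assms unfolding approximable_def by (meson half_gt_zero)
  have "depends_below (max n m) (\<lambda>\<omega>. q \<omega> + r \<omega>)"
    using depends_below_mono[OF q(1), of "max n m"] depends_below_mono[OF r(1), of "max n m"]
    unfolding depends_below_def by (metis max.cobounded1 max.cobounded2)
  moreover have "(\<integral>x. norm (f x + g x - (q (b x) + r (b x))) \<partial>M)
      \<le> (\<integral>x. norm (f x - q (b x)) + norm (g x - r (b x)) \<partial>M)"
    using f g integrable_depends_below[OF q(1)] integrable_depends_below[OF r(1)]
    by (intro integral_mono norm_diff_triangle_ineq) auto
  moreover have "\<dots> = (\<integral>x. norm (f x - q (b x)) \<partial>M) + (\<integral>x. norm (g x - r (b x)) \<partial>M)"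
    using f g integrable_depends_below[OF q(1)] integrable_depends_below[OF r(1)] by simp
  ultimately show "\<exists>n q. depends_below n q \<and> (\<integral>x. norm (f x + g x - q (b x)) \<partial>M) < \<epsilon>"
    using q r by (intro exI[of _ "max n m"] exI[of _ "\<lambda>\<omega>. q \<omega> + r \<omega>"]) auto
qed

lemma approximable_scale:
  assumes "approximable f"
  shows "approximable (\<lambda>x. c * f x)"
proof (cases "c = 0")
  case True
  then show ?thesis
    using approximable_depends_below[of 0 "\<lambda>_. 0"] by (simp add: depends_below_def)
next
  case False
  show ?thesis
    unfolding approximable_def
  proof (intro conjI allI impI)
    show "integrable M (\<lambda>x. c * f x)"
      using assms by (simp add: approximable_def)
    fix \<epsilon> :: real assume "\<epsilon> > 0"
    then have "\<epsilon> / norm c > 0"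
      using False by simp
    then obtain n q where q: "depends_below n q" "(\<integral>x. norm (f x - q (b x)) \<partial>M) < \<epsilon> / norm c"
      using assms unfolding approximable_def by meson
    have "norm (c * f x - c * q (b x)) = norm c * norm (f x - q (b x))" for x
      unfolding right_diff_distrib[symmetric] norm_mult ..
    with q(2) False have "(\<integral>x. norm (c * f x - c * q (b x)) \<partial>M) < \<epsilon>"
      by (simp add: field_simps)
    then show "\<exists>n q. depends_below n q \<and> (\<integral>x. norm (c * f x - q (b x)) \<partial>M) < \<epsilon>"
      using q by (intro exI[of _ n] exI[of _ "\<lambda>\<omega>. c * q \<omega>"]) (auto simp: depends_below_def)
  qed
qed

text \<open>Dominated convergence; it serves both countable unions of sets and limits of simple
  functions.\<close>

lemma approximable_limit:
  assumes f: "integrable M f" and s: "\<And>i. approximable (s i)" and g: "integrable M g"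
    and bound: "\<And>i x. x \<in> space M \<Longrightarrow> norm (s i x) \<le> g x"
    and lim: "\<And>x. x \<in> space M \<Longrightarrow> (\<lambda>i. s i x) \<longlonglongrightarrow> f x"
  shows "approximable f"
proof (rule approximable_close[OF f])
  fix \<epsilon> :: real assume "\<epsilon> > 0"
  have "(\<lambda>i. \<integral>x. norm (f x - s i x) \<partial>M) \<longlonglongrightarrow> (\<integral>x. 0 \<partial>M)"
  proof (rule integral_dominated_convergence[where w="\<lambda>x. norm (f x) + g x"])
    show "(\<lambda>x. norm (f x - s i x)) \<in> borel_measurable M" for i
      using f s[of i] by (auto simp: approximable_def)
    show "AE x in M. (\<lambda>i. norm (f x - s i x)) \<longlonglongrightarrow> 0"
    proof (rule AE_I2)
      fix x assume "x \<in> space M"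
      from lim[OF this] have "(\<lambda>i. norm (f x - s i x)) \<longlonglongrightarrow> norm (f x - f x)"
        by (intro tendsto_intros)
      then show "(\<lambda>i. norm (f x - s i x)) \<longlonglongrightarrow> 0"
        by simp
    qed
    show "AE x in M. norm (norm (f x - s i x)) \<le> norm (f x) + g x" for i
    proof (rule AE_I2)
      fix x assume "x \<in> space M"
      then show "norm (norm (f x - s i x)) \<le> norm (f x) + g x"
        using bound[of x i] norm_triangle_ineq4[of "f x" "s i x"] by simp
    qed
  qed (use f g in auto)
  then have "eventually (\<lambda>i. (\<integral>x. norm (f x - s i x) \<partial>M) < \<epsilon>) sequentially"
    using \<open>\<epsilon> > 0\<close> by (intro order_tendstoD(2)[where y=0]) auto
  then show "\<exists>g. approximable g \<and> (\<integral>x. norm (f x - g x) \<partial>M) < \<epsilon>"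
    using s by (auto simp: eventually_sequentially)
qed

text \<open>Dynkin's argument: the approximable sets contain the cylinders, which are stable under
  intersection, and are closed under complements and countable disjoint unions.\<close>

lemma approximable_indicator_b:
  assumes "D \<in> sets bits"
  shows "approximable (\<lambda>x. indicator D (b x))"
proof -
  let ?G = "prod_algebra UNIV (\<lambda>_::nat. count_space (UNIV :: bool set))"
  have sets_bits: "sets bits = sigma_sets UNIV ?G"
    by (simp add: sets_PiM)
  have G_Pow: "?G \<subseteq> Pow UNIV"
    by simp
  have "D \<in> sigma_sets UNIV ?G"
    using assms by (simp add: sets_bits)
  from Int_stable_prod_algebra G_Pow this show ?thesis
  proof (induction rule: sigma_sets_induct_disjoint)
    case (basic A)
    then obtain J E where A: "A = prod_emb UNIV (\<lambda>_. count_space UNIV) J (Pi\<^sub>E J E)" and J: "finite J"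
      by (elim prod_algebraE) auto
    then have A: "A = {\<omega>. \<forall>k\<in>J. \<omega> k \<in> E k}"
      by (auto simp: prod_emb_iff)
    obtain n where "J \<subseteq> {..<n}"
      using J by (meson finite_nat_iff_bounded)
    then have "depends_below n (indicator A :: _ \<Rightarrow> complex)"
      unfolding depends_below_def A indicator_def by (auto simp: subset_iff)
    then show ?case
      by (rule approximable_depends_below)
  next
    case empty
    show ?case
      using approximable_depends_below[of 0 "\<lambda>_. 0"] by (simp add: depends_below_def)
  next
    case (compl A)
    have "approximable (\<lambda>x. 1 + (-1) * indicator A (b x))"
      using approximable_depends_below[of 0 "\<lambda>_. 1"]
      by (intro approximable_add approximable_scale compl) (simp add: depends_below_def)
    also have "(\<lambda>x. 1 + (-1) * indicator A (b x)) = (\<lambda>x. indicator (UNIV - A) (b x) :: complex)"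
      by (auto simp: indicator_def)
    finally show ?case .
  next
    case (union A)
    have "approximable (\<lambda>x. indicator (\<Union>j<i. A j) (b x))" for i
    proof (induction i)
      case 0
      show ?case
        using approximable_depends_below[of 0 "\<lambda>_. 0"] by (simp add: depends_below_def)
    next
      case (Suc i)
      have "A j \<inter> A i = {}" if "j < i" for j
        using disjoint_family_onD[OF union(1), of j i] that by simp
      then have "(\<Union>j<i. A j) \<inter> A i = {}"
        by blast
      then have "(\<lambda>x. indicator (\<Union>j<Suc i. A j) (b x) :: complex)
          = (\<lambda>x. indicator (\<Union>j<i. A j) (b x) + indicator (A i) (b x))"
        by (auto simp: lessThan_Suc indicator_def fun_eq_iff)
      then show ?case
        using approximable_add[OF Suc union(3)[of i]] by simp
    qed
    note fin = this
    have [measurable]: "(\<Union>i. A i) \<in> sets bits"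
      using union(2) by (auto simp: sets_bits intro!: sigma_sets.Union)
    have "(\<lambda>\<omega>. indicator (\<Union>i. A i) \<omega> :: complex) \<in> borel_measurable bits"
      by measurable
    then have "integrable M (\<lambda>x. indicator (\<Union>i. A i) (b x) :: complex)"
      by (intro integrable_const_bound[where B=1] measurable_compose_b) (auto simp: indicator_def)
    from this fin show ?case
    proof (rule approximable_limit[where g="\<lambda>_. 1"])
      show "norm (indicator (\<Union>j<i. A j) (b x) :: complex) \<le> 1" for i x
        by (simp add: indicator_def)
      show "(\<lambda>i. indicator (\<Union>j<i. A j) (b x) :: complex) \<longlonglongrightarrow> indicator (\<Union>i. A i) (b x)" for x
        by (rule LIMSEQ_indicator_UN)
    qed simp
  qed
qed

lemma approximable_integrable:
  assumes "integrable M f"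
  shows "approximable f"
  using assms
proof (induction rule: integrable_induct)
  case (base A c)
  \<comment> \<open>The preimage of \<open>A\<close> under decoding is a set of sequences whose
    indicator, composed with \<open>b\<close>, agrees almost everywhere with that of
    \<open>A\<close>.\<close>
  define D where "D = dec -` A \<inter> space bits"
  have D [measurable]: "D \<in> sets bits"
    unfolding D_def using base by (intro measurable_sets[OF measurable_dec])
  have A: "integrable M (\<lambda>x. indicat_real A x *\<^sub>R c)"
    using base by simp
  show ?case
  proof (rule approximable_close[OF A])
    fix \<epsilon> :: real assume "\<epsilon> > 0"
    have "AE x in M. norm (indicat_real A x *\<^sub>R c - c * indicator D (b x)) = 0"
      using dec_b by eventually_elim (simp add: D_def indicator_def)
    then have "(\<integral>x. norm (indicat_real A x *\<^sub>R c - c * indicator D (b x)) \<partial>M) = 0"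
      by (rule integral_eq_zero_AE)
    then show "\<exists>g. approximable g \<and> (\<integral>x. norm (indicat_real A x *\<^sub>R c - g x) \<partial>M) < \<epsilon>"
      using approximable_scale[OF approximable_indicator_b[OF D], of c] \<open>\<epsilon> > 0\<close>
      by (intro exI[of _ "\<lambda>x. c * indicator D (b x)"]) simp
  qed
next
  case (add f g)
  then show ?case
    by (intro approximable_add)
next
  case (lim f s)
  show ?case
    by (rule approximable_limit[where g="\<lambda>x. 2 * norm (f x)" and s=s]) (use lim in auto)
qed

section \<open>Convolution with biased coins as an operator on L^1\<close>

definition walsh_l1 :: "nat set \<Rightarrow> 'a l1" where
  "walsh_l1 F = abs_l1 (\<lambda>x. walsh F (b x))"

definition walsh_sum_l1 :: "nat \<Rightarrow> (nat set \<Rightarrow> complex) \<Rightarrow> 'a l1" where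
  "walsh_sum_l1 n c = (\<Sum>F\<in>Pow {..<n}. c F *\<^sub>C walsh_l1 F)"

lemma walsh_sum_l1_eq: "walsh_sum_l1 n c = abs_l1 (\<lambda>x. walsh_sum n c (b x))"
  unfolding walsh_sum_l1_def walsh_l1_def walsh_sum_def
  by (simp add: abs_l1_scaleC abs_l1_sum integrable_b)

lemma norm_walsh_l1 [simp]: "norm (walsh_l1 F) = 1"
  unfolding walsh_l1_def by (subst norm_abs_l1) (auto simp: integrable_b prob_space)

lemma walsh_dense:
  assumes "\<epsilon> > 0"
  shows "\<exists>n c. norm (x - walsh_sum_l1 n c) < \<epsilon>"
proof -
  have "approximable (rep_l1 x)"
    by (rule approximable_integrable) simp
  then obtain n q where q: "depends_below n q" "(\<integral>y. norm (rep_l1 x y - q (b y)) \<partial>M) < \<epsilon>"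
    using assms unfolding approximable_def by blast
  then obtain c where c: "q = walsh_sum n c"
    using walsh_expansion by blast
  have "x - walsh_sum_l1 n c = abs_l1 (\<lambda>y. rep_l1 x y - q (b y))"
    using abs_l1_diff[of "rep_l1 x" "\<lambda>y. q (b y)"] by (simp add: walsh_sum_l1_eq c integrable_b)
  moreover have "norm (abs_l1 (\<lambda>y. rep_l1 x y - q (b y))) = (\<integral>y. norm (rep_l1 x y - q (b y)) \<partial>M)"
    using integrable_depends_below[OF q(1)] by (intro norm_abs_l1) simp
  ultimately show ?thesis
    using q(2) by metis
qed

text \<open>Convolution with \<open>biased_coins a\<close>; every element of the coin group is its
  own inverse, so the usual reflection is the identity. On a null set of x the integrand may fail to
  be integrable, and the value is then the default 0.\<close>

definition average :: "(nat \<Rightarrow> real) \<Rightarrow> ('a \<Rightarrow> complex) \<Rightarrow> 'a \<Rightarrow> complex" where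
  "average a f x = (\<integral>\<omega>. f (flip (x, \<omega>)) \<partial>biased_coins a)"

context
  fixes a :: "nat \<Rightarrow> real"
  assumes a: "\<forall>k. \<bar>a k\<bar> \<le> 1"
begin

interpretation pair_prob_space M "biased_coins a"
  by (rule pair_prob)

lemma integrable_flip:
  fixes f :: "'a \<Rightarrow> 'b::{banach, second_countable_topology}"
  assumes "integrable M f"
  shows "integrable (M \<Otimes>\<^sub>M biased_coins a) (\<lambda>p. f (flip p))"
  using assms integrable_distr[OF measurable_flip, of a f] by (simp add: distr_flip a)

lemma integral_flip:
  fixes f :: "'a \<Rightarrow> 'b::{banach, second_countable_topology}"
  assumes "f \<in> borel_measurable M"
  shows "(\<integral>p. f (flip p) \<partial>(M \<Otimes>\<^sub>M biased_coins a)) = (\<integral>x. f x \<partial>M)"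
  using assms integral_distr[OF measurable_flip, of f a] by (simp add: distr_flip a)

lemma integrable_average:
  assumes "integrable M f"
  shows "integrable M (average a f)"
  using integrable_fst'[OF integrable_flip[OF assms]] by (simp add: average_def[abs_def])

lemma AE_integrable_flip:
  fixes f :: "'a \<Rightarrow> complex"
  assumes "integrable M f"
  shows "AE x in M. integrable (biased_coins a) (\<lambda>\<omega>. f (flip (x, \<omega>)))"
  using AE_integrable_fst'[OF integrable_flip[OF assms]] .

text \<open>Fubini, and the fact that \<open>flip\<close> preserves the base measure.\<close>

lemma integral_norm_average_le:
  assumes f: "integrable M f"
  shows "(\<integral>x. norm (average a f x) \<partial>M) \<le> (\<integral>x. norm (f x) \<partial>M)"
proof -
  have nf: "integrable (M \<Otimes>\<^sub>M biased_coins a) (\<lambda>p. norm (f (flip p)))"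
    using integrable_flip[OF f] by simp
  have "(\<integral>x. norm (average a f x) \<partial>M) \<le> (\<integral>x. (\<integral>\<omega>. norm (f (flip (x, \<omega>))) \<partial>biased_coins a) \<partial>M)"
    using integrable_norm[OF integrable_average[OF f]] integrable_fst'[OF nf]
    by (intro integral_mono) (simp_all add: average_def)
  also have "\<dots> = (\<integral>p. norm (f (flip p)) \<partial>(M \<Otimes>\<^sub>M biased_coins a))"
    by (rule integral_fst'[OF nf])
  also have "\<dots> = (\<integral>x. norm (f x) \<partial>M)"
    using f by (intro integral_flip) simp
  finally show ?thesis .
qed

lemma coin_operator_exists:
  "\<exists>T :: 'a l1 \<Rightarrow>\<^sub>L 'a l1. complex_linear T \<and> norm T \<le> 1 \<and>
     (\<forall>f. integrable M f \<longrightarrow> blinfun_apply T (abs_l1 f) = abs_l1 (average a f))"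
proof (rule l1_operator_exists[where \<Phi>="\<lambda>f. abs_l1 (average a f)" and C=1])
  fix f g :: "'a \<Rightarrow> complex" and c :: complex
  assume f: "integrable M f"
  have "average a (\<lambda>x. c * f x) = (\<lambda>x. c * average a f x)"
    by (auto simp: average_def)
  then show "abs_l1 (average a (\<lambda>x. c * f x)) = c *\<^sub>C abs_l1 (average a f)"
    using integrable_average[OF f] by (simp add: abs_l1_scaleC)
  show "norm (abs_l1 (average a f)) \<le> 1 * (\<integral>x. norm (f x) \<partial>M)"
    using integral_norm_average_le[OF f] by (simp add: norm_abs_l1 integrable_average f)
  assume g: "integrable M g"
  have "AE x in M. average a (\<lambda>x. f x + g x) x = average a f x + average a g x"
    using AE_integrable_flip[OF f] AE_integrable_flip[OF g] by eventually_elim (simp add: average_def)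
  then show "abs_l1 (average a (\<lambda>x. f x + g x)) = abs_l1 (average a f) + abs_l1 (average a g)"
    using f g by (subst abs_l1_add) (auto intro!: abs_l1_cong_AE integrable_average)
qed auto

end

text \<open>The values on all \<open>abs_l1 f\<close> determine the operator, so the choice only
  names it.\<close>

definition coin_op :: "(nat \<Rightarrow> real) \<Rightarrow> 'a l1 \<Rightarrow>\<^sub>L 'a l1" where
  "coin_op a = (SOME T. complex_linear T \<and> norm T \<le> 1 \<and>
     (\<forall>f. integrable M f \<longrightarrow> blinfun_apply T (abs_l1 f) = abs_l1 (average a f)))"

context
  fixes a :: "nat \<Rightarrow> real"
  assumes a: "\<forall>k. \<bar>a k\<bar> \<le> 1"
begin

lemma coin_op:
  shows complex_linear_coin_op: "complex_linear (coin_op a)"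
    and norm_coin_op_le: "norm (coin_op a) \<le> 1"
    and coin_op_abs_l1: "integrable M f \<Longrightarrow> blinfun_apply (coin_op a) (abs_l1 f) = abs_l1 (average a f)"
  using someI_ex[OF coin_operator_exists[OF a]] unfolding coin_op_def by auto

lemma norm_coin_op_apply_le: "norm (blinfun_apply (coin_op a) x) \<le> norm x"
  using norm_blinfun[of "coin_op a" x] mult_right_mono[OF norm_coin_op_le norm_ge_zero[of x]] by simp

text \<open>A Walsh function is a character, so averaging over translations multiplies it by its
  mean under \<open>biased_coins a\<close>.\<close>

lemma coin_op_walsh:
  assumes F: "finite F"
  shows "blinfun_apply (coin_op a) (walsh_l1 F) = (\<Prod>k\<in>F. complex_of_real (a k)) *\<^sub>C walsh_l1 F"
proof -
  interpret pair_prob_space M "biased_coins a"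
    by (rule pair_prob)
  have "AE x in M. AE \<omega> in biased_coins a. b (flip (x, \<omega>)) = bxor (b x) \<omega>"
    using AE_pair[OF b_flip[OF a]] by simp
  then have "AE x in M. average a (\<lambda>x. walsh F (b x)) x = (\<Prod>k\<in>F. complex_of_real (a k)) * walsh F (b x)"
    using AE_space
  proof eventually_elim
    case (elim x)
    have [measurable]: "(\<lambda>\<omega>. flip (x, \<omega>)) \<in> biased_coins a \<rightarrow>\<^sub>M M"
      using measurable_Pair2[OF measurable_flip elim(2)] by simp
    have "average a (\<lambda>x. walsh F (b x)) x = (\<integral>\<omega>. walsh F (b x) * walsh F \<omega> \<partial>biased_coins a)"
      unfolding average_def walsh_bxor[symmetric]
      using elim by (intro integral_cong_AE) (auto elim!: eventually_mono)
    then show ?case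
      using F a by (simp add: integral_walsh_biased_coins)
  qed
  then show ?thesis
    unfolding walsh_l1_def
    by (subst coin_op_abs_l1) (auto simp: integrable_b abs_l1_scaleC a intro!: abs_l1_cong_AE integrable_average)
qed

lemma norm_coin_op: "norm (coin_op a) = 1"
proof (rule antisym[OF norm_coin_op_le])
  show "1 \<le> norm (coin_op a)"
    \<comment> \<open>The constant function \<open>walsh_l1 {}\<close> has norm 1 and is fixed, the
      product over the empty set being 1.\<close>
    using norm_blinfun[of "coin_op a" "walsh_l1 {}"] coin_op_walsh[of "{}"] by (simp add: norm_scaleC)
qed

text \<open>An average of nonnegative values is nonnegative, and the exceptional null set of f stays
  null because \<open>flip\<close> preserves measure.\<close>

lemma positive_coin_op: "positive_operator (coin_op a)"
  unfolding positive_operator_def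
proof (intro allI impI)
  interpret pair_prob_space M "biased_coins a"
    by (rule pair_prob)
  fix x :: "'a l1" assume "nonneg_l1 x"
  define f where "f = rep_l1 x"
  have f: "integrable M f" "x = abs_l1 f"
    by (simp_all add: f_def)
  with \<open>nonneg_l1 x\<close> have "AE y in M. f y \<in> \<real>\<^sub>\<ge>\<^sub>0"
    by (simp add: nonneg_abs_l1)
  then have "AE y in distr (M \<Otimes>\<^sub>M biased_coins a) M flip. f y \<in> \<real>\<^sub>\<ge>\<^sub>0"
    unfolding distr_flip[OF a] .
  then have "AE p in M \<Otimes>\<^sub>M biased_coins a. f (flip p) \<in> \<real>\<^sub>\<ge>\<^sub>0"
    by (rule AE_distrD[OF measurable_flip])
  then have "AE y in M. AE \<omega> in biased_coins a. f (flip (y, \<omega>)) \<in> \<real>\<^sub>\<ge>\<^sub>0"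
    by (rule AE_pair)
  then have "AE y in M. average a f y \<in> \<real>\<^sub>\<ge>\<^sub>0"
    using AE_integrable_flip[OF a f(1)]
  proof eventually_elim
    case (elim y)
    from elim(2) have [measurable]: "(\<lambda>\<omega>. f (flip (y, \<omega>))) \<in> borel_measurable (biased_coins a)"
      by simp
    from elim have "average a f y = (\<integral>\<omega>. complex_of_real (Re (f (flip (y, \<omega>)))) \<partial>biased_coins a)"
      unfolding average_def
      by (intro integral_cong_AE) (auto elim!: eventually_mono simp: complex_nonneg_Reals_iff complex_eq_iff)
    also have "\<dots> = complex_of_real (\<integral>\<omega>. Re (f (flip (y, \<omega>))) \<partial>biased_coins a)"
      by simp
    also have "\<dots> \<in> \<real>\<^sub>\<ge>\<^sub>0"
      using elim(1)
      by (auto simp: complex_nonneg_Reals_iff intro!: integral_nonneg_AE elim!: eventually_mono)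
    finally show ?case .
  qed
  then show "nonneg_l1 (blinfun_apply (coin_op a) x)"
    by (simp add: f coin_op_abs_l1 nonneg_abs_l1 integrable_average a)
qed

end

section \<open>Walsh coefficients as functionals\<close>

definition walsh_coeff :: "nat set \<Rightarrow> 'a l1 \<Rightarrow>\<^sub>L complex" where
  "walsh_coeff F = (SOME \<phi>. complex_linear \<phi> \<and> norm \<phi> \<le> 1 \<and>
     (\<forall>f. integrable M f \<longrightarrow> blinfun_apply \<phi> (abs_l1 f) = (\<integral>x. f x * walsh F (b x) \<partial>M)))"

lemma walsh_coeff:
  shows complex_linear_walsh_coeff: "complex_linear (walsh_coeff F)"
    and norm_walsh_coeff_le: "norm (walsh_coeff F) \<le> 1"
    and walsh_coeff_abs_l1:
      "integrable M f \<Longrightarrow> blinfun_apply (walsh_coeff F) (abs_l1 f) = (\<integral>x. f x * walsh F (b x) \<partial>M)"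
proof -
  have "\<exists>\<phi> :: 'a l1 \<Rightarrow>\<^sub>L complex. complex_linear \<phi> \<and> norm \<phi> \<le> 1 \<and>
     (\<forall>f. integrable M f \<longrightarrow> blinfun_apply \<phi> (abs_l1 f) = (\<integral>x. f x * walsh F (b x) \<partial>M))"
    by (rule l1_functional_exists[of "\<lambda>x. walsh F (b x)" 1]) auto
  from someI_ex[OF this] show "complex_linear (walsh_coeff F)" "norm (walsh_coeff F) \<le> 1"
      "integrable M f \<Longrightarrow> blinfun_apply (walsh_coeff F) (abs_l1 f) = (\<integral>x. f x * walsh F (b x) \<partial>M)"
    unfolding walsh_coeff_def by auto
qed

lemma norm_walsh_coeff_apply_le: "norm (blinfun_apply (walsh_coeff F) x) \<le> norm x"
  using norm_blinfun[of "walsh_coeff F" x] mult_right_mono[OF norm_walsh_coeff_le[of F] norm_ge_zero[of x]] by simp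

lemma walsh_coeff_walsh:
  "finite F \<Longrightarrow> finite G \<Longrightarrow> blinfun_apply (walsh_coeff F) (walsh_l1 G) = (if F = G then 1 else 0)"
  unfolding walsh_l1_def by (subst walsh_coeff_abs_l1) (auto simp: integrable_b integral_walsh_mult)

lemma walsh_coeff_walsh_sum:
  assumes "F \<subseteq> {..<n}"
  shows "blinfun_apply (walsh_coeff F) (walsh_sum_l1 n c) = c F"
proof -
  have "blinfun_apply (walsh_coeff F) (walsh_sum_l1 n c) = (\<Sum>G\<in>Pow {..<n}. c G *\<^sub>C blinfun_apply (walsh_coeff F) (walsh_l1 G))"
    unfolding walsh_sum_l1_def by (rule complex_linear_sum[OF complex_linear_walsh_coeff])
  also have "\<dots> = (\<Sum>G\<in>Pow {..<n}. if G = F then c F else 0)"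
    using assms by (intro sum.cong refl) (auto simp: walsh_coeff_walsh scaleC_complex_def finite_subset)
  finally show ?thesis
    using assms by simp
qed

text \<open>The defect of this identity is linear and bounded by \<open>2 * norm x\<close>, and it
  vanishes on the dense set of Walsh sums. Arbitrary x are needed when the averaging follows an
  arbitrary T.\<close>

lemma walsh_coeff_coin_op:
  assumes a: "\<forall>k. \<bar>a k\<bar> \<le> 1" and F: "finite F"
  shows "blinfun_apply (walsh_coeff F) (blinfun_apply (coin_op a) x)
    = (\<Prod>k\<in>F. complex_of_real (a k)) * blinfun_apply (walsh_coeff F) x"
proof -
  let ?p = "\<Prod>k\<in>F. complex_of_real (a k)"
  have p: "norm ?p \<le> 1"
    using a by (auto simp: prod_norm[symmetric] intro!: prod_le_1)
  define D where "D x = blinfun_apply (walsh_coeff F) (blinfun_apply (coin_op a) x) - ?p * blinfun_apply (walsh_coeff F) x" for x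
  have D_diff: "D (x - y) = D x - D y" for x y
    by (simp add: D_def blinfun.diff_right algebra_simps)
  have D_bound: "norm (D x) \<le> 2 * norm x" for x
  proof -
    have "norm (D x) \<le> norm (blinfun_apply (coin_op a) x) + 1 * norm x"
      unfolding D_def by (rule order_trans[OF norm_triangle_ineq4], unfold norm_mult)
        (intro add_mono mult_mono p norm_walsh_coeff_apply_le; simp)
    then show ?thesis
      using norm_coin_op_apply_le[OF a, of x] by simp
  qed
  have D_walsh: "D (walsh_sum_l1 n c) = 0" for n c
    unfolding D_def walsh_sum_l1_def complex_linear_sum[OF complex_linear_walsh_coeff]
      complex_linear_sum[OF complex_linear_coin_op[OF a]] sum_distrib_left sum_subtractf[symmetric]
  proof (rule sum.neutral, rule ballI)
    fix G assume "G \<in> Pow {..<n}"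
    then have "finite G"
      by (auto intro: finite_subset)
    then show "c G *\<^sub>C blinfun_apply (walsh_coeff F) (blinfun_apply (coin_op a) (walsh_l1 G))
        - ?p * c G *\<^sub>C blinfun_apply (walsh_coeff F) (walsh_l1 G) = 0"
      using complex_linear_walsh_coeff[of F] F
      by (simp add: coin_op_walsh a complex_linear_def walsh_coeff_walsh scaleC_complex_def)
  qed
  have "norm (D x) \<le> 0"
  proof (rule field_le_epsilon)
    fix \<epsilon> :: real assume "\<epsilon> > 0"
    then obtain n c where "norm (x - walsh_sum_l1 n c) < \<epsilon> / 2"
      using walsh_dense[of "\<epsilon> / 2" x] by auto
    then show "norm (D x) \<le> 0 + \<epsilon>"
      using D_bound[of "x - walsh_sum_l1 n c"] by (simp add: D_diff D_walsh)
  qed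
  then show ?thesis
    by (simp add: D_def)
qed

end

section \<open>Uniform integrability of weakly null sequences\<close>

text \<open>Gliding hump: on small sets \<open>A\<^sub>k\<close> carrying mass of \<open>X (n\<^sub>k)\<close>, a test function is overwritten by
  \<open>0\<close> or by the conjugate sign of \<open>X (n\<^sub>k)\<close>; one of the two choices keeps the integral away from \<open>0\<close>,
  and later modifications take place on sets too small to matter.\<close>

lemma weakly_null_uniformly_integrable:
  fixes X :: "nat \<Rightarrow> 'b \<Rightarrow> complex"
  assumes N: "finite_measure N"
    and X [measurable]: "\<And>n. X n \<in> borel_measurable N"
    and bounded: "\<And>n. \<exists>K. \<forall>x. norm (X n x) \<le> K"
    and weak: "\<And>g. g \<in> borel_measurable N \<Longrightarrow> \<forall>x. norm (g x) \<le> 1 \<Longrightarrow> (\<lambda>n. \<integral>x. X n x * g x \<partial>N) \<longlonglongrightarrow> 0"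
    and \<epsilon>: "\<epsilon> > 0"
  shows "\<exists>\<delta>>0. \<exists>n0. \<forall>n\<ge>n0. \<forall>A\<in>sets N. measure N A \<le> \<delta> \<longrightarrow> (\<integral>x. norm (X n x) * indicator A x \<partial>N) \<le> \<epsilon>"
proof (rule ccontr)
  interpret finite_measure N by (rule N)
  have int: "integrable N (\<lambda>x. X n x * g x)" if [measurable]: "g \<in> borel_measurable N" and g: "\<forall>x. norm (g x) \<le> 1" for n g
  proof -
    obtain K where "\<forall>x. norm (X n x) \<le> K"
      using bounded by blast
    then have "integrable N (X n)"
      by (intro integrable_const_bound[where B=K]) auto
    then show ?thesis
      using g by (intro integrable_mult_bounded[where C=1]) auto
  qed
  assume "\<not> ?thesis"
  then have hump: "\<exists>n\<ge>n0. \<exists>A\<in>sets N. measure N A \<le> \<delta> \<and> \<epsilon> < (\<integral>x. norm (X n x) * indicator A x \<partial>N)"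
    if "\<delta> > 0" for \<delta> n0
    using that by (meson not_le)
  \<comment> \<open>\<open>\<eta>\<close> is the budget of a stage: later changes stay within a set
    of measure at most \<open>\<eta>\<close>, where altering \<open>g\<close> by at most 2 moves the
    integral by at most 2 * \<epsilon> / 8 = \<epsilon> / 4.\<close>
  define good where "good n g \<eta> \<longleftrightarrow> g \<in> borel_measurable N \<and> (\<forall>x. norm (g x) \<le> 1) \<and> \<eta> > 0 \<and>
      \<epsilon> / 2 \<le> norm (\<integral>x. X n x * g x \<partial>N) \<and> (\<forall>x. norm (X n x) * \<eta> \<le> \<epsilon> / 8)"
    for n g and \<eta> :: real
  have step: "\<exists>n' A g' \<eta>'. good n' g' \<eta>' \<and> n < n' \<and> A \<in> sets N \<and> measure N A \<le> \<eta> / 2 \<and>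
      (\<forall>x. x \<notin> A \<longrightarrow> g' x = g x) \<and> \<eta>' \<le> \<eta> / 2"
    if g [measurable]: "g \<in> borel_measurable N" and g1: "\<forall>x. norm (g x) \<le> 1" and \<eta>: "\<eta> > 0" for n g and \<eta> :: real
  proof -
    obtain n' A where n': "Suc n \<le> n'" and A [measurable]: "A \<in> sets N" and mA: "measure N A \<le> \<eta> / 2"
      and big: "\<epsilon> < (\<integral>x. norm (X n' x) * indicator A x \<partial>N)"
      using hump[of "\<eta> / 2" "Suc n"] \<eta> by auto
    \<comment> \<open>The two candidates agree off \<open>A\<close>, and their integrals against
      \<open>X n'\<close> differ by the mass of \<open>X n'\<close> on \<open>A\<close>. As this
      exceeds \<epsilon>, one of the integrals has absolute value at least \<epsilon> / 2.\<close>
    define g0 where "g0 x = (if x \<in> A then 0 else g x)" for x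
    define g1 where "g1 x = (if x \<in> A then cnj (sgn (X n' x)) else g x)" for x
    have [measurable]: "cnj \<in> borel_measurable borel"
      by (intro borel_measurable_continuous_onI continuous_intros)
    have m: "g0 \<in> borel_measurable N" "g1 \<in> borel_measurable N"
      unfolding g0_def g1_def sgn_div_norm by measurable
    have le: "\<forall>x. norm (g0 x) \<le> 1" "\<forall>x. norm (g1 x) \<le> 1"
      using \<open>\<forall>x. norm (g x) \<le> 1\<close> by (auto simp: g0_def g1_def norm_sgn)
    have sgn: "z * cnj (sgn z) = complex_of_real (norm z)" for z
      by (cases "z = 0") (simp_all add: sgn_div_norm scaleR_conv_of_real complex_norm_square[symmetric]
          power2_eq_square field_simps)
    have "(\<integral>x. X n' x * g1 x \<partial>N) - (\<integral>x. X n' x * g0 x \<partial>N) = (\<integral>x. X n' x * g1 x - X n' x * g0 x \<partial>N)"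
      by (intro Bochner_Integration.integral_diff[symmetric] int m le)
    also have "\<dots> = (\<integral>x. complex_of_real (norm (X n' x) * indicator A x) \<partial>N)"
      by (intro Bochner_Integration.integral_cong refl) (auto simp: g0_def g1_def indicator_def sgn)
    also have "\<dots> = complex_of_real (\<integral>x. norm (X n' x) * indicator A x \<partial>N)"
      by (rule integral_complex_of_real)
    finally have "\<epsilon> < norm ((\<integral>x. X n' x * g1 x \<partial>N) - (\<integral>x. X n' x * g0 x \<partial>N))"
      using big by simp
    also have "\<dots> \<le> norm (\<integral>x. X n' x * g1 x \<partial>N) + norm (\<integral>x. X n' x * g0 x \<partial>N)"
      by (rule norm_triangle_ineq4)
    finally have "\<epsilon> / 2 \<le> norm (\<integral>x. X n' x * g1 x \<partial>N) \<or> \<epsilon> / 2 \<le> norm (\<integral>x. X n' x * g0 x \<partial>N)"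
      by linarith
    then obtain g' where g': "g' \<in> {g0, g1}" "\<epsilon> / 2 \<le> norm (\<integral>x. X n' x * g' x \<partial>N)"
      by blast
    obtain K0 where K0: "\<forall>x. norm (X n' x) \<le> K0"
      using bounded by blast
    define K where "K = \<bar>K0\<bar> + 1"
    have K: "K > 0" "\<And>x. norm (X n' x) \<le> K"
      using K0[rule_format, THEN order_trans[of _ _ K]] by (auto simp: K_def)
    \<comment> \<open>The term \<open>\<eta> / 2\<close> makes the measures of the later sets
      summable; the term \<open>\<epsilon> / (8 * K)\<close> protects the integral just
      secured.\<close>
    define \<eta>' where "\<eta>' = min (\<eta> / 2) (\<epsilon> / (8 * K))"
    have \<eta>': "\<eta>' > 0" "\<eta>' \<le> \<eta> / 2"
      unfolding \<eta>'_def using \<eta> \<epsilon> K(1) by (simp, intro min.cobounded1)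
    have "norm (X n' x) * \<eta>' \<le> \<epsilon> / 8" for x
    proof -
      have "norm (X n' x) * \<eta>' \<le> K * (\<epsilon> / (8 * K))"
        using K \<eta>' by (intro mult_mono) (auto simp: \<eta>'_def intro: min.cobounded2)
      then show ?thesis
        using K(1) by simp
    qed
    then have "good n' g' \<eta>'"
      using g' m le \<eta>' by (auto simp: good_def)
    moreover have "\<forall>x. x \<notin> A \<longrightarrow> g' x = g x"
      using g'(1) by (auto simp: g0_def g1_def)
    ultimately show ?thesis
      using n' A mA \<eta>' by (intro exI[of _ n'] exI[of _ A] exI[of _ g'] exI[of _ \<eta>']) auto
  qed
  have "\<exists>f. \<forall>k. (case f k of (n, A, g, \<eta>) \<Rightarrow> good n g \<eta>) \<and>
      (case f k of (n, A, g, \<eta>) \<Rightarrow> case f (Suc k) of (n', A', g', \<eta>') \<Rightarrow>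
        n < n' \<and> A' \<in> sets N \<and> measure N A' \<le> \<eta> / 2 \<and> (\<forall>x. x \<notin> A' \<longrightarrow> g' x = g x) \<and> \<eta>' \<le> \<eta> / 2)"
  proof (rule dependent_nat_choice)
    obtain n g \<eta> where "good n g \<eta>"
      using step[of "\<lambda>_. 0" 1 0] by auto
    then show "\<exists>s :: nat \<times> 'b set \<times> ('b \<Rightarrow> complex) \<times> real. case s of (n, A, g, \<eta>) \<Rightarrow> good n g \<eta>"
      by (intro exI[of _ "(n, {}, g, \<eta>)"]) simp
  next
    fix s :: "nat \<times> 'b set \<times> ('b \<Rightarrow> complex) \<times> real" and k :: nat
    assume s: "case s of (n, A, g, \<eta>) \<Rightarrow> good n g \<eta>"
    obtain n A g \<eta> where eq: "s = (n, A, g, \<eta>)"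
      by (cases s) auto
    obtain n' A' g' \<eta>' where "good n' g' \<eta>' \<and> n < n' \<and> A' \<in> sets N \<and> measure N A' \<le> \<eta> / 2 \<and>
      (\<forall>x. x \<notin> A' \<longrightarrow> g' x = g x) \<and> \<eta>' \<le> \<eta> / 2"
      using step[of g \<eta> n] s by (auto simp: eq good_def)
    then show "\<exists>t. (case t of (n, A, g, \<eta>) \<Rightarrow> good n g \<eta>) \<and>
      (case s of (n, A, g, \<eta>) \<Rightarrow> case t of (n', A', g', \<eta>') \<Rightarrow>
        n < n' \<and> A' \<in> sets N \<and> measure N A' \<le> \<eta> / 2 \<and> (\<forall>x. x \<notin> A' \<longrightarrow> g' x = g x) \<and> \<eta>' \<le> \<eta> / 2)"
      by (intro exI[of _ "(n', A', g', \<eta>')"]) (simp add: eq)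
  qed
  then obtain f where f: "\<forall>k. (case f k of (n, A, g, \<eta>) \<Rightarrow> good n g \<eta>) \<and>
      (case f k of (n, A, g, \<eta>) \<Rightarrow> case f (Suc k) of (n', A', g', \<eta>') \<Rightarrow>
        n < n' \<and> A' \<in> sets N \<and> measure N A' \<le> \<eta> / 2 \<and> (\<forall>x. x \<notin> A' \<longrightarrow> g' x = g x) \<and> \<eta>' \<le> \<eta> / 2)"
    by (elim exE)
  define n where "n k = fst (f k)" for k
  define A where "A k = fst (snd (f k))" for k
  define g where "g k = fst (snd (snd (f k)))" for k
  define \<eta> where "\<eta> k = snd (snd (snd (f k)))" for k
  have good: "good (n k) (g k) (\<eta> k)" for k
    using conjunct1[OF f[rule_format, of k]] by (simp add: n_def g_def \<eta>_def split: prod.splits)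
  have next_k: "n k < n (Suc k)" "A (Suc k) \<in> sets N" "measure N (A (Suc k)) \<le> \<eta> k / 2"
      "\<And>x. x \<notin> A (Suc k) \<Longrightarrow> g (Suc k) x = g k x" "\<eta> (Suc k) \<le> \<eta> k / 2" for k
    using conjunct2[OF f[rule_format, of k]] by (simp_all add: n_def A_def g_def \<eta>_def split: prod.splits)
  have [measurable]: "g k \<in> borel_measurable N" for k
    using good[of k] by (simp add: good_def)
  have g1: "norm (g k x) \<le> 1" for k x
    using good[of k] by (simp add: good_def)
  \<comment> \<open>Where the stages do not converge, which can happen only inside every
    \<open>B k\<close>, the value of \<open>lim\<close> is arbitrary; the cut keeps \<open>G\<close>
    bounded by 1 there.\<close>
  define G where "G x = (if norm (lim (\<lambda>j. g j x)) \<le> 1 then lim (\<lambda>j. g j x) else 0)" for x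
  have G [measurable]: "G \<in> borel_measurable N"
  proof -
    have [measurable]: "(\<lambda>x. lim (\<lambda>j. g j x)) \<in> borel_measurable N"
      by (rule borel_measurable_lim_metric) simp
    show ?thesis
      unfolding G_def by measurable
  qed
  have G1: "\<forall>x. norm (G x) \<le> 1"
    by (simp add: G_def)
  define B where "B k = (\<Union>i. A (Suc (k + i)))" for k
  have B [measurable]: "B k \<in> sets N" for k
    unfolding B_def using next_k(2) by auto
  have \<eta>_decay: "\<eta> (k + i) \<le> \<eta> k * (1 / 2) ^ i" for k i
  proof (induction i)
    case (Suc i)
    then show ?case
      using next_k(5)[of "k + i"] by simp
  qed simp
  \<comment> \<open>The budgets at least halve, so the sets in the union have measures at most
    \<open>\<eta> k\<close> times 1/2, 1/4, ..., which add up to \<open>\<eta> k\<close>.\<close>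
  have mB: "measure N (B k) \<le> \<eta> k" for k
  proof -
    have le: "measure N (A (Suc (k + i))) \<le> \<eta> k * (1 / 2) ^ Suc i" for i
      using next_k(3)[of "k + i"] \<eta>_decay[of k i] by simp
    have sums: "(\<lambda>i. \<eta> k * (1 / 2) ^ Suc i) sums (\<eta> k * 1)"
      using power_half_series by (intro sums_mult)
    have summ: "summable (\<lambda>i. measure N (A (Suc (k + i))))"
      by (rule summable_comparison_test[OF _ sums_summable[OF sums]]) (use le in auto)
    have "measure N (B k) \<le> (\<Sum>i. measure N (A (Suc (k + i))))"
      unfolding B_def using next_k(2) by (intro finite_measure_subadditive_countably summ) auto
    also have "\<dots> \<le> (\<Sum>i. \<eta> k * (1 / 2) ^ Suc i)"
      by (intro suminf_le le summ sums_summable[OF sums])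
    also have "\<dots> = \<eta> k"
      using sums_unique[OF sums] by simp
    finally show ?thesis .
  qed
  have G_eq: "G x = g k x" if "x \<notin> B k" for x k
  proof -
    have "g (k + i) x = g k x" for i
      using that by (induction i) (auto simp: B_def next_k(4))
    then have "eventually (\<lambda>j. g j x = g k x) sequentially"
      unfolding eventually_sequentially by (metis le_Suc_ex)
    then have "(\<lambda>j. g j x) \<longlonglongrightarrow> g k x"
      by (rule tendsto_eventually)
    then have "lim (\<lambda>j. g j x) = g k x"
      by (rule limI)
    then show ?thesis
      using g1 by (simp add: G_def)
  qed
  \<comment> \<open>Passing from \<open>g k\<close> to the limit loses at most \<epsilon> / 4 of the
    \<epsilon> / 2 secured at stage k.\<close>
  have far: "\<epsilon> / 4 \<le> norm (\<integral>x. X (n k) x * G x \<partial>N)" for k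
  proof -
    have \<eta>k: "\<eta> k > 0" "\<epsilon> / 2 \<le> norm (\<integral>x. X (n k) x * g k x \<partial>N)" "\<And>x. norm (X (n k) x) * \<eta> k \<le> \<epsilon> / 8"
      using good[of k] by (auto simp: good_def)
    have int2: "integrable N (\<lambda>x. X (n k) x * G x)" "integrable N (\<lambda>x. X (n k) x * g k x)"
      using g1 by (auto intro!: int G1)
    have "norm ((\<integral>x. X (n k) x * G x \<partial>N) - (\<integral>x. X (n k) x * g k x \<partial>N))
        = norm (\<integral>x. X (n k) x * G x - X (n k) x * g k x \<partial>N)"
      using int2 by simp
    also have "\<dots> \<le> (\<integral>x. norm (X (n k) x * G x - X (n k) x * g k x) \<partial>N)"
      by (rule integral_norm_bound)
    also have "\<dots> \<le> (\<integral>x. \<epsilon> / (4 * \<eta> k) * indicator (B k) x \<partial>N)"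
    proof (intro integral_mono)
      show "integrable N (\<lambda>x. \<epsilon> / (4 * \<eta> k) * indicator (B k) x)"
        by (intro integrable_mult_right integrable_real_indicator) (auto simp: emeasure_eq_measure)
      fix x
      show "norm (X (n k) x * G x - X (n k) x * g k x) \<le> \<epsilon> / (4 * \<eta> k) * indicator (B k) x"
      proof (cases "x \<in> B k")
        case True
        have "norm (G x - g k x) \<le> 2"
          using norm_triangle_ineq4[of "G x" "g k x"] G1[rule_format, of x] g1[of k x] by simp
        moreover have "norm (X (n k) x) \<le> \<epsilon> / (8 * \<eta> k)"
          using \<eta>k(1) \<eta>k(3)[of x] by (simp add: field_simps)
        ultimately have "norm (X (n k) x) * norm (G x - g k x) \<le> \<epsilon> / (8 * \<eta> k) * 2"
          using \<eta>k(1) \<epsilon> by (intro mult_mono) auto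
        then show ?thesis
          using True by (simp add: right_diff_distrib[symmetric] norm_mult)
      qed (simp add: G_eq)
    qed (use int2 in auto)
    also have "\<dots> = \<epsilon> / (4 * \<eta> k) * measure N (B k)"
      by (simp add: measure_def)
    also have "\<dots> \<le> \<epsilon> / (4 * \<eta> k) * \<eta> k"
      using \<eta>k(1) \<epsilon> by (intro mult_left_mono mB) auto
    also have "\<dots> = \<epsilon> / 4"
      using \<eta>k(1) by simp
    finally have "norm ((\<integral>x. X (n k) x * G x \<partial>N) - (\<integral>x. X (n k) x * g k x \<partial>N)) \<le> \<epsilon> / 4" .
    then show ?thesis
      using \<eta>k(2) norm_triangle_ineq2[of "\<integral>x. X (n k) x * g k x \<partial>N" "\<integral>x. X (n k) x * G x \<partial>N"]
      by (simp add: norm_minus_commute)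
  qed
  have "strict_mono n"
    using next_k(1) by (simp add: strict_mono_Suc_iff)
  from LIMSEQ_subseq_LIMSEQ[OF weak[OF G G1] this]
  have "(\<lambda>k. \<integral>x. X (n k) x * G x \<partial>N) \<longlonglongrightarrow> 0"
    by (simp add: comp_def)
  then have "(\<lambda>k. norm (\<integral>x. X (n k) x * G x \<partial>N)) \<longlonglongrightarrow> 0"
    by (rule tendsto_norm_zero)
  then have "eventually (\<lambda>k. norm (\<integral>x. X (n k) x * G x \<partial>N) < \<epsilon> / 4) sequentially"
    using \<epsilon> by (intro order_tendstoD(2)[where y=0]) auto
  then show False
    using far by (auto simp: eventually_sequentially not_less[symmetric])
qed

section \<open>The averaging operator is Dunford--Pettis\<close>

text \<open>The Dirichlet kernel of the coin group: the sum over subsets factors into terms 1 + 1 or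
  1 - 1, which leaves the normalised indicator of a cylinder.\<close>

lemma walsh_kernel:
  "walsh_sum n (\<lambda>F. walsh F \<omega>) \<omega>' = (if \<forall>k<n. \<omega> k = \<omega>' k then 2 ^ n else 0)"
proof -
  have "walsh_sum n (\<lambda>F. walsh F \<omega>) \<omega>' = (\<Sum>F\<in>Pow {..<n}. walsh F (bxor \<omega> \<omega>') * (\<Prod>k\<in>{..<n} - F. 1))"
    by (simp add: walsh_sum_def walsh_bxor)
  also have "\<dots> = (\<Prod>k<n. (if bxor \<omega> \<omega>' k then -1 else 1) + 1)"
    unfolding walsh_def by (rule prod_add[symmetric]) simp
  also have "\<dots> = (if \<forall>k<n. \<omega> k = \<omega>' k then 2 ^ n else 0)"
  proof (cases "\<forall>k<n. \<omega> k = \<omega>' k")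
    case True
    then have "(\<Prod>k<n. (if bxor \<omega> \<omega>' k then -1 else 1) + 1 :: complex) = (\<Prod>k<n. 2)"
      by (intro prod.cong refl) (simp add: bxor_def)
    with True show ?thesis
      by simp
  next
    case False
    then show ?thesis
      by (auto simp: bxor_def)
  qed
  finally show ?thesis .
qed

lemma weakly_nullD:
  fixes \<phi> :: "'b::complex_normed_space \<Rightarrow>\<^sub>L complex"
  shows "weakly_null x \<Longrightarrow> complex_linear \<phi> \<Longrightarrow> (\<lambda>n. blinfun_apply \<phi> (x n)) \<longlonglongrightarrow> 0"
  by (simp add: weakly_null_def)

lemma weakly_null_close:
  fixes x y :: "nat \<Rightarrow> 'b::complex_normed_space"
  assumes x: "weakly_null x" and close: "(\<lambda>n. norm (x n - y n)) \<longlonglongrightarrow> 0"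
  shows "weakly_null y"
  unfolding weakly_null_def
proof (intro allI impI)
  fix \<phi> :: "'b \<Rightarrow>\<^sub>L complex" assume \<phi>: "complex_linear \<phi>"
  have "(\<lambda>n. x n - y n) \<longlonglongrightarrow> 0"
    using close by (rule tendsto_norm_zero_cancel)
  then have "(\<lambda>n. blinfun_apply \<phi> (x n - y n)) \<longlonglongrightarrow> blinfun_apply \<phi> 0"
    by (intro tendsto_intros)
  from tendsto_diff[OF weakly_nullD[OF x \<phi>] this] show "(\<lambda>n. blinfun_apply \<phi> (y n)) \<longlonglongrightarrow> 0"
    by (simp add: blinfun.diff_right blinfun.zero_right)
qed

section \<open>Parseval, truncation and the Dunford--Pettis property\<close>

context coin_coding
begin

lemma walsh_parseval:
  "(\<integral>x. (norm (walsh_sum n c (b x)))\<^sup>2 \<partial>M) = (\<Sum>F\<in>Pow {..<n}. (norm (c F))\<^sup>2)"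
proof -
  have fin: "finite F" if "F \<in> Pow {..<n}" for F
    using that by (auto intro: finite_subset)
  have int: "integrable M (\<lambda>x. walsh F (b x) * walsh G (b x))" for F G
    by (rule integrable_mult_bounded[where C=1]) (auto intro: integrable_b)
  have "complex_of_real (\<integral>x. (norm (walsh_sum n c (b x)))\<^sup>2 \<partial>M)
      = (\<integral>x. walsh_sum n c (b x) * cnj (walsh_sum n c (b x)) \<partial>M)"
    by (simp add: integral_complex_of_real[symmetric] complex_norm_square del: of_real_power integral_complex_of_real)
  also have "\<dots> = (\<integral>x. (\<Sum>F\<in>Pow {..<n}. \<Sum>G\<in>Pow {..<n}. c F * cnj (c G) * (walsh F (b x) * walsh G (b x))) \<partial>M)"
    unfolding walsh_sum_def cnj_sum sum_product by (simp add: mult_ac)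
  also have "\<dots> = (\<Sum>F\<in>Pow {..<n}. \<Sum>G\<in>Pow {..<n}. c F * cnj (c G) * (\<integral>x. walsh F (b x) * walsh G (b x) \<partial>M))"
    using int by (simp add: Bochner_Integration.integral_sum)
  also have "\<dots> = (\<Sum>F\<in>Pow {..<n}. \<Sum>G\<in>Pow {..<n}. if F = G then c F * cnj (c F) else 0)"
    by (intro sum.cong refl) (auto simp: integral_walsh_mult fin)
  also have "\<dots> = (\<Sum>F\<in>Pow {..<n}. c F * cnj (c F))"
    by (intro sum.cong refl) simp
  also have "\<dots> = complex_of_real (\<Sum>F\<in>Pow {..<n}. (norm (c F))\<^sup>2)"
    by (simp only: of_real_sum complex_norm_square)
  finally show ?thesis
    by (simp only: of_real_eq_iff)
qed

lemma norm_walsh_sum_l1: "norm (walsh_sum_l1 n c) = (\<integral>x. norm (walsh_sum n c (b x)) \<partial>M)"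
  unfolding walsh_sum_l1_eq by (rule norm_abs_l1[OF integrable_b(1)])

text \<open>Parseval together with the comparison of L^1 and L^2 norms, which comes from the
  nonnegativity of a variance.\<close>

lemma norm_walsh_sum_l1_le:
  "(norm (walsh_sum_l1 n c))\<^sup>2 \<le> (\<Sum>F\<in>Pow {..<n}. (norm (c F))\<^sup>2)"
proof -
  define t where "t = norm (walsh_sum_l1 n c)"
  have int1: "integrable M (\<lambda>x. norm (walsh_sum n c (b x)))"
    by (intro integrable_norm integrable_b)
  have int2: "integrable M (\<lambda>x. (norm (walsh_sum n c (b x)))\<^sup>2)"
    by (rule integrable_const_bound[where B="(\<Sum>F\<in>Pow {..<n}. norm (c F))\<^sup>2"])
      (auto intro!: power_mono norm_walsh_sum_le)
  have "0 \<le> (\<integral>x. (norm (walsh_sum n c (b x)) - t)\<^sup>2 \<partial>M)"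
    by (rule Bochner_Integration.integral_nonneg) simp
  also have "\<dots> = (\<integral>x. (norm (walsh_sum n c (b x)))\<^sup>2 - 2 * t * norm (walsh_sum n c (b x)) + t\<^sup>2 \<partial>M)"
    by (simp add: power2_diff algebra_simps)
  also have "\<dots> = (\<Sum>F\<in>Pow {..<n}. (norm (c F))\<^sup>2) - 2 * t * t + t\<^sup>2"
    using int1 int2 by (simp add: walsh_parseval t_def norm_walsh_sum_l1 prob_space)
  finally show ?thesis
    by (simp add: t_def power2_eq_square)
qed

text \<open>Turns uniform integrability into an L^1 bound: the space splits into
  \<open>2 ^ n\<close> cylinders of measure \<open>(1 / 2) ^ n < \<delta>\<close>, each carrying at
  most \<epsilon>. \<open>B\<close> is chosen before \<open>h\<close>, so one bound serves a whole
  sequence.\<close>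

lemma integral_cylinder_le:
  fixes \<epsilon> :: real
  assumes "0 < \<delta>" "0 < \<epsilon>"
  shows "\<exists>B>0. \<forall>h :: 'a \<Rightarrow> real. h \<in> borel_measurable M \<longrightarrow> (\<exists>K. \<forall>x. \<bar>h x\<bar> \<le> K) \<longrightarrow>
    (\<forall>A\<in>sets M. measure M A \<le> \<delta> \<longrightarrow> (\<integral>x. h x * indicator A x \<partial>M) \<le> \<epsilon>) \<longrightarrow> (\<integral>x. h x \<partial>M) \<le> B"
proof -
  obtain n where n: "(1 / 2) ^ n < \<delta>"
    using real_arch_pow_inv[of \<delta> "1/2"] assms by auto
  define cyl where "cyl s = {x \<in> space M. \<forall>k<n. b x k = (k \<in> s)}" for s :: "nat set"
  have cyl [measurable]: "cyl s \<in> sets M" for s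
  proof -
    have [measurable]: "(\<lambda>x. b x k) \<in> M \<rightarrow>\<^sub>M count_space UNIV" for k
      by (rule measurable_compose[OF measurable_b measurable_bits])
    show ?thesis
      unfolding cyl_def by measurable
  qed
  have m_cyl: "measure M (cyl s) \<le> \<delta>" for s
  proof -
    \<comment> \<open>\<open>2 ^ n\<close> times the indicator is a Walsh kernel, whose only term
      with nonzero integral is the one for \<open>F = {}\<close>.\<close>
    have "complex_of_real (2 ^ n * measure M (cyl s)) = (\<integral>x. complex_of_real (2 ^ n * indicator (cyl s) x) \<partial>M)"
      by (simp add: integral_complex_of_real)
    also have "\<dots> = (\<integral>x. walsh_sum n (\<lambda>F. walsh F (\<lambda>k. k \<in> s)) (b x) \<partial>M)"
      by (intro Bochner_Integration.integral_cong refl) (auto simp: walsh_kernel cyl_def indicator_def)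
    also have "\<dots> = (\<Sum>F\<in>Pow {..<n}. walsh F (\<lambda>k. k \<in> s) * (\<integral>x. walsh F (b x) \<partial>M))"
      unfolding walsh_sum_def using integrable_b by (subst Bochner_Integration.integral_sum) auto
    also have "\<dots> = (\<Sum>F\<in>Pow {..<n}. if F = {} then 1 else 0)"
      by (intro sum.cong refl) (auto simp: integral_walsh finite_subset)
    also have "\<dots> = complex_of_real 1"
      by simp
    finally have "2 ^ n * measure M (cyl s) = 1"
      by (simp only: of_real_eq_iff)
    then have "measure M (cyl s) = (1 / 2) ^ n"
      by (simp add: field_simps power_divide)
    with n show ?thesis
      by simp
  qed
  have "(\<integral>x. h x \<partial>M) \<le> 2 ^ n * \<epsilon>"
    if h [measurable]: "h \<in> borel_measurable M" and K: "\<forall>x. \<bar>h x\<bar> \<le> K"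
      and le: "\<forall>A\<in>sets M. measure M A \<le> \<delta> \<longrightarrow> (\<integral>x. h x * indicator A x \<partial>M) \<le> \<epsilon>" for h :: "'a \<Rightarrow> real" and K
  proof -
    have int: "integrable M (\<lambda>x. h x * indicator (cyl s) x)" for s
      using order_trans[OF abs_ge_zero K[rule_format]]
      by (intro integrable_const_bound[where B=K]) (auto simp: indicator_def K)
    have "(\<Sum>s\<in>Pow {..<n}. h x * indicator (cyl s) x) = h x" if x: "x \<in> space M" for x
    proof -
      have "(\<Sum>s\<in>Pow {..<n}. h x * indicator (cyl s) x) = (\<Sum>s\<in>Pow {..<n}. if s = {k. k < n \<and> b x k} then h x else 0)"
        using x by (intro sum.cong refl) (auto simp: cyl_def indicator_def)
      also have "\<dots> = h x"
        by (subst sum.delta) auto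
      finally show ?thesis .
    qed
    then have "(\<integral>x. h x \<partial>M) = (\<integral>x. (\<Sum>s\<in>Pow {..<n}. h x * indicator (cyl s) x) \<partial>M)"
      by (intro Bochner_Integration.integral_cong refl) simp
    also have "\<dots> = (\<Sum>s\<in>Pow {..<n}. \<integral>x. h x * indicator (cyl s) x \<partial>M)"
      by (rule Bochner_Integration.integral_sum[OF int])
    also have "\<dots> \<le> (\<Sum>s\<in>Pow {..<n}. \<epsilon>)"
      using le m_cyl by (intro sum_mono) auto
    finally show ?thesis
      by (simp add: card_Pow)
  qed
  then show ?thesis
    using assms by (intro exI[of _ "2 ^ n * \<epsilon>"]) auto
qed

lemma coin_op_walsh_sum:
  assumes "\<forall>k. \<bar>a k\<bar> \<le> 1"
  shows "blinfun_apply (coin_op a) (walsh_sum_l1 n c)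
    = walsh_sum_l1 n (\<lambda>F. (\<Prod>k\<in>F. complex_of_real (a k)) * c F)"
proof -
  have "blinfun_apply (coin_op a) (walsh_sum_l1 n c)
      = (\<Sum>F\<in>Pow {..<n}. c F *\<^sub>C blinfun_apply (coin_op a) (walsh_l1 F))"
    unfolding walsh_sum_l1_def by (rule complex_linear_sum[OF complex_linear_coin_op[OF assms]])
  also have "\<dots> = walsh_sum_l1 n (\<lambda>F. (\<Prod>k\<in>F. complex_of_real (a k)) * c F)"
    unfolding walsh_sum_l1_def
    by (intro sum.cong refl) (auto simp: coin_op_walsh assms finite_subset scaleC_scaleC mult.commute)
  finally show ?thesis .
qed

lemma walsh_sum_l1_diff: "walsh_sum_l1 n c - walsh_sum_l1 n d = walsh_sum_l1 n (\<lambda>F. c F - d F)"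
  unfolding walsh_sum_l1_eq by (subst abs_l1_diff) (simp_all add: integrable_b walsh_sum_def sum_subtractf left_diff_distrib)

text \<open>Compactness on L^2 in quantitative form. The two multipliers differ only on sets F with
  an element k \<ge> N, where the product is at most \<open>a k \<le> a N\<close>; the sup bound K
  enters through Parseval.\<close>

lemma coin_op_tail_small:
  assumes a: "\<forall>k. 0 \<le> a k \<and> a k \<le> 1" "decseq a"
    and bound: "\<And>\<omega>. norm (walsh_sum n c \<omega>) \<le> K"
  shows "norm (blinfun_apply (coin_op a) (walsh_sum_l1 n c)
    - blinfun_apply (coin_op (\<lambda>k. if k < N then a k else 0)) (walsh_sum_l1 n c)) \<le> a N * K"
proof -
  define a' where "a' = (\<lambda>k. if k < N then a k else 0)"
  have K: "0 \<le> K"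
    using order_trans[OF norm_ge_zero bound] .
  have abs: "\<forall>k. \<bar>a k\<bar> \<le> 1" "\<forall>k. \<bar>a' k\<bar> \<le> 1"
    using a by (auto simp: a'_def)
  define d where "d F = (\<Prod>k\<in>F. complex_of_real (a k)) * c F - (\<Prod>k\<in>F. complex_of_real (a' k)) * c F" for F
  have d: "norm (d F) \<le> a N * norm (c F)" if F: "F \<in> Pow {..<n}" for F
  proof (cases "F \<subseteq> {..<N}")
    case True
    then have "(\<Prod>k\<in>F. complex_of_real (a' k)) = (\<Prod>k\<in>F. complex_of_real (a k))"
      by (intro prod.cong) (auto simp: a'_def)
    then show ?thesis
      using a by (simp add: d_def)
  next
    case False
    then obtain k where k: "k \<in> F" "N \<le> k"
      by (auto simp: subset_iff not_less)
    have fin: "finite F"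
      using F by (auto intro: finite_subset)
    have "(\<Prod>k\<in>F. complex_of_real (a' k)) = 0"
      using k fin by (auto simp: a'_def intro!: bexI[of _ k])
    then have "norm (d F) = (\<Prod>k\<in>F. a k) * norm (c F)"
      using a by (simp add: d_def norm_mult prod_norm[symmetric])
    also have "(\<Prod>k\<in>F. a k) = a k * (\<Prod>k\<in>F - {k}. a k)"
      using fin k(1) by (rule prod.remove)
    also have "\<dots> \<le> a N * 1"
      using a decseqD[OF a(2) k(2)] by (intro mult_mono prod_le_1 prod_nonneg) auto
    finally show ?thesis
      by (simp add: mult_right_mono)
  qed
  have "blinfun_apply (coin_op a) (walsh_sum_l1 n c) - blinfun_apply (coin_op a') (walsh_sum_l1 n c) = walsh_sum_l1 n d"
    by (simp add: coin_op_walsh_sum abs walsh_sum_l1_diff d_def[abs_def])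
  moreover have "(norm (walsh_sum_l1 n d))\<^sup>2 \<le> (a N * K)\<^sup>2"
  proof -
    have "(norm (walsh_sum_l1 n d))\<^sup>2 \<le> (\<Sum>F\<in>Pow {..<n}. (norm (d F))\<^sup>2)"
      by (rule norm_walsh_sum_l1_le)
    also have "\<dots> \<le> (\<Sum>F\<in>Pow {..<n}. (a N * norm (c F))\<^sup>2)"
      using d by (intro sum_mono power_mono) auto
    also have "\<dots> = (a N)\<^sup>2 * (\<integral>x. (norm (walsh_sum n c (b x)))\<^sup>2 \<partial>M)"
      by (simp add: walsh_parseval power_mult_distrib sum_distrib_left)
    also have "\<dots> \<le> (a N)\<^sup>2 * (\<integral>x. K\<^sup>2 \<partial>M)"
      by (intro mult_left_mono integral_mono integrable_const_bound[where B="K\<^sup>2"])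
        (auto intro!: power_mono bound)
    finally show ?thesis
      by (simp add: prob_space power_mult_distrib)
  qed
  ultimately show ?thesis
    using a K by (simp add: a'_def abs_le_square_iff[symmetric])
qed

text \<open>With the digits from N on averaged out the operator has finite rank: only subsets of
  \<open>{..<N}\<close> contribute, and each of their coefficients is a functional applied to a
  weakly null sequence.\<close>

lemma coin_op_truncated_null:
  assumes a: "\<forall>k. \<bar>a k\<bar> \<le> 1" and null: "weakly_null (\<lambda>i. walsh_sum_l1 (m i) (c i))"
  shows "(\<lambda>i. norm (blinfun_apply (coin_op (\<lambda>k. if k < N then a k else 0)) (walsh_sum_l1 (m i) (c i)))) \<longlonglongrightarrow> 0"
proof -
  define a' where "a' = (\<lambda>k. if k < N then a k else 0)"
  have a': "\<forall>k. \<bar>a' k\<bar> \<le> 1"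
    using a by (auto simp: a'_def)
  define p where "p F = (\<Prod>k\<in>F. complex_of_real (a' k))" for F
  have p1: "norm (p F) \<le> 1" for F
    unfolding p_def prod_norm[symmetric] using a' by (intro prod_le_1) auto
  have p0: "p F = 0" if F: "finite F" "\<not> F \<subseteq> {..<N}" for F
  proof -
    obtain k where "k \<in> F" "N \<le> k"
      using F(2) by (auto simp: subset_iff not_less)
    then show ?thesis
      using F(1) by (auto simp: p_def a'_def intro!: bexI[of _ k])
  qed
  let ?x = "\<lambda>i. walsh_sum_l1 (m i) (c i)"
  have le: "norm (blinfun_apply (coin_op a') (?x i)) \<le> (\<Sum>F\<in>Pow {..<N}. norm (blinfun_apply (walsh_coeff F) (?x i)))" for i
  proof -
    have "norm (blinfun_apply (coin_op a') (?x i)) = norm (\<Sum>F\<in>Pow {..<m i}. (p F * c i F) *\<^sub>C walsh_l1 F)"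
      unfolding coin_op_walsh_sum[OF a'] by (simp add: p_def walsh_sum_l1_def)
    also have "\<dots> \<le> (\<Sum>F\<in>Pow {..<m i}. norm (p F) * norm (c i F))"
      by (rule sum_norm_le) (simp add: norm_scaleC norm_mult)
    also have "\<dots> = (\<Sum>F\<in>Pow {..<m i} \<inter> Pow {..<N}. norm (p F) * norm (c i F))"
    proof (intro sum.mono_neutral_right ballI)
      fix F assume F: "F \<in> Pow {..<m i} - Pow {..<m i} \<inter> Pow {..<N}"
      then have "finite F" "\<not> F \<subseteq> {..<N}"
        by (auto intro: finite_subset)
      then show "norm (p F) * norm (c i F) = 0"
        by (simp add: p0)
    qed auto
    also have "\<dots> \<le> (\<Sum>F\<in>Pow {..<m i} \<inter> Pow {..<N}. norm (blinfun_apply (walsh_coeff F) (?x i)))"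
      using mult_right_mono[OF p1 norm_ge_zero] by (intro sum_mono) (simp add: walsh_coeff_walsh_sum)
    also have "\<dots> \<le> (\<Sum>F\<in>Pow {..<N}. norm (blinfun_apply (walsh_coeff F) (?x i)))"
      by (intro sum_mono2) auto
    finally show ?thesis .
  qed
  have lim: "(\<lambda>i. \<Sum>F\<in>Pow {..<N}. norm (blinfun_apply (walsh_coeff F) (?x i))) \<longlonglongrightarrow> 0"
    by (intro tendsto_null_sum tendsto_norm_zero weakly_nullD[OF null] complex_linear_walsh_coeff)
  show ?thesis
    unfolding a'_def[symmetric] by (rule Lim_null_comparison[OF always_eventually lim]) (simp add: le)
qed

text \<open>Each function is cut off at a height K. The part above K is small in L^1 by uniform
  integrability, the bounded part is controlled by the L^2 estimate, and the remainder is of finite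
  rank.\<close>

lemma coin_op_walsh_sum_null:
  assumes a: "\<forall>k. 0 \<le> a k \<and> a k \<le> 1" "decseq a" "a \<longlonglongrightarrow> 0"
    and null: "weakly_null (\<lambda>i. walsh_sum_l1 (m i) (c i))"
  shows "(\<lambda>i. norm (blinfun_apply (coin_op a) (walsh_sum_l1 (m i) (c i)))) \<longlonglongrightarrow> 0"
proof -
  have abs: "\<forall>k. \<bar>a k\<bar> \<le> 1"
    using a by auto
  define X where "X i x = walsh_sum (m i) (c i) (b x)" for i x
  have X [measurable]: "X i \<in> borel_measurable M" for i
    unfolding X_def by (intro measurable_compose_b) simp
  have X_bounded: "\<exists>K. \<forall>x. norm (X i x) \<le> K" for i
    unfolding X_def using norm_walsh_sum_le by blast
  have X_weak: "(\<lambda>i. \<integral>x. X i x * g x \<partial>M) \<longlonglongrightarrow> 0" if g: "g \<in> borel_measurable M" "\<forall>x. norm (g x) \<le> 1" for g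
  proof -
    obtain \<phi> :: "'a l1 \<Rightarrow>\<^sub>L complex" where \<phi>: "complex_linear \<phi>"
      "\<And>f. integrable M f \<Longrightarrow> blinfun_apply \<phi> (abs_l1 f) = (\<integral>x. f x * g x \<partial>M)"
      using l1_functional_exists[OF g(1), of 1] g(2) by blast
    from weakly_nullD[OF null this(1)] show ?thesis
      by (simp add: walsh_sum_l1_eq \<phi>(2) integrable_b X_def)
  qed
  have small: "eventually (\<lambda>i. norm (blinfun_apply (coin_op a) (walsh_sum_l1 (m i) (c i))) < 5 * \<epsilon>) sequentially"
    if \<epsilon>: "\<epsilon> > 0" for \<epsilon>
  proof -
    obtain \<delta> n0 where \<delta>: "\<delta> > 0" and ui: "\<And>n A. n \<ge> n0 \<Longrightarrow> A \<in> sets M \<Longrightarrow> measure M A \<le> \<delta> \<Longrightarrow>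
        (\<integral>x. norm (X n x) * indicator A x \<partial>M) \<le> \<epsilon>"
      using weakly_null_uniformly_integrable[OF finite_measure_axioms X X_bounded X_weak \<epsilon>] by blast
    obtain B where B: "B > 0" "\<And>n. n \<ge> n0 \<Longrightarrow> (\<integral>x. norm (X n x) \<partial>M) \<le> B"
    proof -
      obtain B where "B > 0" and *: "\<And>h. h \<in> borel_measurable M \<Longrightarrow> (\<exists>K. \<forall>x. \<bar>h x\<bar> \<le> K) \<Longrightarrow>
          (\<forall>A\<in>sets M. measure M A \<le> \<delta> \<longrightarrow> (\<integral>x. h x * indicator A x \<partial>M) \<le> \<epsilon>) \<Longrightarrow> (\<integral>x. h x \<partial>M) \<le> B"
        using integral_cylinder_le[OF \<delta> \<epsilon>] by blast
      have "(\<integral>x. norm (X n x) \<partial>M) \<le> B" if "n \<ge> n0" for n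
        using X_bounded[of n] ui[OF that] by (intro *) auto
      with \<open>B > 0\<close> that show ?thesis
        by blast
    qed
    \<comment> \<open>By Markov's inequality the set where \<open>X i\<close> exceeds K has measure
      at most \<open>B / K = \<delta>\<close>, as uniform integrability asks. Both K and N are fixed
      before \<open>i\<close>.\<close>
    define K where "K = B / \<delta>"
    have K: "K > 0"
      using B \<delta> by (simp add: K_def)
    have "eventually (\<lambda>N. a N < \<epsilon> / K) sequentially"
      using a(3) \<epsilon> K by (intro order_tendstoD(2)[where y=0]) auto
    then obtain N where N: "a N * K < \<epsilon>"
      using K by (auto simp: eventually_sequentially field_simps)
    define a' where "a' = (\<lambda>k. if k < N then a k else 0)"
    have abs': "\<forall>k. \<bar>a' k\<bar> \<le> 1"
      using abs by (auto simp: a'_def)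
    have "eventually (\<lambda>i. norm (blinfun_apply (coin_op a') (walsh_sum_l1 (m i) (c i))) < \<epsilon>) sequentially"
      unfolding a'_def using coin_op_truncated_null[OF abs null] \<epsilon> by (rule order_tendstoD(2))
    moreover have "eventually (\<lambda>i. i \<ge> n0) sequentially"
      by (rule eventually_ge_at_top)
    ultimately show ?thesis
    proof eventually_elim
      case (elim i)
      define n where "n = m i"
      \<comment> \<open>The cut-off function still depends on the first \<open>n\<close> digits
        only, so it is again a Walsh sum.\<close>
      define u where "u \<omega> = (if norm (walsh_sum n (c i) \<omega>) \<le> K then walsh_sum n (c i) \<omega> else 0)" for \<omega>
      have "depends_below n u"
        using depends_belowD[OF depends_below_walsh_sum[of n "c i"]]
        unfolding u_def depends_below_def by metis
      then obtain d where d: "u = walsh_sum n d"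
        using walsh_expansion by blast
      define A where "A = {x \<in> space M. K < norm (X i x)}"
      have A [measurable]: "A \<in> sets M"
        unfolding A_def by measurable
      have intX: "integrable M (\<lambda>x. norm (X i x))"
        unfolding X_def by (intro integrable_norm integrable_b)
      have "measure M A \<le> measure M {x \<in> space M. norm (X i x) \<ge> K}"
        by (intro finite_measure_mono) (auto simp: A_def)
      also have "\<dots> \<le> (\<integral>x. norm (X i x) \<partial>M) / K"
        by (rule integral_Markov_inequality_measure[OF intX, of "{}"]) (use K in auto)
      also have "\<dots> \<le> \<delta>"
        using B(2)[OF elim(2)] K \<delta> B(1) by (simp add: K_def field_simps)
      finally have mA: "measure M A \<le> \<delta>" .
      define x where "x = walsh_sum_l1 n (c i)"
      define y where "y = walsh_sum_l1 n d"
      have "norm (x - y) = (\<integral>x. norm (X i x) * indicator A x \<partial>M)"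
        unfolding x_def y_def walsh_sum_l1_diff norm_walsh_sum_l1
      proof (intro Bochner_Integration.integral_cong refl)
        fix x assume "x \<in> space M"
        have "walsh_sum n (\<lambda>F. c i F - d F) (b x) = walsh_sum n (c i) (b x) - u (b x)"
          unfolding d by (simp add: walsh_sum_def left_diff_distrib sum_subtractf)
        then show "norm (walsh_sum n (\<lambda>F. c i F - d F) (b x)) = norm (X i x) * indicator A x"
          using \<open>x \<in> space M\<close> by (auto simp: u_def A_def X_def n_def)
      qed
      also have "\<dots> \<le> \<epsilon>"
        by (rule ui[OF elim(2) A mA])
      finally have xy: "norm (x - y) \<le> \<epsilon>" .
      have y_bound: "norm (walsh_sum n d \<omega>) \<le> K" for \<omega>
        using K by (simp add: d[symmetric] u_def)
      \<comment> \<open>The truncated operator is left acting on \<open>x\<close> rather than on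
        \<open>y\<close>, since weak nullity is known for the original sequence.\<close>
      have "blinfun_apply (coin_op a) x = blinfun_apply (coin_op a) (x - y) - blinfun_apply (coin_op a') (x - y)
          + (blinfun_apply (coin_op a) y - blinfun_apply (coin_op a') y) + blinfun_apply (coin_op a') x"
        by (simp add: blinfun.diff_right)
      then have "norm (blinfun_apply (coin_op a) x) \<le> norm (blinfun_apply (coin_op a) (x - y)) + norm (blinfun_apply (coin_op a') (x - y))
          + norm (blinfun_apply (coin_op a) y - blinfun_apply (coin_op a') y) + norm (blinfun_apply (coin_op a') x)"
        by (rule ssubst[where P="\<lambda>z. norm z \<le> _"]) (intro order_trans[OF norm_triangle_ineq] add_mono norm_triangle_ineq4 order_refl)
      moreover have "norm (blinfun_apply (coin_op a) (x - y)) \<le> \<epsilon>"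
        using norm_coin_op_apply_le[OF abs, of "x - y"] xy by linarith
      moreover have "norm (blinfun_apply (coin_op a') (x - y)) \<le> \<epsilon>"
        using norm_coin_op_apply_le[OF abs', of "x - y"] xy by linarith
      moreover have "norm (blinfun_apply (coin_op a) y - blinfun_apply (coin_op a') y) \<le> a N * K"
        unfolding a'_def y_def by (rule coin_op_tail_small[OF a(1,2) y_bound])
      ultimately show ?case
        using N elim(1) \<epsilon> unfolding x_def n_def by linarith
    qed
  qed
  have "eventually (\<lambda>i. dist (norm (blinfun_apply (coin_op a) (walsh_sum_l1 (m i) (c i)))) 0 < \<epsilon>) sequentially"
    if "\<epsilon> > 0" for \<epsilon>
    using that small[of "\<epsilon> / 5"] by (simp add: dist_real_def)
  then show ?thesis
    by (rule tendstoI)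
qed

text \<open>Walsh sums suffice: replacing \<open>x i\<close> by one at distance less than
  \<open>1 / Suc i\<close> keeps the sequence weakly null and moves the images by a null
  sequence.\<close>

lemma coin_op_dunford_pettis:
  assumes a: "\<forall>k. 0 \<le> a k \<and> a k \<le> 1" "decseq a" "a \<longlonglongrightarrow> 0"
  shows "coin_op a \<in> dunford_pettis"
  unfolding dunford_pettis_def
proof (intro CollectI conjI allI impI)
  have abs: "\<forall>k. \<bar>a k\<bar> \<le> 1"
    using a by auto
  show "complex_linear (coin_op a)"
    by (rule complex_linear_coin_op[OF abs])
  fix x :: "nat \<Rightarrow> 'a l1" assume x: "weakly_null x"
  have "\<forall>i. \<exists>n c. norm (x i - walsh_sum_l1 n c) < 1 / Suc i"
    by (intro allI walsh_dense) simp
  then obtain m c where mc: "\<And>i. norm (x i - walsh_sum_l1 (m i) (c i)) < 1 / Suc i"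
    by metis
  define y where "y i = walsh_sum_l1 (m i) (c i)" for i
  have close: "(\<lambda>i. norm (x i - y i)) \<longlonglongrightarrow> 0"
  proof (rule Lim_null_comparison)
    show "(\<lambda>i. 1 / real (Suc i)) \<longlonglongrightarrow> 0"
      using LIMSEQ_inverse_real_of_nat by (simp add: inverse_eq_divide)
    show "eventually (\<lambda>i. norm (norm (x i - y i)) \<le> 1 / real (Suc i)) sequentially"
      using mc by (intro always_eventually) (auto simp: y_def intro: less_imp_le)
  qed
  have "(\<lambda>i. norm (blinfun_apply (coin_op a) (y i))) \<longlonglongrightarrow> 0"
    unfolding y_def using weakly_null_close[OF x close] by (intro coin_op_walsh_sum_null a) (simp add: y_def)
  from tendsto_add[OF close this]
  have lim: "(\<lambda>i. norm (x i - y i) + norm (blinfun_apply (coin_op a) (y i))) \<longlonglongrightarrow> 0"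
    by simp
  show "(\<lambda>n. norm (blinfun_apply (coin_op a) (x n))) \<longlonglongrightarrow> 0"
  proof (rule Lim_null_comparison[OF always_eventually lim], rule allI)
    fix i
    have "blinfun_apply (coin_op a) (x i) = blinfun_apply (coin_op a) (x i - y i) + blinfun_apply (coin_op a) (y i)"
      by (simp add: blinfun.diff_right)
    also have "norm \<dots> \<le> norm (x i - y i) + norm (blinfun_apply (coin_op a) (y i))"
      by (intro order_trans[OF norm_triangle_ineq] add_mono norm_coin_op_apply_le[OF abs] order_refl)
    finally show "norm (norm (blinfun_apply (coin_op a) (x i))) \<le> norm (x i - y i) + norm (blinfun_apply (coin_op a) (y i))"
      by simp
  qed
qed

end

section \<open>The lower bound\<close>

text \<open>The variance of \<open>\<bar>X\<bar>\<close> is nonnegative.\<close>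

lemma (in prob_space) expectation_abs_le_sqrt:
  assumes "integrable M X" "integrable M (\<lambda>x. (X x)\<^sup>2)" "expectation (\<lambda>x. (X x)\<^sup>2) \<le> C"
  shows "expectation (\<lambda>x. \<bar>X x\<bar>) \<le> sqrt C"
proof (rule real_le_rsqrt)
  have "0 \<le> variance (\<lambda>x. \<bar>X x\<bar>)"
    by (rule variance_positive)
  also have "\<dots> = expectation (\<lambda>x. (X x)\<^sup>2) - (expectation (\<lambda>x. \<bar>X x\<bar>))\<^sup>2"
    using assms by (subst variance_eq) auto
  finally show "(expectation (\<lambda>x. \<bar>X x\<bar>))\<^sup>2 \<le> C"
    using assms(3) by simp
qed

section \<open>Sums of biased signs\<close>

definition rademacher :: "nat \<Rightarrow> (nat \<Rightarrow> bool) \<Rightarrow> real" where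
  "rademacher k \<omega> = (if \<omega> k then -1 else 1)"

lemma of_real_rademacher: "complex_of_real (rademacher k \<omega>) = walsh {k} \<omega>"
  by (simp add: rademacher_def walsh_def)

lemma abs_rademacher [simp]: "\<bar>rademacher k \<omega>\<bar> = 1"
  by (simp add: rademacher_def)

lemma rademacher_bxor: "rademacher k (bxor \<omega> \<omega>') = rademacher k \<omega> * rademacher k \<omega>'"
  by (simp add: rademacher_def bxor_def)

lemma measurable_rademacher [measurable]: "rademacher k \<in> borel_measurable bits"
  unfolding rademacher_def by measurable

lemma integrable_rademacher:
  "integrable (biased_coins a) (rademacher k)"
  "integrable (biased_coins a) (\<lambda>\<omega>. rademacher j \<omega> * rademacher k \<omega>)"
proof -
  interpret prob_space "biased_coins a"
    by (rule prob_space_biased_coins)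
  show "integrable (biased_coins a) (rademacher k)"
    "integrable (biased_coins a) (\<lambda>\<omega>. rademacher j \<omega> * rademacher k \<omega>)"
    by (rule integrable_const_bound[where B=1]; simp add: abs_mult)+
qed

lemma integral_rademacher:
  assumes a: "\<forall>k. \<bar>a k\<bar> \<le> 1"
  shows "(\<integral>\<omega>. rademacher k \<omega> \<partial>biased_coins a) = a k"
    and "(\<integral>\<omega>. rademacher j \<omega> * rademacher k \<omega> \<partial>biased_coins a) = (if j = k then 1 else a j * a k)"
proof -
  have "complex_of_real (\<integral>\<omega>. rademacher k \<omega> \<partial>biased_coins a) = (\<integral>\<omega>. walsh {k} \<omega> \<partial>biased_coins a)"
    by (simp only: integral_complex_of_real[symmetric] of_real_rademacher)
  also have "\<dots> = complex_of_real (a k)"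
    using a by (subst integral_walsh_biased_coins) auto
  finally show "(\<integral>\<omega>. rademacher k \<omega> \<partial>biased_coins a) = a k"
    by (simp only: of_real_eq_iff)
  have "complex_of_real (\<integral>\<omega>. rademacher j \<omega> * rademacher k \<omega> \<partial>biased_coins a)
      = (\<integral>\<omega>. walsh (sym_diff {j} {k}) \<omega> \<partial>biased_coins a)"
    by (simp only: integral_complex_of_real[symmetric] of_real_rademacher of_real_mult walsh_mult finite.intros)
  also have "\<dots> = (\<Prod>i\<in>sym_diff {j} {k}. complex_of_real (a i))"
    using a by (intro integral_walsh_biased_coins) auto
  also have "\<dots> = complex_of_real (if j = k then 1 else a j * a k)"
    by (auto simp: insert_Diff_if)
  finally show "(\<integral>\<omega>. rademacher j \<omega> * rademacher k \<omega> \<partial>biased_coins a) = (if j = k then 1 else a j * a k)"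
    by (simp only: of_real_eq_iff)
qed

text \<open>The signs are pairwise uncorrelated with variances \<open>1 - (a k)\<^sup>2\<close>, at
  most 1, so the cross terms of the second moment vanish.\<close>

lemma rademacher_sum_deviation:
  assumes a: "\<forall>k. \<bar>a k\<bar> \<le> 1" and J: "finite J"
  shows "(\<integral>\<omega>. \<bar>\<Sum>k\<in>J. u k * (rademacher k \<omega> - a k)\<bar> \<partial>biased_coins a) \<le> sqrt (\<Sum>k\<in>J. (u k)\<^sup>2)"
proof -
  interpret prob_space "biased_coins a"
    by (rule prob_space_biased_coins)
  have int: "integrable (biased_coins a) (\<lambda>\<omega>. (rademacher j \<omega> - a j) * (rademacher k \<omega> - a k))" for j k
    using integrable_rademacher by (simp add: algebra_simps)
  have val: "(\<integral>\<omega>. (rademacher j \<omega> - a j) * (rademacher k \<omega> - a k) \<partial>biased_coins a) = (if j = k then 1 - (a k)\<^sup>2 else 0)" for j k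
  proof -
    have "(\<integral>\<omega>. (rademacher j \<omega> - a j) * (rademacher k \<omega> - a k) \<partial>biased_coins a)
        = (\<integral>\<omega>. rademacher j \<omega> * rademacher k \<omega> - a k * rademacher j \<omega> - a j * rademacher k \<omega> + a j * a k \<partial>biased_coins a)"
      by (intro Bochner_Integration.integral_cong refl) (simp add: algebra_simps)
    then show ?thesis
      using integrable_rademacher by (simp add: integral_rademacher[OF a] power2_eq_square prob_space)
  qed
  have sq: "(\<Sum>k\<in>J. u k * (rademacher k \<omega> - a k))\<^sup>2
      = (\<Sum>j\<in>J. \<Sum>k\<in>J. u j * u k * ((rademacher j \<omega> - a j) * (rademacher k \<omega> - a k)))" for \<omega>
    by (simp add: power2_eq_square sum_product mult_ac)
  have "expectation (\<lambda>\<omega>. (\<Sum>k\<in>J. u k * (rademacher k \<omega> - a k))\<^sup>2) = (\<Sum>j\<in>J. \<Sum>k\<in>J. u j * u k * (if j = k then 1 - (a k)\<^sup>2 else 0))"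
    unfolding sq using int by (simp add: Bochner_Integration.integral_sum val)
  also have "\<dots> = (\<Sum>k\<in>J. (u k)\<^sup>2 * (1 - (a k)\<^sup>2))"
    using J by (simp add: if_distrib[of "(*) _"] power2_eq_square cong: if_cong)
  also have "\<dots> \<le> (\<Sum>k\<in>J. (u k)\<^sup>2)"
    by (intro sum_mono mult_left_le) auto
  finally have "expectation (\<lambda>\<omega>. (\<Sum>k\<in>J. u k * (rademacher k \<omega> - a k))\<^sup>2) \<le> (\<Sum>k\<in>J. (u k)\<^sup>2)" .
  then show ?thesis
  proof (rule expectation_abs_le_sqrt[rotated 2])
    show "integrable (biased_coins a) (\<lambda>\<omega>. \<Sum>k\<in>J. u k * (rademacher k \<omega> - a k))"
      using integrable_rademacher by simp
    show "integrable (biased_coins a) (\<lambda>\<omega>. (\<Sum>k\<in>J. u k * (rademacher k \<omega> - a k))\<^sup>2)"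
      unfolding sq using int by simp
  qed
qed

section \<open>Averages of operators over the coin group\<close>

context coin_coding
begin

text \<open>A functional on L^1 restricts to L^2 with no larger norm. The proof tests it on the
  Walsh sum with the conjugate coefficients.\<close>

lemma bessel:
  fixes \<phi> :: "'a l1 \<Rightarrow>\<^sub>L complex"
  assumes "complex_linear \<phi>"
  shows "(\<Sum>F\<in>Pow {..<n}. (norm (blinfun_apply \<phi> (walsh_l1 F)))\<^sup>2) \<le> (norm \<phi>)\<^sup>2"
proof -
  define S where "S = (\<Sum>F\<in>Pow {..<n}. (norm (blinfun_apply \<phi> (walsh_l1 F)))\<^sup>2)"
  define c where "c F = cnj (blinfun_apply \<phi> (walsh_l1 F))" for F
  have S: "0 \<le> S"
    by (simp add: S_def sum_nonneg)
  have "complex_of_real S = blinfun_apply \<phi> (walsh_sum_l1 n c)"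
    unfolding walsh_sum_l1_def complex_linear_sum[OF assms]
    by (simp add: S_def c_def scaleC_complex_def complex_norm_square mult.commute del: of_real_power)
  then have "S = norm (blinfun_apply \<phi> (walsh_sum_l1 n c))"
    using S by (metis norm_of_real abs_of_nonneg)
  also have "\<dots> \<le> norm \<phi> * norm (walsh_sum_l1 n c)"
    by (rule norm_blinfun)
  finally have "S\<^sup>2 \<le> (norm \<phi> * norm (walsh_sum_l1 n c))\<^sup>2"
    using S by (rule power_mono)
  also have "\<dots> \<le> (norm \<phi>)\<^sup>2 * S"
    using norm_walsh_sum_l1_le[of n c] by (simp add: power_mult_distrib S_def c_def mult_left_mono)
  finally have "S * S \<le> (norm \<phi>)\<^sup>2 * S"
    by (simp add: power2_eq_square)
  then show ?thesis
    using S unfolding S_def[symmetric] by (cases "S = 0") (auto simp: mult_le_cancel_right)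
qed

text \<open>By Bessel's inequality the values of a functional on the Rademacher functions are square
  summable, so they tend to 0.\<close>

lemma weakly_null_walsh_singleton: "weakly_null (\<lambda>k. walsh_l1 {k})"
  unfolding weakly_null_def
proof (intro allI impI)
  fix \<phi> :: "'a l1 \<Rightarrow>\<^sub>L complex" assume \<phi>: "complex_linear \<phi>"
  let ?s = "\<lambda>k. (norm (blinfun_apply \<phi> (walsh_l1 {k})))\<^sup>2"
  have le: "(\<Sum>k<n. ?s k) \<le> (norm \<phi>)\<^sup>2" for n
  proof -
    have "(\<Sum>k<n. ?s k) = (\<Sum>F\<in>(\<lambda>k. {k}) ` {..<n}. (norm (blinfun_apply \<phi> (walsh_l1 F)))\<^sup>2)"
      by (simp add: sum.reindex)
    also have "\<dots> \<le> (\<Sum>F\<in>Pow {..<n}. (norm (blinfun_apply \<phi> (walsh_l1 F)))\<^sup>2)"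
      by (intro sum_mono2) auto
    also have "\<dots> \<le> (norm \<phi>)\<^sup>2"
      by (rule bessel[OF \<phi>])
    finally show ?thesis .
  qed
  have "summable ?s"
    using le[of "Suc n" for n] unfolding lessThan_Suc_atMost by (intro bounded_imp_summable) auto
  then have "(\<lambda>k. sqrt (?s k)) \<longlonglongrightarrow> sqrt 0"
    by (intro tendsto_real_sqrt summable_LIMSEQ_zero)
  then show "(\<lambda>k. blinfun_apply \<phi> (walsh_l1 {k})) \<longlonglongrightarrow> 0"
    by (simp add: tendsto_norm_zero_iff)
qed

text \<open>The Walsh coefficients of the convolution that results from averaging V over all
  translations.\<close>

definition diagonal :: "('a l1 \<Rightarrow>\<^sub>L 'a l1) \<Rightarrow> nat set \<Rightarrow> complex" where
  "diagonal V F = blinfun_apply (walsh_coeff F) (blinfun_apply V (walsh_l1 F))"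

text \<open>The sum is the integral of a representative of \<open>z\<close> against the translate of
  \<open>walsh_sum n c\<close> by \<omega>, and translation preserves the sup bound.\<close>

lemma norm_translate_pairing_le:
  assumes C: "\<And>\<omega>. norm (walsh_sum n c \<omega>) \<le> C"
  shows "norm (\<Sum>G\<in>Pow {..<n}. c G * walsh G \<omega> * blinfun_apply (walsh_coeff G) z) \<le> C * norm z"
proof -
  obtain g where g: "integrable M g" "z = abs_l1 g"
    using that[of "rep_l1 z"] by simp
  have int: "integrable M (\<lambda>x. g x * walsh G (b x))" for G
    by (rule integrable_mult_bounded[OF g(1), where C=1]) auto
  have int2: "integrable M (\<lambda>x. g x * walsh_sum n c (bxor \<omega> (b x)))"
    by (rule integrable_mult_bounded[OF g(1) _ C]) simp
  have "(\<Sum>G\<in>Pow {..<n}. c G * walsh G \<omega> * blinfun_apply (walsh_coeff G) z)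
      = (\<Sum>G\<in>Pow {..<n}. \<integral>x. c G * walsh G \<omega> * (g x * walsh G (b x)) \<partial>M)"
    by (simp add: g walsh_coeff_abs_l1)
  also have "\<dots> = (\<integral>x. (\<Sum>G\<in>Pow {..<n}. c G * walsh G \<omega> * (g x * walsh G (b x))) \<partial>M)"
    using int by (subst Bochner_Integration.integral_sum) auto
  also have "\<dots> = (\<integral>x. g x * walsh_sum n c (bxor \<omega> (b x)) \<partial>M)"
    by (simp add: walsh_sum_def walsh_bxor sum_distrib_left mult_ac)
  also have "norm \<dots> \<le> (\<integral>x. norm (g x * walsh_sum n c (bxor \<omega> (b x))) \<partial>M)"
    by (rule integral_norm_bound)
  also have "\<dots> \<le> (\<integral>x. C * norm (g x) \<partial>M)"
    using g C by (intro integral_mono integrable_norm int2) (auto simp: norm_mult mult.commute[of C] intro!: mult_left_mono)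
  also have "\<dots> = C * norm z"
    using g by (simp add: norm_abs_l1)
  finally show ?thesis .
qed

text \<open>The kernel is nonnegative with integral 1.\<close>

lemma norm_walsh_kernel_l1: "norm (walsh_sum_l1 n (\<lambda>F. walsh F \<omega>)) = 1"
proof -
  have "complex_of_real (norm (walsh_sum_l1 n (\<lambda>F. walsh F \<omega>)))
      = (\<integral>x. complex_of_real (norm (walsh_sum n (\<lambda>F. walsh F \<omega>) (b x))) \<partial>M)"
    by (simp add: norm_walsh_sum_l1)
  also have "\<dots> = (\<integral>x. walsh_sum n (\<lambda>F. walsh F \<omega>) (b x) \<partial>M)"
    by (intro Bochner_Integration.integral_cong refl) (simp add: walsh_kernel norm_power)
  also have "\<dots> = (\<Sum>F\<in>Pow {..<n}. walsh F \<omega> * (\<integral>x. walsh F (b x) \<partial>M))"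
    unfolding walsh_sum_def using integrable_b by (subst Bochner_Integration.integral_sum) auto
  also have "\<dots> = (\<Sum>F\<in>Pow {..<n}. if F = {} then 1 else 0)"
    by (intro sum.cong refl) (auto simp: integral_walsh finite_subset)
  also have "\<dots> = complex_of_real 1"
    by simp
  finally show ?thesis
    by (simp only: of_real_eq_iff)
qed

text \<open>The sum on the left is the average over \<open>y\<close> of the pairings of \<open>V f\<^sub>y\<close> with the translate by
  \<open>y\<close> of \<open>walsh_sum n c\<close>, where \<open>f\<^sub>y\<close> is the normalised indicator of a cylinder around \<open>y\<close>: averaging
  over the group replaces \<open>V\<close> by a convolution.\<close>

lemma norm_diagonal_sum_le:
  assumes V: "complex_linear V" and C: "\<And>\<omega>. norm (walsh_sum n c \<omega>) \<le> C"
  shows "norm (\<Sum>F\<in>Pow {..<n}. c F * diagonal V F) \<le> norm V * C"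
proof -
  have C0: "0 \<le> C"
    using order_trans[OF norm_ge_zero C] .
  define v where "v G F = blinfun_apply (walsh_coeff G) (blinfun_apply V (walsh_l1 F))" for G F
  define I where "I y = (\<Sum>G\<in>Pow {..<n}. c G * walsh G (b y)
      * blinfun_apply (walsh_coeff G) (blinfun_apply V (walsh_sum_l1 n (\<lambda>F. walsh F (b y)))))" for y
  have I_eq: "I y = (\<Sum>G\<in>Pow {..<n}. \<Sum>F\<in>Pow {..<n}. c G * v G F * (walsh G (b y) * walsh F (b y)))" for y
    unfolding I_def walsh_sum_l1_def complex_linear_sum[OF V] complex_linear_sum[OF complex_linear_walsh_coeff]
    by (simp add: v_def scaleC_complex_def sum_distrib_left mult_ac)
  have int: "integrable M (\<lambda>y. walsh G (b y) * walsh F (b y))" for F G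
    by (rule integrable_mult_bounded[where C=1]) (auto intro: integrable_b)
  have intI: "integrable M I"
    unfolding I_eq[abs_def] using int by simp
  have I_le: "norm (I y) \<le> norm V * C" for y
  proof -
    have "norm (I y) \<le> C * norm (blinfun_apply V (walsh_sum_l1 n (\<lambda>F. walsh F (b y))))"
      unfolding I_def by (rule norm_translate_pairing_le[OF C])
    also have "\<dots> \<le> C * (norm V * norm (walsh_sum_l1 n (\<lambda>F. walsh F (b y))))"
      by (intro mult_left_mono norm_blinfun C0)
    finally show ?thesis
      by (simp add: norm_walsh_kernel_l1 mult.commute)
  qed
  \<comment> \<open>Orthogonality in \<open>y\<close> kills the terms with
    \<open>F \<noteq> G\<close>: this is how averaging makes the operator diagonal.\<close>
  have "(\<integral>y. I y \<partial>M) = (\<Sum>G\<in>Pow {..<n}. \<Sum>F\<in>Pow {..<n}. c G * v G F * (\<integral>y. walsh G (b y) * walsh F (b y) \<partial>M))"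
    unfolding I_eq using int by (simp add: Bochner_Integration.integral_sum)
  also have "\<dots> = (\<Sum>G\<in>Pow {..<n}. \<Sum>F\<in>Pow {..<n}. if G = F then c G * v G G else 0)"
    by (intro sum.cong refl) (auto simp: integral_walsh_mult finite_subset)
  also have "\<dots> = (\<Sum>F\<in>Pow {..<n}. c F * diagonal V F)"
    by (intro sum.cong refl) (simp add: v_def diagonal_def)
  finally have "norm (\<Sum>F\<in>Pow {..<n}. c F * diagonal V F) = norm (\<integral>y. I y \<partial>M)"
    by simp
  also have "\<dots> \<le> (\<integral>y. norm (I y) \<partial>M)"
    by (rule integral_norm_bound)
  also have "\<dots> \<le> (\<integral>y. norm V * C \<partial>M)"
    using intI I_le by (intro integral_mono) auto
  finally show ?thesis
    by (simp add: prob_space)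
qed

lemma diagonal_singleton_null:
  assumes "T \<in> dunford_pettis"
  shows "(\<lambda>k. diagonal T {k}) \<longlonglongrightarrow> 0"
proof (rule Lim_null_comparison[OF always_eventually])
  show "(\<lambda>k. norm (blinfun_apply T (walsh_l1 {k}))) \<longlonglongrightarrow> 0"
    using assms weakly_null_walsh_singleton by (auto simp: dunford_pettis_def)
  show "\<forall>k. norm (diagonal T {k}) \<le> norm (blinfun_apply T (walsh_l1 {k}))"
    by (simp add: diagonal_def norm_walsh_coeff_apply_le)
qed

text \<open>Operators enter only through their diagonals. V is paired with the truncated sum g; the
  factor \<open>p F\<close> turns the coefficients \<open>c F\<close> of g into those of its average
  under \<mu>, which stays within s of m at every point. The 1 in \<open>1 - diagonal T F\<close>
  yields the value of this average at the group identity, at least 1 - s; the other term contributes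
  at most \<open>norm T * s + e / 2\<close>.\<close>

lemma norm_ge_1_if_diagonal:
  assumes a: "\<forall>k. \<bar>a k\<bar> \<le> 1"
    and diverges: "\<And>N L. \<exists>n. L \<le> (\<Sum>k\<in>{N..<n}. (a k)\<^sup>2)"
    and T: "T \<in> dunford_pettis" and V: "complex_linear V"
    and diag: "\<And>F. finite F \<Longrightarrow> diagonal V F = (\<Prod>k\<in>F. complex_of_real (a k)) * (1 - diagonal T F)"
  shows "1 \<le> norm V"
proof (rule field_le_epsilon)
  fix e :: real assume e: "e > 0"
  define t where "t = 1 + norm T"
  have t: "t > 0"
    unfolding t_def using norm_ge_zero[of T] by linarith
  \<comment> \<open>Chosen so that the losses s, \<open>norm T * s\<close> and \<open>e / 2\<close>
    add up to e.\<close>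
  define s where "s = e / (2 * t)"
  have s: "s > 0" "s * t = e / 2"
    using e t by (simp_all add: s_def)
  have linT: "complex_linear T"
    using T by (simp add: dunford_pettis_def)
  have "eventually (\<lambda>k. norm (diagonal T {k}) < e / 2) sequentially"
    using tendsto_norm_zero[OF diagonal_singleton_null[OF T]] e by (intro order_tendstoD(2)[where y=0]) auto
  then obtain N where N: "\<And>k. k \<ge> N \<Longrightarrow> norm (diagonal T {k}) \<le> e / 2"
    unfolding eventually_sequentially by (meson less_imp_le)
  \<comment> \<open>The block \<open>{N..<n}\<close> begins late enough for the diagonal of T to be
    small on it, and is long enough for the second moment bound \<open>1 / A\<close> to be at most
    \<open>s\<^sup>2\<close>.\<close>
  obtain n where n: "1 / s\<^sup>2 \<le> (\<Sum>k\<in>{N..<n}. (a k)\<^sup>2)"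
    using diverges by blast
  define J where "J = {N..<n}"
  define A where "A = (\<Sum>k\<in>J. (a k)\<^sup>2)"
  have J: "finite J" "J \<subseteq> {..<n}"
    by (auto simp: J_def)
  have "1 / s\<^sup>2 > 0"
    using s by simp
  then have A: "A > 0" "1 / s\<^sup>2 \<le> A"
    using n unfolding A_def J_def by linarith+
  have sqrtA: "sqrt (1 / A) \<le> s"
  proof (rule real_le_lsqrt)
    show "1 / A \<le> s\<^sup>2"
      using A s by (simp add: field_simps)
  qed (use s A in auto)
  define m where "m \<omega> = (\<Sum>k\<in>J. (a k)\<^sup>2 / A * rademacher k \<omega>)" for \<omega>
  define S where "S \<omega> = (\<Sum>k\<in>J. a k / A * rademacher k \<omega>)" for \<omega>
  define g where "g \<omega> = max (-1) (min 1 (S \<omega>))" for \<omega>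
  have weights: "(\<Sum>k\<in>J. (a k)\<^sup>2 / A) = 1"
    using A(1) by (simp add: sum_divide_distrib[symmetric] A_def[symmetric])
  have m_le: "\<bar>m \<omega>\<bar> \<le> 1" for \<omega>
  proof -
    have "\<bar>m \<omega>\<bar> \<le> (\<Sum>k\<in>J. \<bar>(a k)\<^sup>2 / A * rademacher k \<omega>\<bar>)"
      unfolding m_def by (rule sum_abs)
    also have "\<dots> = 1"
      using A(1) by (simp add: abs_mult weights)
    finally show ?thesis .
  qed
  have "depends_below n S"
    unfolding depends_below_def S_def rademacher_def using J(2)
    by (intro allI impI sum.cong refl) (auto simp: subset_iff)
  then have "depends_below n (\<lambda>\<omega>. complex_of_real (g \<omega>))"
    unfolding depends_below_def g_def by metis
  then obtain c where c: "(\<lambda>\<omega>. complex_of_real (g \<omega>)) = walsh_sum n c"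
    using walsh_expansion by blast
  define p where "p F = (\<Prod>k\<in>F. complex_of_real (a k))" for F
  \<comment> \<open>The Walsh coefficients of m: weight \<open>(a k)\<^sup>2 / A\<close> at each
    singleton from the block, and 0 elsewhere.\<close>
  define mc where "mc F = (\<Sum>k\<in>J. if F = {k} then complex_of_real ((a k)\<^sup>2 / A) else 0)" for F
  have mc: "(\<Sum>F\<in>Pow {..<n}. mc F * z F) = (\<Sum>k\<in>J. complex_of_real ((a k)\<^sup>2 / A) * z {k})" for z
  proof -
    have "(\<Sum>F\<in>Pow {..<n}. mc F * z F)
        = (\<Sum>k\<in>J. \<Sum>F\<in>Pow {..<n}. if F = {k} then complex_of_real ((a k)\<^sup>2 / A) * z {k} else 0)"
      unfolding mc_def sum_distrib_right by (subst sum.swap) (intro sum.cong refl, auto)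
    also have "\<dots> = (\<Sum>k\<in>J. complex_of_real ((a k)\<^sup>2 / A) * z {k})"
      using J by (intro sum.cong refl) auto
    finally show ?thesis .
  qed
  have m_eq: "walsh_sum n mc \<omega> = complex_of_real (m \<omega>)" for \<omega>
    unfolding walsh_sum_def mc by (simp add: m_def of_real_rademacher)
  interpret P: prob_space "biased_coins a"
    by (rule prob_space_biased_coins)
  have h: "walsh_sum n (\<lambda>F. p F * c F) \<omega> = complex_of_real (\<integral>\<omega>'. g (bxor \<omega> \<omega>') \<partial>biased_coins a)" for \<omega>
  proof -
    have "complex_of_real (\<integral>\<omega>'. g (bxor \<omega> \<omega>') \<partial>biased_coins a) = (\<integral>\<omega>'. walsh_sum n c (bxor \<omega> \<omega>') \<partial>biased_coins a)"
      unfolding c[symmetric] by (rule integral_complex_of_real[symmetric])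
    also have "\<dots> = (\<integral>\<omega>'. (\<Sum>F\<in>Pow {..<n}. c F * walsh F \<omega> * walsh F \<omega>') \<partial>biased_coins a)"
      by (simp add: walsh_sum_def walsh_bxor mult_ac)
    also have "\<dots> = (\<Sum>F\<in>Pow {..<n}. c F * walsh F \<omega> * (\<integral>\<omega>'. walsh F \<omega>' \<partial>biased_coins a))"
      using integrable_walsh_sum(2)[OF P.finite_measure_axioms sets_biased_coins]
      by (subst Bochner_Integration.integral_sum) auto
    also have "\<dots> = (\<Sum>F\<in>Pow {..<n}. c F * walsh F \<omega> * p F)"
      using a by (intro sum.cong refl) (auto simp: p_def integral_walsh_biased_coins finite_subset)
    finally show ?thesis
      by (simp add: walsh_sum_def mult_ac)
  qed
  have [measurable]: "S \<in> borel_measurable bits"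
    unfolding S_def by measurable
  have [measurable]: "g \<in> borel_measurable bits"
    unfolding g_def by measurable
  have close: "norm (walsh_sum n (\<lambda>F. p F * c F - mc F) \<omega>) \<le> s" for \<omega>
  proof -
    have int_g: "integrable (biased_coins a) (\<lambda>\<omega>'. g (bxor \<omega> \<omega>'))"
      by (rule P.integrable_const_bound[where B=1]) (auto simp: g_def)
    have int_S: "integrable (biased_coins a) (\<lambda>\<omega>'. S (bxor \<omega> \<omega>'))"
      unfolding S_def rademacher_bxor using integrable_rademacher by (simp add: mult.assoc[symmetric])
    have "walsh_sum n (\<lambda>F. p F * c F - mc F) \<omega> = walsh_sum n (\<lambda>F. p F * c F) \<omega> - walsh_sum n mc \<omega>"
      by (simp add: walsh_sum_def left_diff_distrib sum_subtractf)
    also have "\<dots> = complex_of_real (\<integral>\<omega>'. g (bxor \<omega> \<omega>') - m \<omega> \<partial>biased_coins a)"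
      unfolding h m_eq using int_g by (simp add: P.prob_space)
    also have "norm \<dots> \<le> (\<integral>\<omega>'. \<bar>g (bxor \<omega> \<omega>') - m \<omega>\<bar> \<partial>biased_coins a)"
      unfolding norm_of_real by (rule integral_abs_bound)
    also have "\<dots> \<le> (\<integral>\<omega>'. \<bar>S (bxor \<omega> \<omega>') - m \<omega>\<bar> \<partial>biased_coins a)"
    proof (intro integral_mono)
      \<comment> \<open>Clamping to [-1, 1] does not increase the distance to a point of that
        interval.\<close>
      show "\<bar>g (bxor \<omega> \<omega>') - m \<omega>\<bar> \<le> \<bar>S (bxor \<omega> \<omega>') - m \<omega>\<bar>" for \<omega>'
        using m_le[of \<omega>] unfolding g_def by linarith
    qed (use int_g int_S in auto)
    \<comment> \<open>As \<open>rademacher k\<close> has mean \<open>a k\<close>, the number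
      \<open>m \<omega>\<close> is the mean of S translated by \<omega>, and the difference is a sum
      of centred signs.\<close>
    also have "\<dots> = (\<integral>\<omega>'. \<bar>\<Sum>k\<in>J. a k / A * rademacher k \<omega> * (rademacher k \<omega>' - a k)\<bar> \<partial>biased_coins a)"
      unfolding S_def m_def rademacher_bxor sum_subtractf[symmetric]
      by (intro Bochner_Integration.integral_cong refl arg_cong[where f=abs] sum.cong)
        (simp add: algebra_simps power2_eq_square diff_divide_distrib)
    also have "\<dots> \<le> sqrt (\<Sum>k\<in>J. (a k / A * rademacher k \<omega>)\<^sup>2)"
      by (rule rademacher_sum_deviation[OF a J(1)])
    also have "(\<Sum>k\<in>J. (a k / A * rademacher k \<omega>)\<^sup>2) = (\<Sum>k\<in>J. (a k)\<^sup>2) / A\<^sup>2"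
      unfolding sum_divide_distrib
      by (intro sum.cong refl) (simp add: rademacher_def power_mult_distrib power_divide)
    also have "\<dots> = 1 / A"
      unfolding A_def[symmetric] using A(1) by (simp add: power2_eq_square)
    also note sqrtA
    finally show ?thesis .
  qed
  have "1 - s \<le> norm (\<Sum>F\<in>Pow {..<n}. p F * c F)"
  proof -
    \<comment> \<open>At the group identity every Walsh function is 1, so sums of coefficients
      become values of functions; there m equals 1.\<close>
    define o0 where "o0 = (\<lambda>k::nat. False)"
    have "walsh_sum n q o0 = (\<Sum>F\<in>Pow {..<n}. q F)" for q
      by (simp add: walsh_sum_def walsh_def o0_def)
    note * = this[of "\<lambda>F. p F * c F"] this[of "\<lambda>F. p F * c F - mc F"] this[of mc]
    have "walsh_sum n mc o0 = 1"
      using weights by (simp add: m_eq m_def rademacher_def o0_def)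
    then have "(\<Sum>F\<in>Pow {..<n}. p F * c F) = 1 + walsh_sum n (\<lambda>F. p F * c F - mc F) o0"
      using * by (simp add: sum_subtractf)
    moreover have "norm (1 :: complex) - norm (walsh_sum n (\<lambda>F. p F * c F - mc F) o0)
        \<le> norm (1 + walsh_sum n (\<lambda>F. p F * c F - mc F) o0)"
      by (rule norm_diff_ineq)
    ultimately show ?thesis
      using close[of o0] by simp
  qed
  moreover have "norm (\<Sum>F\<in>Pow {..<n}. (p F * c F - mc F) * diagonal T F) \<le> norm T * s"
    by (rule norm_diagonal_sum_le[OF linT close])
  moreover have "norm (\<Sum>F\<in>Pow {..<n}. mc F * diagonal T F) \<le> e / 2"
  proof -
    have "norm (\<Sum>F\<in>Pow {..<n}. mc F * diagonal T F) \<le> (\<Sum>k\<in>J. (a k)\<^sup>2 / A * (e / 2))"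
      unfolding mc
    proof (rule sum_norm_le)
      fix k assume "k \<in> J"
      then have "norm (diagonal T {k}) \<le> e / 2"
        by (intro N) (simp add: J_def)
      then have "\<bar>(a k)\<^sup>2 / A\<bar> * norm (diagonal T {k}) \<le> (a k)\<^sup>2 / A * (e / 2)"
        using A(1) by (intro mult_mono) auto
      then show "norm (complex_of_real ((a k)\<^sup>2 / A) * diagonal T {k}) \<le> (a k)\<^sup>2 / A * (e / 2)"
        by (simp only: norm_mult norm_of_real)
    qed
    also have "\<dots> = e / 2"
      unfolding sum_distrib_right[symmetric] weights by simp
    finally show ?thesis .
  qed
  moreover have "(\<Sum>F\<in>Pow {..<n}. c F * diagonal V F) = (\<Sum>F\<in>Pow {..<n}. p F * c F)
      - (\<Sum>F\<in>Pow {..<n}. (p F * c F - mc F) * diagonal T F) - (\<Sum>F\<in>Pow {..<n}. mc F * diagonal T F)"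
  proof -
    have "(\<Sum>F\<in>Pow {..<n}. c F * diagonal V F)
        = (\<Sum>F\<in>Pow {..<n}. p F * c F - (p F * c F - mc F) * diagonal T F - mc F * diagonal T F)"
      by (intro sum.cong refl, subst diag) (auto simp: p_def algebra_simps intro: finite_subset)
    then show ?thesis
      by (simp only: sum_subtractf)
  qed
  moreover have "norm (\<Sum>F\<in>Pow {..<n}. c F * diagonal V F) \<le> norm V * 1"
    by (rule norm_diagonal_sum_le[OF V]) (simp add: c[symmetric, THEN fun_cong] g_def)
  moreover have "norm x - norm y - norm z \<le> norm (x - y - z)" for x y z :: complex
    using norm_triangle_ineq2[of x y] norm_triangle_ineq2[of "x - y" z] by linarith
  ultimately have "1 - s - norm T * s - e / 2 \<le> norm V"
    by (smt (verit, best))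
  then show "1 \<le> norm V + e"
    using s(2) by (simp add: t_def algebra_simps)
qed

lemma dunford_pettis_far:
  "\<exists>R \<in> (dunford_pettis :: ('a l1 \<Rightarrow>\<^sub>L 'a l1) set). positive_operator R \<and> norm R = 1 \<and>
     (\<forall>T \<in> dunford_pettis. norm (R - (R o\<^sub>L T)) \<ge> 1 \<and> norm (R - (T o\<^sub>L R)) \<ge> 1)"
proof -
  \<comment> \<open>Any decreasing null sequence in [0, 1] with divergent squares would serve; here
    the squares form the harmonic series.\<close>
  define a :: "nat \<Rightarrow> real" where "a k = 1 / sqrt (real (Suc k))" for k
  have a: "\<forall>k. 0 \<le> a k \<and> a k \<le> 1" "\<forall>k. \<bar>a k\<bar> \<le> 1"
    by (auto simp: a_def)
  have a_decseq: "decseq a"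
    unfolding decseq_def a_def by (intro allI impI divide_left_mono) auto
  have a_null: "a \<longlonglongrightarrow> 0"
  proof -
    have "(\<lambda>k. sqrt (1 / real (Suc k))) \<longlonglongrightarrow> sqrt 0"
      using LIMSEQ_inverse_real_of_nat by (intro tendsto_real_sqrt) (simp add: inverse_eq_divide)
    then show ?thesis
      by (simp add: a_def[abs_def] real_sqrt_divide)
  qed
  have a_sq: "(a k)\<^sup>2 = inverse (real (Suc k))" for k
    by (simp add: a_def power_divide inverse_eq_divide)
  have diverges: "\<exists>n. L \<le> (\<Sum>k\<in>{N..<n}. (a k)\<^sup>2)" for N L
  proof (rule ccontr)
    assume *: "\<not> ?thesis"
    have "summable (\<lambda>k. (a k)\<^sup>2)"
    proof (rule bounded_imp_summable)
      fix n
      have "(\<Sum>k\<le>n. (a k)\<^sup>2) \<le> (\<Sum>k\<in>{..<N} \<union> {N..<Suc n}. (a k)\<^sup>2)"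
        by (intro sum_mono2) auto
      also have "\<dots> = (\<Sum>k<N. (a k)\<^sup>2) + (\<Sum>k\<in>{N..<Suc n}. (a k)\<^sup>2)"
        by (intro sum.union_disjoint) auto
      also have "\<dots> \<le> (\<Sum>k<N. (a k)\<^sup>2) + L"
        using * by (intro add_left_mono) (meson not_le less_imp_le)
      finally show "(\<Sum>k\<le>n. (a k)\<^sup>2) \<le> (\<Sum>k<N. (a k)\<^sup>2) + L" .
    qed simp
    then have "summable (\<lambda>k. inverse (real (Suc k)))"
      by (simp only: a_sq)
    then show False
      using not_summable_harmonic[where ?'a=real] by (subst (asm) summable_Suc_iff) simp
  qed
  note lin = complex_linear_coin_op[OF a(2)]
  show ?thesis
  proof (intro bexI conjI ballI)
    show "coin_op a \<in> dunford_pettis"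
      by (rule coin_op_dunford_pettis[OF a(1) a_decseq a_null])
    show "positive_operator (coin_op a)" "norm (coin_op a) = 1"
      by (rule positive_coin_op[OF a(2)] norm_coin_op[OF a(2)])+
    fix T :: "'a l1 \<Rightarrow>\<^sub>L 'a l1" assume T: "T \<in> dunford_pettis"
    then have linT: "complex_linear T"
      by (simp add: dunford_pettis_def)
    have coeff_scale: "blinfun_apply (walsh_coeff F) (z *\<^sub>C x) = z * blinfun_apply (walsh_coeff F) x" for F z x
      using complex_linear_walsh_coeff by (simp add: complex_linear_def scaleC_complex_def)
    show "1 \<le> norm (coin_op a - (coin_op a o\<^sub>L T))"
    proof (rule norm_ge_1_if_diagonal[OF a(2) diverges T complex_linear_diff[OF lin complex_linear_compose[OF lin linT]]])
      \<comment> \<open>The averaging comes after T, so its effect is read off from the coefficient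
        of an arbitrary vector by \<open>walsh_coeff_coin_op\<close>.\<close>
      show "diagonal (coin_op a - (coin_op a o\<^sub>L T)) F = (\<Prod>k\<in>F. complex_of_real (a k)) * (1 - diagonal T F)"
        if "finite F" for F
        using that unfolding diagonal_def
        by (simp add: blinfun.diff_left blinfun.diff_right walsh_coeff_coin_op a walsh_coeff_walsh algebra_simps)
    qed
    show "1 \<le> norm (coin_op a - (T o\<^sub>L coin_op a))"
    proof (rule norm_ge_1_if_diagonal[OF a(2) diverges T complex_linear_diff[OF lin complex_linear_compose[OF linT lin]]])
      \<comment> \<open>The averaging comes before T and merely scales the Walsh function.\<close>
      show "diagonal (coin_op a - (T o\<^sub>L coin_op a)) F = (\<Prod>k\<in>F. complex_of_real (a k)) * (1 - diagonal T F)"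
        if "finite F" for F
        using that linT unfolding diagonal_def complex_linear_def
        by (simp add: blinfun.diff_left blinfun.diff_right coin_op_walsh a walsh_coeff_walsh coeff_scale algebra_simps)
    qed
  qed
qed

end

section \<open>Binary digits on the circle and on the interval\<close>

text \<open>Index 0 is the first digit after the binary point. The floor makes the digit 1-periodic
  in y and selects the terminating expansion of dyadic numbers.\<close>

definition digit :: "real \<Rightarrow> nat \<Rightarrow> bool" where
  "digit y k \<longleftrightarrow> odd \<lfloor>y * 2 ^ Suc k\<rfloor>"

definition from_digits :: "(nat \<Rightarrow> bool) \<Rightarrow> real" where
  "from_digits \<omega> = (\<Sum>k. if \<omega> k then (1 / 2) ^ Suc k else 0)"

lemma measurable_digit [measurable]: "(\<lambda>y. digit y k) \<in> borel \<rightarrow>\<^sub>M count_space UNIV"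
  unfolding digit_def by measurable

lemma measurable_from_digits [measurable]: "from_digits \<in> borel_measurable bits"
  unfolding from_digits_def by measurable

text \<open>At positions j \<ge> k the floor moves by an even integer; carries run only towards
  smaller indices.\<close>

lemma digit_shift:
  assumes "j \<ge> k"
  shows "digit (y + (1 / 2) ^ k) j = digit y j"
proof -
  have "(1 / 2 :: real) ^ k * 2 ^ Suc j = of_int (2 * 2 ^ (j - k))"
    using power_add[of "2::real" k "j - k"] assms by (simp add: power_divide)
  then have "\<lfloor>(y + (1 / 2) ^ k) * 2 ^ Suc j\<rfloor> = \<lfloor>y * 2 ^ Suc j\<rfloor> + 2 * 2 ^ (j - k)"
    by (simp only: distrib_right floor_add_int)
  then show ?thesis
    by (simp add: digit_def)
qed

lemma digit_flip: "digit (y + (1 / 2) ^ Suc k) k \<longleftrightarrow> \<not> digit y k"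
proof -
  have "(1 / 2 :: real) ^ Suc k * 2 ^ Suc k = of_int 1"
    by (simp add: power_divide)
  then have "\<lfloor>(y + (1 / 2) ^ Suc k) * 2 ^ Suc k\<rfloor> = \<lfloor>y * 2 ^ Suc k\<rfloor> + 1"
    by (simp only: distrib_right floor_add_int)
  then show ?thesis
    by (simp add: digit_def)
qed

lemma digit_cong:
  assumes "y - z \<in> \<int>"
  shows "digit y k = digit z k"
proof -
  obtain m :: int where m: "y - z = of_int m"
    using assms by (auto elim: Ints_cases)
  have "y * 2 ^ Suc k = z * 2 ^ Suc k + of_int (2 * (m * 2 ^ k))"
    using m by (simp add: algebra_simps)
  then have "\<lfloor>y * 2 ^ Suc k\<rfloor> = \<lfloor>z * 2 ^ Suc k\<rfloor> + 2 * (m * 2 ^ k)"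
    by (simp only: floor_add_int)
  then show ?thesis
    by (simp add: digit_def)
qed

lemma partial_digits:
  assumes "0 \<le> y" "y < 1"
  shows "(\<Sum>k<n. if digit y k then (1 / 2) ^ Suc k else 0) = real_of_int \<lfloor>y * 2 ^ n\<rfloor> / 2 ^ n"
proof (induction n)
  case 0
  have "\<lfloor>y\<rfloor> = 0"
    using assms by (simp add: floor_eq_iff)
  then show ?case
    by simp
next
  case (Suc n)
  define u where "u = \<lfloor>y * 2 ^ n\<rfloor>"
  define v where "v = \<lfloor>y * 2 ^ Suc n\<rfloor>"
  have "of_int u \<le> y * 2 ^ n" "y * 2 ^ n < of_int u + 1"
    by (simp_all add: u_def)
  then have "of_int (2 * u) \<le> y * 2 ^ Suc n" "y * 2 ^ Suc n < of_int (2 * u + 2)"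
    by (simp_all add: algebra_simps)
  \<comment> \<open>The new floor is twice the old one or one more, and the extra one is the new
    digit.\<close>
  then have "2 * u \<le> v" "v < 2 * u + 2"
    unfolding v_def by (simp_all only: le_floor_iff floor_less_iff)
  then have "v div 2 = u"
    by linarith
  then have "v = 2 * u + of_bool (odd v)"
    using div_mult_mod_eq[of v 2] by (simp add: mod_2_eq_odd)
  then have "real_of_int v = real_of_int (2 * u + of_bool (odd v))"
    by (rule arg_cong)
  then have "real_of_int v / 2 ^ Suc n = real_of_int u / 2 ^ n + (if odd v then (1 / 2) ^ Suc n else 0)"
    by (simp add: field_simps power_divide)
  then show ?case
    using Suc.IH by (simp add: digit_def u_def v_def)
qed

lemma from_digits_digit:
  assumes "0 \<le> y" "y < 1"
  shows "from_digits (digit y) = y"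
proof -
  have "(\<lambda>n. of_int \<lfloor>y * 2 ^ n\<rfloor> / 2 ^ n) \<longlonglongrightarrow> y"
  proof (rule tendsto_sandwich)
    show "eventually (\<lambda>n. y - (1 / 2) ^ n \<le> of_int \<lfloor>y * 2 ^ n\<rfloor> / 2 ^ n) sequentially"
    proof (intro always_eventually allI)
      fix n
      have "y * 2 ^ n - 1 \<le> of_int \<lfloor>y * 2 ^ n\<rfloor>"
        by linarith
      then have "(y * 2 ^ n - 1) / 2 ^ n \<le> of_int \<lfloor>y * 2 ^ n\<rfloor> / 2 ^ n"
        by (rule divide_right_mono) simp
      then show "y - (1 / 2) ^ n \<le> of_int \<lfloor>y * 2 ^ n\<rfloor> / 2 ^ n"
        by (simp add: diff_divide_distrib power_divide)
    qed
    show "eventually (\<lambda>n. of_int \<lfloor>y * 2 ^ n\<rfloor> / 2 ^ n \<le> y) sequentially"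
      by (intro always_eventually allI) (simp add: divide_le_eq)
    show "(\<lambda>n. y - (1 / 2) ^ n) \<longlonglongrightarrow> y"
      using tendsto_diff[OF tendsto_const LIMSEQ_power_zero[of "1 / 2 :: real"], of y] by simp
  qed simp
  then have "(\<lambda>k. if digit y k then (1 / 2) ^ Suc k else 0) sums y"
    unfolding sums_def by (simp only: partial_digits[OF assms])
  then show ?thesis
    unfolding from_digits_def by (rule sums_unique[symmetric])
qed

section \<open>Digits on the circle\<close>

definition circle_coord :: "circle \<Rightarrow> real" where
  "circle_coord x = frac (rep_circle x)"

lemma to_circle_rep: "to_circle (rep_circle x) = x"
  using Quotient_abs_rep[OF Quotient_circle] .

lemma to_circle_coord [simp]: "to_circle (circle_coord x) = x"
proof -
  have "to_circle (circle_coord x) = to_circle (rep_circle x)"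
    by (simp add: to_circle_eq_iff circle_coord_def frac_def)
  then show ?thesis
    by (simp add: to_circle_rep)
qed

lemma circle_coord_bounds: "0 \<le> circle_coord x" "circle_coord x < 1"
  by (simp_all add: circle_coord_def frac_lt_1)

lemma circle_coord_to_circle: "circle_coord (to_circle y) = frac y"
proof -
  have "rep_circle (to_circle y) - y \<in> \<int>"
    using to_circle_rep[of "to_circle y"] by (simp add: to_circle_eq_iff)
  then obtain m :: int where "rep_circle (to_circle y) - y = of_int m"
    by (rule Ints_cases)
  then have "rep_circle (to_circle y) = y + of_int m"
    by simp
  then show ?thesis
    by (simp add: circle_coord_def frac_def)
qed

text \<open>The coordinate is discontinuous only at 0, where it takes its least value, so it is
  lower semicontinuous.\<close>

lemma measurable_circle_coord [measurable]: "circle_coord \<in> borel_measurable borel"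
proof (subst borel_measurable_iff_greater, rule allI)
  fix a :: real
  have "open {x. a < circle_coord x}"
  proof (cases "a < 0")
    case True
    then have "{x. a < circle_coord x} = UNIV"
      using circle_coord_bounds(1) by (auto intro: less_le_trans)
    then show ?thesis
      by simp
  next
    case False
    have "to_circle -` {x. a < circle_coord x} = (\<Union>n::int. {a + of_int n<..<1 + of_int n})"
    proof (intro equalityI subsetI)
      fix y assume "y \<in> to_circle -` {x. a < circle_coord x}"
      then have "a < frac y"
        by (simp add: circle_coord_to_circle)
      then have "y \<in> {a + of_int \<lfloor>y\<rfloor><..<1 + of_int \<lfloor>y\<rfloor>}"
        using frac_lt_1[of y] by (auto simp: frac_def)
      then show "y \<in> (\<Union>n::int. {a + of_int n<..<1 + of_int n})"
        by blast
    next
      fix y assume "y \<in> (\<Union>n::int. {a + of_int n<..<1 + of_int n})"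
      then obtain n :: int where n: "a + of_int n < y" "y < 1 + of_int n"
        by auto
      then have "\<lfloor>y\<rfloor> = n"
        using False by (auto simp: floor_eq_iff)
      then show "y \<in> to_circle -` {x. a < circle_coord x}"
        using n by (simp add: circle_coord_to_circle frac_def)
    qed
    then show ?thesis
      by (auto simp: open_circle_def)
  qed
  then show "{x \<in> space borel. a < circle_coord x} \<in> sets borel"
    by simp
qed

definition circle_digits :: "circle \<Rightarrow> nat \<Rightarrow> bool" where
  "circle_digits x = digit (circle_coord x)"

text \<open>Periodicity allows any real representative, so translation on the circle becomes
  addition of reals.\<close>

lemma circle_digits_to_circle: "circle_digits (to_circle y) k = digit y k"
  unfolding circle_digits_def by (rule digit_cong) (simp add: circle_coord_to_circle frac_def)

lemma space_circle [simp]: "space (base_measure :: circle measure) = UNIV"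
  using sets_eq_imp_space_eq[OF sets_base_measure_circle] by simp

lemma measurable_circle_digits [measurable]: "circle_digits \<in> base_measure \<rightarrow>\<^sub>M bits"
  unfolding circle_digits_def by (rule measurable_PiM_single') auto

lemma distr_circle_translation: "distr base_measure base_measure (\<lambda>x :: circle. x + t) = base_measure"
proof (rule measure_eqI)
  fix A :: "circle set" assume "A \<in> sets (distr base_measure base_measure (\<lambda>x. x + t))"
  then have A: "A \<in> sets borel"
    by (simp add: sets_base_measure_circle)
  have "(\<lambda>x :: circle. x + t) \<in> borel \<rightarrow>\<^sub>M borel"
    by (rule borel_measurable_continuous_onI[OF continuous_circle_translation])
  then have "(\<lambda>x :: circle. x + t) \<in> base_measure \<rightarrow>\<^sub>M base_measure"
    by (simp cong: measurable_cong_sets add: sets_base_measure_circle)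
  then show "emeasure (distr base_measure base_measure (\<lambda>x. x + t)) A = emeasure base_measure A"
    using A emeasure_base_measure_circle_translation[OF A, of t]
    by (simp add: emeasure_distr sets_base_measure_circle)
qed simp

lemma prob_space_circle: "prob_space (base_measure :: circle measure)"
  by (rule prob_spaceI) (simp add: emeasure_base_measure_circle_UNIV)

text \<open>Translation by \<open>(1 / 2) ^ Suc k\<close>, with k the least element of F, flips
  digit k; carries reach only digits below k, which F does not contain. The Walsh function changes
  sign while Haar measure is invariant.\<close>

lemma integral_walsh_circle_digits:
  assumes F: "finite F" "F \<noteq> {}"
  shows "(\<integral>x. walsh F (circle_digits x) \<partial>base_measure) = 0"
proof -
  define k where "k = Min F"
  have k: "k \<in> F" "\<And>j. j \<in> F \<Longrightarrow> k \<le> j"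
    using F by (auto simp: k_def)
  define t where "t = to_circle ((1 / 2) ^ Suc k)"
  have flip: "walsh F (circle_digits (x + t)) = - walsh F (circle_digits x)" for x
  proof -
    define y where "y = rep_circle x"
    have x: "x = to_circle y"
      by (simp add: y_def to_circle_rep)
    have split: "walsh F z = (if z k then -1 else 1) * walsh (F - {k}) z" for z
      using walsh_insert[of "F - {k}" k z] F k(1) by (simp add: insert_absorb)
    have "circle_digits (x + t) k \<longleftrightarrow> \<not> circle_digits x k"
      by (simp add: x t_def to_circle_add[symmetric] circle_digits_to_circle digit_flip del: power_Suc)
    moreover have "walsh (F - {k}) (circle_digits (x + t)) = walsh (F - {k}) (circle_digits x)"
      unfolding walsh_def
    proof (intro prod.cong refl)
      fix j assume "j \<in> F - {k}"
      then have "Suc k \<le> j"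
        using k(2)[of j] by auto
      then show "(if circle_digits (x + t) j then -1 else 1 :: complex) = (if circle_digits x j then -1 else 1)"
        by (simp add: x t_def to_circle_add[symmetric] circle_digits_to_circle digit_shift del: power_Suc)
    qed
    ultimately show ?thesis
      by (simp add: split)
  qed
  have trans: "(\<lambda>x :: circle. x + t) \<in> base_measure \<rightarrow>\<^sub>M base_measure"
    using borel_measurable_continuous_onI[OF continuous_circle_translation]
    by (simp cong: measurable_cong_sets add: sets_base_measure_circle)
  have "(\<integral>x. walsh F (circle_digits x) \<partial>base_measure)
      = (\<integral>x. walsh F (circle_digits x) \<partial>distr base_measure base_measure (\<lambda>x. x + t))"
    by (simp add: distr_circle_translation)
  also have "\<dots> = (\<integral>x. walsh F (circle_digits (x + t)) \<partial>base_measure)"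
    by (rule integral_distr[OF trans]) (rule measurable_compose[OF measurable_circle_digits measurable_walsh])
  also have "\<dots> = - (\<integral>x. walsh F (circle_digits x) \<partial>base_measure)"
    by (simp add: flip)
  finally show ?thesis
    by simp
qed

lemma distr_circle_digits: "distr base_measure bits circle_digits = biased_coins (\<lambda>_. 0)"
proof (rule measure_eqI_walsh)
  interpret prob_space "base_measure :: circle measure"
    by (rule prob_space_circle)
  show "prob_space (distr base_measure bits circle_digits)"
    by (rule prob_space_distr) measurable
  fix F :: "nat set" assume F: "finite F"
  have "(\<integral>\<omega>. walsh F \<omega> \<partial>distr base_measure bits circle_digits) = (\<integral>x. walsh F (circle_digits x) \<partial>base_measure)"
    by (rule integral_distr) measurable
  also have "\<dots> = (if F = {} then 1 else 0)"
    using F prob_space by (auto simp: integral_walsh_circle_digits)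
  also have "\<dots> = (\<integral>\<omega>. walsh F \<omega> \<partial>biased_coins (\<lambda>_. 0))"
    using F by (subst integral_walsh_biased_coins) auto
  finally show "(\<integral>\<omega>. walsh F \<omega> \<partial>distr base_measure bits circle_digits) = (\<integral>\<omega>. walsh F \<omega> \<partial>biased_coins (\<lambda>_. 0))" .
qed (simp_all add: prob_space_biased_coins sets_biased_coins)

lemma circle_decode: "to_circle (from_digits (circle_digits x)) = x"
  unfolding circle_digits_def by (simp add: from_digits_digit circle_coord_bounds)

interpretation circle: coin_coding circle_digits "\<lambda>\<omega>. to_circle (from_digits \<omega>)"
proof (rule coin_coding.intro)
  show "prob_space (base_measure :: circle measure)"
    by (rule prob_space_circle)
  show "circle_digits \<in> base_measure \<rightarrow>\<^sub>M bits"
    by measurable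
  show "distr base_measure bits circle_digits = biased_coins (\<lambda>_. 0)"
    by (rule distr_circle_digits)
  have "(\<lambda>\<omega>. to_circle (from_digits \<omega>)) \<in> bits \<rightarrow>\<^sub>M borel"
    by measurable
  then show "(\<lambda>\<omega>. to_circle (from_digits \<omega>)) \<in> bits \<rightarrow>\<^sub>M base_measure"
    by (simp cong: measurable_cong_sets add: sets_base_measure_circle)
  show "AE x in base_measure. to_circle (from_digits (circle_digits x)) = x"
    by (simp add: circle_decode)
qed

section \<open>From the circle to the interval\<close>

definition circle_to_interval :: "circle \<Rightarrow> unit_interval" where
  "circle_to_interval x = Abs_unit_interval (circle_coord x)"

definition interval_to_circle :: "unit_interval \<Rightarrow> circle" where
  "interval_to_circle y = to_circle (Rep_unit_interval y)"

lemma interval_to_circle_to_interval: "interval_to_circle (circle_to_interval x) = x"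
  using circle_coord_bounds[of x]
  by (simp add: interval_to_circle_def circle_to_interval_def Abs_unit_interval_inverse)

lemma measurable_circle_to_interval [measurable]: "circle_to_interval \<in> base_measure \<rightarrow>\<^sub>M base_measure"
proof -
  have "circle_coord \<in> base_measure \<rightarrow>\<^sub>M restrict_space lborel {0..1}"
    using circle_coord_bounds(1) less_imp_le[OF circle_coord_bounds(2)] by (intro measurable_restrict_space2) auto
  moreover have "Abs_unit_interval \<in> restrict_space lborel {0..1} \<rightarrow>\<^sub>M base_measure"
    unfolding base_measure_unit_interval_def
    by (rule measurable_embed_measure2') (simp add: space_restrict_space inj_on_Abs_unit_interval)
  ultimately show ?thesis
    unfolding circle_to_interval_def[abs_def] by (rule measurable_compose)
qed

lemma measurable_interval_to_circle [measurable]: "interval_to_circle \<in> base_measure \<rightarrow>\<^sub>M base_measure"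
proof -
  have "interval_to_circle \<in> base_measure \<rightarrow>\<^sub>M borel"
    unfolding base_measure_unit_interval_def
  proof (rule measurable_embed_measure1)
    have "to_circle \<in> restrict_space lborel {0..1} \<rightarrow>\<^sub>M borel"
      by (intro measurable_restrict_space1) simp
    then show "(\<lambda>x. interval_to_circle (Abs_unit_interval x)) \<in> restrict_space lborel {0..1} \<rightarrow>\<^sub>M borel"
      by (rule measurable_cong[THEN iffD1, rotated])
        (simp add: space_restrict_space interval_to_circle_def Abs_unit_interval_inverse)
  qed
  then show ?thesis
    by (simp cong: measurable_cong_sets add: sets_base_measure_circle)
qed

lemma distr_circle_to_interval: "distr base_measure base_measure circle_to_interval = base_measure"
proof (rule measure_eqI)
  fix A assume "A \<in> sets (distr base_measure base_measure circle_to_interval)"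
  then have A: "A \<in> sets base_measure"
    by simp
  then obtain C where C: "A = Abs_unit_interval ` C" "C \<in> sets (restrict_space lborel {0..1})"
    unfolding base_measure_unit_interval_def
    by (subst (asm) sets_embed_measure') (auto simp: space_restrict_space inj_on_Abs_unit_interval)
  then have C': "C \<in> sets borel" "C \<subseteq> {0..1}"
    by (auto simp: sets_restrict_space)
  have "circle_to_interval -` A \<in> sets borel"
    using measurable_sets[OF measurable_circle_to_interval A] by (simp add: sets_base_measure_circle)
  then have "emeasure (distr base_measure base_measure circle_to_interval) A
      = emeasure lborel (to_circle -` circle_to_interval -` A \<inter> {0..<1})"
    using A by (simp add: emeasure_distr emeasure_base_measure_circle)
  \<comment> \<open>The coordinate of a point of the circle never equals 1, so the end point drops
    out.\<close>
  also have "to_circle -` circle_to_interval -` A \<inter> {0..<1} = C - {1}"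
  proof -
    have "circle_to_interval (to_circle y) \<in> A \<longleftrightarrow> y \<in> C" if "0 \<le> y" "y < 1" for y
    proof -
      have "frac y = y"
        using that by (simp add: frac_eq)
      then show ?thesis
        using that C'(2) by (auto simp: C(1) circle_to_interval_def circle_coord_to_circle image_iff
            Abs_unit_interval_inject subset_iff)
    qed
    then show ?thesis
      using C'(2) by (auto simp: subset_iff less_le)
  qed
  also have "emeasure lborel (C - {1}) = emeasure lborel C"
    using C'(1) by (intro emeasure_Diff_null_set) auto
  also have "\<dots> = emeasure base_measure A"
    using emeasure_base_measure_unit_interval[OF C'] by (simp add: C(1))
  finally show "emeasure (distr base_measure base_measure circle_to_interval) A = emeasure base_measure A" .
qed simp

interpretation interval: coin_coding "\<lambda>y. circle_digits (interval_to_circle y)"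
  "\<lambda>\<omega>. circle_to_interval (to_circle (from_digits \<omega>))"
proof (rule coin_coding.intro)
  show "prob_space (base_measure :: unit_interval measure)"
    using circle.prob_space_distr[OF measurable_circle_to_interval] by (simp only: distr_circle_to_interval)
  show meas: "(\<lambda>y. circle_digits (interval_to_circle y)) \<in> base_measure \<rightarrow>\<^sub>M bits"
    by measurable
  show "(\<lambda>\<omega>. circle_to_interval (to_circle (from_digits \<omega>))) \<in> bits \<rightarrow>\<^sub>M base_measure"
    by (rule measurable_compose[OF circle.measurable_dec measurable_circle_to_interval])
  have "distr base_measure bits (\<lambda>y. circle_digits (interval_to_circle y))
      = distr (distr base_measure base_measure circle_to_interval) bits (\<lambda>y. circle_digits (interval_to_circle y))"
    by (simp only: distr_circle_to_interval)
  also have "\<dots> = distr base_measure bits circle_digits"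
    by (subst distr_distr[OF meas measurable_circle_to_interval]) (simp add: comp_def interval_to_circle_to_interval)
  finally show "distr base_measure bits (\<lambda>y. circle_digits (interval_to_circle y)) = biased_coins (\<lambda>_. 0)"
    by (simp only: distr_circle_digits)
  \<comment> \<open>The end point 1 goes to the same point of the circle as 0 and cannot be decoded;
    it is a null set.\<close>
  have "{1} \<in> sets (restrict_space lborel {0..1::real})"
    by (auto simp: sets_restrict_space)
  then have "Abs_unit_interval ` {1} \<in> sets base_measure"
    unfolding base_measure_unit_interval_def
    by (subst sets_embed_measure') (auto simp: space_restrict_space inj_on_Abs_unit_interval)
  then have "Abs_unit_interval ` {1} \<in> null_sets base_measure"
    using emeasure_base_measure_unit_interval[of "{1}"] by (simp add: null_sets_def)
  then have "AE y in base_measure. y \<notin> Abs_unit_interval ` {1}"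
    by (rule AE_not_in)
  then show "AE y in base_measure. circle_to_interval (to_circle (from_digits (circle_digits (interval_to_circle y)))) = y"
  proof eventually_elim
    case (elim y)
    have "Rep_unit_interval y \<noteq> 1"
      using elim Rep_unit_interval_inverse[of y] by auto
    then have "0 \<le> Rep_unit_interval y" "Rep_unit_interval y < 1"
      using Rep_unit_interval[of y] by auto
    then have "frac (Rep_unit_interval y) = Rep_unit_interval y"
      by (simp add: frac_eq)
    then show ?case
      by (simp add: circle_decode circle_to_interval_def interval_to_circle_def circle_coord_to_circle
          Rep_unit_interval_inverse)
  qed
qed

text \<open>One index suffices to contradict a uniform lower bound; by reflexivity the start of a
  tail belongs to the tail.\<close>

lemma net_null_below:
  assumes I: "directed_preorder I le" and null: "net_null I le r" and \<epsilon>: "\<epsilon> > 0"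
  obtains i where "i \<in> I" "\<bar>r i\<bar> < \<epsilon>"
proof -
  obtain i where i: "i \<in> I" "\<forall>j\<in>I. le i j \<longrightarrow> \<bar>r j\<bar> < \<epsilon>"
    using null \<epsilon> unfolding net_null_def by blast
  have "le i i"
    using I i(1) unfolding directed_preorder_def by blast
  with i show ?thesis
    by (intro that) auto
qed

theorem theorem1p1:
  shows "(\<exists>R \<in> (dunford_pettis :: (circle l1 \<Rightarrow>\<^sub>L circle l1) set).
            positive_operator R \<and> norm R = 1 \<and>
            (\<forall>T \<in> (dunford_pettis :: (circle l1 \<Rightarrow>\<^sub>L circle l1) set).
               norm (R - (R o\<^sub>L T)) \<ge> 1 \<and> norm (R - (T o\<^sub>L R)) \<ge> 1)) \<and>
         \<not> (\<exists>(I :: 'i set) le e. right_approximate_identity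
               (dunford_pettis :: (unit_interval l1 \<Rightarrow>\<^sub>L unit_interval l1) set) I le e) \<and>
         \<not> (\<exists>(I :: 'i set) le e. left_approximate_identity
               (dunford_pettis :: (unit_interval l1 \<Rightarrow>\<^sub>L unit_interval l1) set) I le e)"
proof (intro conjI notI)
  show "\<exists>R \<in> (dunford_pettis :: (circle l1 \<Rightarrow>\<^sub>L circle l1) set).
            positive_operator R \<and> norm R = 1 \<and>
            (\<forall>T \<in> (dunford_pettis :: (circle l1 \<Rightarrow>\<^sub>L circle l1) set).
               norm (R - (R o\<^sub>L T)) \<ge> 1 \<and> norm (R - (T o\<^sub>L R)) \<ge> 1)"
    by (rule circle.dunford_pettis_far)
next
  \<comment> \<open>The interval has its own coding and hence its own operator, at distance at least
    1 from all products with a Dunford--Pettis operator.\<close>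
  obtain R :: "unit_interval l1 \<Rightarrow>\<^sub>L unit_interval l1" where R: "R \<in> dunford_pettis"
    "\<And>T. T \<in> dunford_pettis \<Longrightarrow> norm (R - (R o\<^sub>L T)) \<ge> 1 \<and> norm (R - (T o\<^sub>L R)) \<ge> 1"
    using interval.dunford_pettis_far by blast
  {
    assume "\<exists>(I :: 'i set) le e. right_approximate_identity
               (dunford_pettis :: (unit_interval l1 \<Rightarrow>\<^sub>L unit_interval l1) set) I le e"
    then obtain I :: "'i set" and le and e :: "'i \<Rightarrow> unit_interval l1 \<Rightarrow>\<^sub>L unit_interval l1"
      where e: "right_approximate_identity dunford_pettis I le e"
      by blast
    then obtain i where "i \<in> I" "\<bar>norm ((R o\<^sub>L e i) - R)\<bar> < 1"
      using R(1) unfolding right_approximate_identity_def by (metis net_null_below zero_less_one)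
    then show False
      using R(2)[of "e i"] e by (simp add: right_approximate_identity_def norm_minus_commute)
  next
    assume "\<exists>(I :: 'i set) le e. left_approximate_identity
               (dunford_pettis :: (unit_interval l1 \<Rightarrow>\<^sub>L unit_interval l1) set) I le e"
    then obtain I :: "'i set" and le and e :: "'i \<Rightarrow> unit_interval l1 \<Rightarrow>\<^sub>L unit_interval l1"
      where e: "left_approximate_identity dunford_pettis I le e"
      by blast
    then obtain i where "i \<in> I" "\<bar>norm ((e i o\<^sub>L R) - R)\<bar> < 1"
      using R(1) unfolding left_approximate_identity_def by (metis net_null_below zero_less_one)
    then show False
      using R(2)[of "e i"] e by (simp add: left_approximate_identity_def norm_minus_commute)
  }
qed

end
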